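(* Let $n\ge 2$ be an integer, let $p<1$ be a real number and let $H$ be a linear subspace of $\mathbb{R}^n$ of dimension $k$, where $1\le k\le n-1$. Let $\mu_H$ be the Borel measure on $\mathbb{S}^{n-1}$ which is concentrated in $H$ and whose restriction to the family of Borel sets in $\mathbb{S}^{n-1}\cap H$ equals the $(k-1)$-dimensional Hausdorff measure on $\mathbb{S}^{n-1}\cap H$; that is, $\mu_H(\omega)=\mathcal{H}^{k-1}(\omega\cap H)$ for every Borel set $\omega\subseteq\mathbb{S}^{n-1}$. Then there exists no convex body $K$ in $\mathbb{R}^n$ containing the origin such that $$S_p(K,\cdot)=\mu_H .$$
   Context: $\mathbb{S}^{n-1}=\{x\in\mathbb{R}^n:|x|=1\}$ is the Euclidean unit sphere, $\langle\cdot,\cdot\rangle$ is the standard inner product, and $\mathcal{H}^a$ denotes $a$-dimensional Hausdorff measure ($\mathcal{H}^0$ is counting measure). A convex body in $\mathbb{R}^n$ is a compact convex set with non-empty interior. The support function of a convex body $K$ is $h_K(x)=\sup\{\langle x,y\rangle: y\in K\}$, $x\in\mathbb{R}^n$; it is non-negative if and only if $K$ contains the origin. The surface area measure $S(K,\cdot)$ of $K$ is the finite Borel measure on $\mathbb{S}^{n-1}$ given by $$S(K,\omega)=\mathcal{H}^{n-1}\big(\{x\in\partial K:\ \exists v\in\omega \text{ such that } \langle x,v\rangle=h_K(v)\}\big)$$ for Borel sets $\omega\subseteq\mathbb{S}^{n-1}$. For $p<1$ and a convex body $K$ containing the origin, the $L_p$-surface area measure $S_p(K,\cdot)$ is the Borel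 measure on $\mathbb{S}^{n-1}$ defined by $dS_p(K,\cdot)=h_K^{1-p}\,dS(K,\cdot)$, i.e. $S_p(K,\omega)=\int_\omega h_K(v)^{1-p}\,dS(K,v)$. A measure on $\mathbb{S}^{n-1}$ is concentrated in $H$ if $\mathbb{S}^{n-1}\setminus H$ has measure zero. *)

theory Defs
  imports "HOL-Analysis.Analysis"
begin

section \<open>Hausdorff measure\<close>

text \<open>
  The factor \<^term>\<open>unit_ball_vol (real m)\<close> is the usual normalisation, for which the
  \<open>m\<close>-dimensional Hausdorff measure of subsets of the \<open>m\<close>-dimensional Euclidean space is the Lebesgue measure. The empty
  set has to be treated separately because \<open>0 ^ 0 = 1\<close>; singletons get the weight \<open>1\<close> for
  \<open>m = 0\<close>, so that the \<open>0\<close>-dimensional Hausdorff measure is the counting measure.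
\<close>

definition hausdorff_weight :: "nat \<Rightarrow> 'a::metric_space set \<Rightarrow> ennreal" where
  "hausdorff_weight m U =
     (if U = {} then 0 else ennreal (unit_ball_vol (real m) * (diameter U / 2) ^ m))"

definition hausdorff_content :: "nat \<Rightarrow> real \<Rightarrow> 'a::metric_space set \<Rightarrow> ennreal" where
  "hausdorff_content m \<delta> A =
     (INF U \<in> {U :: nat \<Rightarrow> 'a set.
                 A \<subseteq> (\<Union>i. U i) \<and> (\<forall>i. bounded (U i) \<and> diameter (U i) \<le> \<delta>)}.
        \<Sum>i. hausdorff_weight m (U i))"

text \<open>
  This is the Hausdorff outer measure, defined on all sets; it is shown below that it is countably
  additive on the Borel sets.
\<close>

definition hausdorff_measure :: "nat \<Rightarrow> 'a::metric_space set \<Rightarrow> ennreal" where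
  "hausdorff_measure m A = (SUP \<delta> \<in> {0<..}. hausdorff_content m \<delta> A)"

lemma hausdorff_weight_empty [simp]: "hausdorff_weight m {} = 0"
  by (simp add: hausdorff_weight_def)

lemma hausdorff_content_le:
  assumes "A \<subseteq> (\<Union>i. U i)" "\<And>i. bounded (U i)" "\<And>i. diameter (U i) \<le> \<delta>"
  shows "hausdorff_content m \<delta> A \<le> (\<Sum>i. hausdorff_weight m (U i))"
  unfolding hausdorff_content_def using assms by (intro INF_lower) auto

lemma hausdorff_content_mono:
  "A \<subseteq> B \<Longrightarrow> hausdorff_content m \<delta> A \<le> hausdorff_content m \<delta> B"
  unfolding hausdorff_content_def by (intro INF_superset_mono) auto

lemma hausdorff_content_antimono:
  "\<delta> \<le> \<delta>' \<Longrightarrow> hausdorff_content m \<delta>' A \<le> hausdorff_content m \<delta> A"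
  unfolding hausdorff_content_def by (intro INF_superset_mono) (auto intro: order_trans)

lemma hausdorff_measure_mono:
  "A \<subseteq> B \<Longrightarrow> hausdorff_measure m A \<le> hausdorff_measure m B"
  unfolding hausdorff_measure_def by (intro SUP_mono) (auto intro: hausdorff_content_mono)

lemma hausdorff_content_le_measure:
  "\<delta> > 0 \<Longrightarrow> hausdorff_content m \<delta> A \<le> hausdorff_measure m A"
  unfolding hausdorff_measure_def by (intro SUP_upper) auto

lemma hausdorff_measure_empty [simp]: "hausdorff_measure m {} = 0"
proof -
  have "hausdorff_content m \<delta> ({} :: 'a set) = 0" if "\<delta> > 0" for \<delta>
    using hausdorff_content_le[of "{}" "\<lambda>_. {}" \<delta> m] that by auto
  then show ?thesis
    by (auto simp: hausdorff_measure_def)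
qed

lemma hausdorff_content_countably_subadditive:
  fixes A :: "nat \<Rightarrow> 'a::metric_space set"
  shows "hausdorff_content m \<delta> (\<Union>i. A i) \<le> (\<Sum>i. hausdorff_content m \<delta> (A i))"
proof (rule ennreal_le_epsilon)
  let ?O = "hausdorff_content m \<delta> :: 'a set \<Rightarrow> ennreal"
  fix e :: real assume "0 < e" "(\<Sum>n. ?O (A n)) < top"
  then have *: "?O (A n) < ?O (A n) + e * (1/2)^Suc n" for n
    by (auto simp add: less_top dest!: ennreal_suminf_lessD)
  have "\<exists>U. A n \<subseteq> (\<Union>i. U i) \<and> (\<forall>i. bounded (U i) \<and> diameter (U i) \<le> \<delta>) \<and>
            (\<Sum>i. hausdorff_weight m (U i)) \<le> ?O (A n) + e * (1/2)^Suc n" for n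
    using *[of n] unfolding hausdorff_content_def[of m \<delta> "A n"] INF_less_iff
    by (auto intro: less_imp_le)
  then obtain B where B: "\<And>n. A n \<subseteq> (\<Union>i. B n i)" "\<And>n i. bounded (B n i)"
      "\<And>n i. diameter (B n i) \<le> \<delta>"
      and Ble: "\<And>n. (\<Sum>i. hausdorff_weight m (B n i)) \<le> ?O (A n) + e * (1/2)^Suc n"
    by metis
  define C where "C = case_prod B o prod_decode"
  have "(\<Union>i. A i) \<subseteq> (\<Union>i. C i)"
    using B(1) by (auto simp add: C_def subset_eq) (metis prod.case prod_encode_inverse)
  then have "?O (\<Union>i. A i) \<le> (\<Sum>i. hausdorff_weight m (C i))"
    using B by (intro hausdorff_content_le) (auto simp: C_def split: prod.split)
  also have "\<dots> = (\<Sum>n. \<Sum>i. hausdorff_weight m (B n i))"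
    unfolding C_def
    using suminf_ennreal_2dimen[of "\<lambda>n. \<Sum>i. hausdorff_weight m (B n i)"
        "\<lambda>(n,i). hausdorff_weight m (B n i)"]
    by (simp add: comp_def split_def)
  also have "\<dots> \<le> (\<Sum>n. ?O (A n) + e * (1/2) ^ Suc n)"
    by (intro suminf_le allI Ble) auto
  also have "\<dots> = (\<Sum>n. ?O (A n)) + (\<Sum>n. ennreal e * ennreal ((1/2) ^ Suc n))"
    using \<open>0 < e\<close> by (subst suminf_add[symmetric])
      (auto simp del: ennreal_suminf_cmult simp add: ennreal_mult[symmetric])
  also have "\<dots> = (\<Sum>n. ?O (A n)) + e"
    unfolding ennreal_suminf_cmult
    by (subst suminf_ennreal_eq[OF zero_le_power power_half_series]) auto
  finally show "?O (\<Union>i. A i) \<le> (\<Sum>n. ?O (A n)) + e" .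
qed

lemma hausdorff_measure_countably_subadditive:
  "hausdorff_measure m (\<Union>i. A i) \<le> (\<Sum>i. hausdorff_measure m (A i))"
  unfolding hausdorff_measure_def[of m "\<Union>i. A i"]
proof (rule SUP_least)
  fix \<delta> :: real assume "\<delta> \<in> {0<..}"
  then have "(\<Sum>i. hausdorff_content m \<delta> (A i)) \<le> (\<Sum>i. hausdorff_measure m (A i))"
    by (intro suminf_le) (auto intro: hausdorff_content_le_measure)
  with hausdorff_content_countably_subadditive
  show "hausdorff_content m \<delta> (\<Union>i. A i) \<le> (\<Sum>i. hausdorff_measure m (A i))"
    by (rule order_trans)
qed

lemma outer_measure_space_hausdorff:
  "outer_measure_space UNIV (hausdorff_measure m)"
  by (auto simp: outer_measure_space_def positive_def increasing_def countably_subadditive_def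
      hausdorff_measure_mono hausdorff_measure_countably_subadditive)

lemma hausdorff_measure_Un_le:
  "hausdorff_measure m (A \<union> B) \<le> hausdorff_measure m A + hausdorff_measure m B"
proof -
  have "(\<Union>i. case_nat A (case_nat B (\<lambda>_. {})) i) = A \<union> B"
    by (auto split: nat.splits simp: gr0_conv_Suc)
  moreover have "(\<Sum>i. hausdorff_measure m (case_nat A (case_nat B (\<lambda>_. {})) i))
      = (\<Sum>i\<in>{0,1}. hausdorff_measure m (case_nat A (case_nat B (\<lambda>_. {})) i))"
    by (rule suminf_finite) (auto split: nat.splits)
  ultimately show ?thesis
    using hausdorff_measure_countably_subadditive[of m "case_nat A (case_nat B (\<lambda>_. {}))"]
    by (simp add: add.commute)
qed

lemma hausdorff_content_separated:
  fixes A B :: "'a::metric_space set"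
  assumes sep: "\<And>x y. x \<in> A \<Longrightarrow> y \<in> B \<Longrightarrow> \<delta> < dist x y"
  shows "hausdorff_content m \<delta> A + hausdorff_content m \<delta> B \<le> hausdorff_content m \<delta> (A \<union> B)"
  unfolding hausdorff_content_def[of m \<delta> "A \<union> B"]
proof (rule INF_greatest)
  fix U :: "nat \<Rightarrow> 'a set"
  assume "U \<in> {U. A \<union> B \<subseteq> (\<Union>i. U i) \<and> (\<forall>i. bounded (U i) \<and> diameter (U i) \<le> \<delta>)}"
  then have U: "A \<union> B \<subseteq> (\<Union>i. U i)" "\<And>i. bounded (U i)" "\<And>i. diameter (U i) \<le> \<delta>"
    by auto
  define V where "V i = (if U i \<inter> A = {} then {} else U i)" for i
  define W where "W i = (if U i \<inter> B = {} then {} else U i)" for i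
  have \<delta>: "\<delta> \<ge> 0"
    using U(2,3)[of 0] diameter_ge_0 by fastforce
  have "U i \<inter> A = {} \<or> U i \<inter> B = {}" for i
  proof (rule ccontr)
    assume "\<not> (U i \<inter> A = {} \<or> U i \<inter> B = {})"
    then obtain x y where "x \<in> A" "y \<in> B" "x \<in> U i" "y \<in> U i"
      by auto
    then show False
      using sep[of x y] diameter_bounded_bound[of "U i" x y] U(2,3)[of i] by auto
  qed
  then have le: "hausdorff_weight m (V i) + hausdorff_weight m (W i) \<le> hausdorff_weight m (U i)"
    for i by (auto simp: V_def W_def)
  have "hausdorff_content m \<delta> A \<le> (\<Sum>i. hausdorff_weight m (V i))"
    using U \<delta> by (intro hausdorff_content_le) (force simp: V_def)+
  moreover have "hausdorff_content m \<delta> B \<le> (\<Sum>i. hausdorff_weight m (W i))"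
    using U \<delta> by (intro hausdorff_content_le) (force simp: W_def)+
  ultimately have "hausdorff_content m \<delta> A + hausdorff_content m \<delta> B
      \<le> (\<Sum>i. hausdorff_weight m (V i) + hausdorff_weight m (W i))"
    by (subst suminf_add[symmetric]) (auto intro: add_mono)
  also have "\<dots> \<le> (\<Sum>i. hausdorff_weight m (U i))"
    by (intro suminf_le le) auto
  finally show "hausdorff_content m \<delta> A + hausdorff_content m \<delta> B
      \<le> (\<Sum>i. hausdorff_weight m (U i))" .
qed

lemma hausdorff_measure_separated:
  fixes A B :: "'a::metric_space set"
  assumes "0 < \<epsilon>" and sep: "\<And>x y. x \<in> A \<Longrightarrow> y \<in> B \<Longrightarrow> \<epsilon> \<le> dist x y"
  shows "hausdorff_measure m A + hausdorff_measure m B \<le> hausdorff_measure m (A \<union> B)"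
proof -
  let ?h = "\<lambda>\<delta> X. hausdorff_content m \<delta> (X :: 'a set)"
  have "?h \<delta> A + ?h \<delta>' B \<le> hausdorff_measure m (A \<union> B)" if "\<delta> > 0" "\<delta>' > 0" for \<delta> \<delta>'
  proof -
    define \<eta> where "\<eta> = min (min \<delta> \<delta>') (\<epsilon> / 2)"
    have "\<eta> > 0" using that \<open>0 < \<epsilon>\<close> by (auto simp: \<eta>_def)
    have "?h \<delta> A + ?h \<delta>' B \<le> ?h \<eta> A + ?h \<eta> B"
      by (intro add_mono hausdorff_content_antimono) (auto simp: \<eta>_def)
    also have "\<dots> \<le> ?h \<eta> (A \<union> B)"
      using \<open>0 < \<epsilon>\<close> by (intro hausdorff_content_separated) (auto simp: \<eta>_def dest!: sep)
    also have "\<dots> \<le> hausdorff_measure m (A \<union> B)"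
      using \<open>\<eta> > 0\<close> by (rule hausdorff_content_le_measure)
    finally show ?thesis .
  qed
  then have "(SUP \<delta>\<in>{0<..}. ?h \<delta> A + ?h \<delta>' B) \<le> hausdorff_measure m (A \<union> B)"
    if "\<delta>' > 0" for \<delta>'
    using that by (intro SUP_least) auto
  then have 1: "hausdorff_measure m A + ?h \<delta>' B \<le> hausdorff_measure m (A \<union> B)"
    if "\<delta>' > 0" for \<delta>'
    unfolding hausdorff_measure_def[of m A] using that
    by (subst ennreal_SUP_add_left[symmetric]) auto
  then have "(SUP \<delta>'\<in>{0<..}. hausdorff_measure m A + ?h \<delta>' B) \<le> hausdorff_measure m (A \<union> B)"
    by (intro SUP_least) auto
  then show ?thesis
    unfolding hausdorff_measure_def[of m B]
    by (subst ennreal_SUP_add_right) auto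
qed

lemma hausdorff_measure_closed_split:
  fixes A F :: "'a::metric_space set"
  assumes F: "closed F" "F \<noteq> {}" and fin: "hausdorff_measure m A < top"
  shows "hausdorff_measure m (A \<inter> F) + hausdorff_measure m (A - F) \<le> hausdorff_measure m A"
proof -
  let ?\<nu> = "hausdorff_measure m :: 'a set \<Rightarrow> ennreal"
  define g where "g x = infdist x F" for x
  define D where "D k = {x \<in> A. 1 / real (k + 2) \<le> g x \<and> g x < 1 / real (k + 1)}" for k
  define S where "S n = {x \<in> A. 1 / real (n + 1) \<le> g x}" for n
  have g: "g x \<le> g y + dist x y" for x y
    unfolding g_def by (rule infdist_triangle)
  have D_sep: "1 / real (j + 2) - 1 / real (j + 3) \<le> dist x y"
    if "x \<in> D j" "y \<in> D k" "j + 2 \<le> k" for x y j k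
  proof -
    have "1 / real (k + 1) \<le> 1 / real (j + 3)"
      using that by (auto intro!: divide_left_mono)
    then show ?thesis using g[of x y] that(1,2) by (auto simp: D_def)
  qed
  have fin_sum: "(\<Sum>k<n. ?\<nu> (D (2 * k + r))) \<le> ?\<nu> (\<Union>k<n. D (2 * k + r))" for n r
  proof (induction n)
    case (Suc n)
    let ?e = "Min (insert 1 ((\<lambda>k. 1 / real (2 * k + r + 2) - 1 / real (2 * k + r + 3)) ` {..<n}))"
    have e: "?e > 0"
      by (subst Min_gr_iff) (auto intro!: divide_strict_left_mono)
    have "(\<Sum>k<Suc n. ?\<nu> (D (2 * k + r))) \<le> ?\<nu> (\<Union>k<n. D (2 * k + r)) + ?\<nu> (D (2 * n + r))"
      using Suc by (auto intro: add_right_mono)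
    also have "\<dots> \<le> ?\<nu> ((\<Union>k<n. D (2 * k + r)) \<union> D (2 * n + r))"
    proof (rule hausdorff_measure_separated[OF e])
      fix x y assume "x \<in> (\<Union>k<n. D (2 * k + r))" "y \<in> D (2 * n + r)"
      then obtain k where k: "k < n" "x \<in> D (2 * k + r)" "y \<in> D (2 * n + r)" by auto
      then have "?e \<le> 1 / real (2 * k + r + 2) - 1 / real (2 * k + r + 3)"
        by (intro Min_le) auto
      also have "\<dots> \<le> dist x y"
        using D_sep[OF k(2,3)] k(1) by auto
      finally show "?e \<le> dist x y" .
    qed
    finally show ?case by (simp add: lessThan_Suc Un_commute)
  qed simp
  have fin_sum': "(\<Sum>k<n. ?\<nu> (D (2 * k + r))) \<le> ?\<nu> A" for n r
    by (rule order_trans[OF fin_sum hausdorff_measure_mono]) (auto simp: D_def)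
  have sum_le: "(\<Sum>k<n. ?\<nu> (D k)) \<le> ?\<nu> A + ?\<nu> A" for n
  proof -
    have "(\<Sum>k<n. ?\<nu> (D k)) \<le> (\<Sum>k<2 * n. ?\<nu> (D k))"
      by (intro sum_mono2) auto
    also have "\<dots> = (\<Sum>k<n. ?\<nu> (D (2 * k + 0))) + (\<Sum>k<n. ?\<nu> (D (2 * k + 1)))"
      by (induction n) (auto simp: algebra_simps)
    also have "\<dots> \<le> ?\<nu> A + ?\<nu> A"
      by (intro add_mono fin_sum')
    finally show ?thesis .
  qed
  then have "(\<Sum>k. ?\<nu> (D k)) \<le> ?\<nu> A + ?\<nu> A"
    by (intro suminf_le_const) auto
  then have tot: "(\<Sum>k. ?\<nu> (D k)) < top"
    using fin by (auto simp: less_top[symmetric] top_unique)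
  have split: "A - F \<subseteq> S n \<union> (\<Union>k. D (k + n))" for n
  proof
    fix x assume x: "x \<in> A - F"
    then have gx: "g x > 0"
      using F by (simp add: g_def infdist_pos_not_in_closed)
    show "x \<in> S n \<union> (\<Union>k. D (k + n))"
    proof (cases "x \<in> S n")
      case False
      obtain N where "1 / real (N + 1) \<le> g x"
        using reals_Archimedean[OF gx] by (auto simp: inverse_eq_divide intro: less_imp_le)
      define M where "M = (LEAST N. 1 / real (N + 1) \<le> g x)"
      have M: "1 / real (M + 1) \<le> g x"
        unfolding M_def by (rule LeastI) fact
      have "n < M"
      proof (rule ccontr)
        assume "\<not> n < M"
        then have "1 / real (n + 1) \<le> 1 / real (M + 1)"
          by (auto intro!: divide_left_mono)
        with M False x show False by (auto simp: S_def)
      qed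
      then have "\<not> 1 / real ((M - 1) + 1) \<le> g x"
        using not_less_Least[of "M - 1" "\<lambda>N. 1 / real (N + 1) \<le> g x"] by (auto simp: M_def)
      then have "x \<in> D ((M - 1 - n) + n)"
        using M x \<open>n < M\<close> by (auto simp: D_def of_nat_diff)
      then show ?thesis by blast
    qed auto
  qed
  have main: "?\<nu> (A \<inter> F) + ?\<nu> (A - F) \<le> ?\<nu> A + (\<Sum>k. ?\<nu> (D (k + n)))" for n
  proof -
    have "?\<nu> (A - F) \<le> ?\<nu> (S n) + ?\<nu> (\<Union>k. D (k + n))"
      by (rule order_trans[OF hausdorff_measure_mono[OF split] hausdorff_measure_Un_le])
    also have "\<dots> \<le> ?\<nu> (S n) + (\<Sum>k. ?\<nu> (D (k + n)))"
      by (intro add_left_mono hausdorff_measure_countably_subadditive)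
    finally have "?\<nu> (A \<inter> F) + ?\<nu> (A - F) \<le> (?\<nu> (A \<inter> F) + ?\<nu> (S n)) + (\<Sum>k. ?\<nu> (D (k + n)))"
      by (simp add: add.assoc add_left_mono)
    moreover have "?\<nu> (A \<inter> F) + ?\<nu> (S n) \<le> ?\<nu> ((A \<inter> F) \<union> S n)"
    proof (rule hausdorff_measure_separated[of "1 / real (n + 1)"])
      fix x y assume "x \<in> A \<inter> F" "y \<in> S n"
      then show "1 / real (n + 1) \<le> dist x y"
        using infdist_le[of x F y] by (auto simp: S_def g_def dist_commute)
    qed auto
    moreover have "?\<nu> ((A \<inter> F) \<union> S n) \<le> ?\<nu> A"
      by (rule hausdorff_measure_mono) (auto simp: S_def)
    ultimately show ?thesis
      by (meson add_right_mono order_trans)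
  qed
  have "(\<lambda>n. \<Sum>k. ?\<nu> (D (k + n))) \<longlonglongrightarrow> 0"
  proof -
    have *: "?\<nu> (D k) = ennreal (enn2real (?\<nu> (D k)))" for k
      using ennreal_suminf_lessD[OF tot, of k] by auto
    define f where "f k = enn2real (?\<nu> (D k))" for k
    have f0: "f k \<ge> 0" for k by (simp add: f_def)
    have f: "?\<nu> (D k) = ennreal (f k)" for k using * by (simp add: f_def)
    have sf: "summable f"
      by (rule summable_suminf_not_top) (use f0 tot in \<open>auto simp: f\<close>)
    have "(\<lambda>n. \<Sum>k. f (k + n)) \<longlonglongrightarrow> 0"
      by (rule suminf_exist_split2[OF sf])
    then have "(\<lambda>n. ennreal (\<Sum>k. f (k + n))) \<longlonglongrightarrow> ennreal 0"
      by (rule tendsto_ennrealI)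
    moreover have "ennreal (\<Sum>k. f (k + n)) = (\<Sum>k. ?\<nu> (D (k + n)))" for n
      unfolding f by (rule suminf_ennreal2[symmetric]) (use f0 sf in \<open>auto simp: summable_iff_shift\<close>)
    ultimately show ?thesis by simp
  qed
  then have "(\<lambda>n. ?\<nu> A + (\<Sum>k. ?\<nu> (D (k + n)))) \<longlonglongrightarrow> ?\<nu> A + 0"
    by (intro tendsto_add tendsto_const)
  then show ?thesis
    using main by (intro LIMSEQ_le_const) auto
qed

lemma borel_subset_lambda_system_hausdorff:
  "sets borel \<subseteq> lambda_system UNIV UNIV (hausdorff_measure m :: 'a::metric_space set \<Rightarrow> ennreal)"
proof -
  let ?\<nu> = "hausdorff_measure m :: 'a set \<Rightarrow> ennreal"
  let ?L = "lambda_system UNIV UNIV ?\<nu>"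
  interpret P: sigma_algebra "UNIV :: 'a set" UNIV
    using sigma_algebra_Pow[of "UNIV :: 'a set"] by simp
  interpret L: sigma_algebra UNIV ?L
    using P.caratheodory_lemma[OF outer_measure_space_hausdorff] by (simp add: measure_space_def)
  have "F \<in> ?L" if F: "closed F" for F
    unfolding P.lambda_system_eq
  proof (intro CollectI conjI ballI antisym)
    fix A :: "'a set"
    show "?\<nu> (A \<inter> F) + ?\<nu> (A - F) \<le> ?\<nu> A"
      using hausdorff_measure_closed_split[OF F, of m A]
      by (cases "F = {}"; cases "?\<nu> A = top") (auto simp: less_top)
    show "?\<nu> A \<le> ?\<nu> (A \<inter> F) + ?\<nu> (A - F)"
      using hausdorff_measure_Un_le[of m "A \<inter> F" "A - F"] by (simp add: Int_Diff_Un)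
  qed auto
  then have "sigma_sets UNIV (Collect closed) \<subseteq> ?L"
    by (intro L.sigma_sets_subset) auto
  then show ?thesis
    by (simp add: borel_eq_closed)
qed

lemma hausdorff_measure_suminf:
  fixes A :: "nat \<Rightarrow> 'a::metric_space set"
  assumes "\<And>i. A i \<in> sets borel" "disjoint_family A"
  shows "(\<Sum>i. hausdorff_measure m (A i)) = hausdorff_measure m (\<Union>i. A i)"
proof -
  interpret P: sigma_algebra "UNIV :: 'a set" UNIV
    using sigma_algebra_Pow[of "UNIV :: 'a set"] by simp
  show ?thesis
    using P.lambda_system_caratheodory[OF outer_measure_space_hausdorff, of A m] assms
      borel_subset_lambda_system_hausdorff[of m] by auto
qed

section \<open>Convex bodies and \<open>L\<^sub>p\<close>-surface area measures\<close>

definition convex_body :: "'a::euclidean_space set \<Rightarrow> bool" where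
  "convex_body K \<longleftrightarrow> compact K \<and> convex K \<and> interior K \<noteq> {}"

definition support_function :: "'a::euclidean_space set \<Rightarrow> 'a \<Rightarrow> real" where
  "support_function K x = (SUP y\<in>K. x \<bullet> y)"

abbreviation unit_sphere :: "'a::euclidean_space set" where
  "unit_sphere \<equiv> sphere 0 1"

abbreviation sphere_borel :: "'a::euclidean_space set set" where
  "sphere_borel \<equiv> sets (restrict_space borel unit_sphere)"

text \<open>
  The set function below is countably additive on the Borel sets of the sphere when \<open>K\<close> is a convex
  body: the sets belonging to disjoint \<open>\<omega>\<close> overlap only in boundary points with more than one
  outer unit normal, and these form an \<open>(n - 1)\<close>-dimensional Hausdorff null set. Hence
  \<^const>\<open>measure_of\<close> yields the measure with exactly these values.
\<close>

definition surface_area_measure :: "'a::euclidean_space set \<Rightarrow> 'a measure" where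
  "surface_area_measure K =
     measure_of unit_sphere sphere_borel
       (\<lambda>\<omega>. hausdorff_measure (DIM('a) - 1)
              {x \<in> frontier K. \<exists>v\<in>\<omega>. x \<bullet> v = support_function K v})"

text \<open>
  For \<open>p < 1\<close> the exponent is positive and the convention \<^prop>\<open>0 powr (1 - p) = 0\<close>
  agrees with the usual value of \<open>0 ^ (1 - p)\<close>; the support function is non-negative
  since the definition is only used for bodies containing the origin.
\<close>

definition Lp_surface_area_measure :: "real \<Rightarrow> 'a::euclidean_space set \<Rightarrow> 'a measure" where
  "Lp_surface_area_measure p K =
     density (surface_area_measure K) (\<lambda>v. ennreal (support_function K v powr (1 - p)))"

text \<open>For a linear subspace \<open>H\<close> of dimension \<open>k\<close>, this is the
  \<open>(k - 1)\<close>-dimensional Hausdorff measure on \<open>unit_sphere \<inter> H\<close>, extended by zero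
  to the whole sphere.\<close>

definition subspace_sphere_measure :: "nat \<Rightarrow> 'a::euclidean_space set \<Rightarrow> 'a measure" where
  "subspace_sphere_measure k H =
     measure_of unit_sphere sphere_borel (\<lambda>\<omega>. hausdorff_measure (k - 1) (\<omega> \<inter> H))"

lemma sphere_borel_iff: "\<omega> \<in> sphere_borel \<longleftrightarrow> \<omega> \<in> sets borel \<and> \<omega> \<subseteq> unit_sphere"
  by (subst sets_restrict_space_iff) auto

lemma emeasure_subspace_sphere_measure:
  fixes H :: "'a::euclidean_space set"
  assumes "subspace H" "\<omega> \<in> sphere_borel"
  shows "emeasure (subspace_sphere_measure k H) \<omega> = hausdorff_measure (k - 1) (\<omega> \<inter> H)"
proof (rule emeasure_measure_of[OF subspace_sphere_measure_def])
  have H: "H \<in> sets borel"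
    using closed_subspace[OF assms(1)] by simp
  interpret sigma_algebra unit_sphere "sphere_borel :: 'a set set"
    using sets.sigma_algebra_axioms[of "restrict_space borel (unit_sphere :: 'a set)"]
    by (simp add: space_restrict_space)
  show "sphere_borel \<subseteq> Pow unit_sphere"
    using sphere_borel_iff by blast
  show "\<omega> \<in> sets (subspace_sphere_measure k H)"
    unfolding subspace_sphere_measure_def using assms(2) by (simp add: sigma_sets_eq space_closed)
  have [simp]: "sets (subspace_sphere_measure k H) = sphere_borel"
    unfolding subspace_sphere_measure_def by (simp add: sigma_sets_eq space_closed)
  show "positive (sets (subspace_sphere_measure k H)) (\<lambda>\<omega>. hausdorff_measure (k - 1) (\<omega> \<inter> H))"
    by (simp add: positive_def)
  show "countably_additive (sets (subspace_sphere_measure k H))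
          (\<lambda>\<omega>. hausdorff_measure (k - 1) (\<omega> \<inter> H))"
  proof (rule countably_additiveI)
    fix A :: "nat \<Rightarrow> 'a set"
    assume A: "range A \<subseteq> sets (subspace_sphere_measure k H)" "disjoint_family A"
    have "A i \<inter> H \<in> sets borel" for i
    proof -
      have "A i \<in> sphere_borel" using A(1) by auto
      then show ?thesis using H sphere_borel_iff by blast
    qed
    moreover have "disjoint_family (\<lambda>i. A i \<inter> H)"
      using A(2) by (auto simp: disjoint_family_on_def)
    ultimately show "(\<Sum>i. hausdorff_measure (k - 1) (A i \<inter> H))
        = hausdorff_measure (k - 1) (\<Union> (range A) \<inter> H)"
      using hausdorff_measure_suminf[of "\<lambda>i. A i \<inter> H" "k - 1"] by (simp add: Int_commute)
  qed
qed

end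

theory Submission
  imports Defs
begin

text \<open>
  Let \<open>h\<close> be the support function of \<open>K\<close> and \<open>S\<close> its surface area measure. The equation says that \<open>S\<close>
  is \<open>h powr (p - 1)\<close> times the rotation invariant measure on the unit sphere of \<open>H\<close>, except on the
  zeros of \<open>h\<close>, where it says nothing about \<open>S\<close>. These zeros form the cone \<open>C\<close> of outer normals at the
  origin. The proof contradicts the fact that the surface area measure has its centroid at the origin,
  \<open>\<integral> v \<bullet> b dS = 0\<close>, for a well chosen direction \<open>b\<close>.

  First, \<open>C\<close> must meet \<open>H\<close> outside the origin, since otherwise \<open>K\<close> would be unbounded in a direction
  orthogonal to \<open>H\<close>. Convex separation then gives a unit vector \<open>w\<close> in \<open>H\<close> with \<open>- w\<close> in \<open>C\<close>, and a
  vector \<open>b\<close> that differs from \<open>w\<close> by a vector orthogonal to \<open>H\<close>, such that \<open>v \<bullet> b \<le> 0\<close> for all \<open>v\<close>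
  in \<open>C\<close> (\<open>reflection_direction\<close>). So \<open>C\<close> contributes nothing positive to the integral, while on \<open>H\<close> the
  integrand is \<open>(v \<bullet> w) * h v powr (p - 1)\<close>. Let \<open>R\<close> be the reflection in the hyperplane orthogonal to
  \<open>w\<close>. As \<open>K\<close> lies in the half-space \<open>0 \<le> w \<bullet> x\<close>, we have \<open>h (R v) \<le> h v\<close> whenever \<open>0 \<le> v \<bullet> w\<close>, and
  hence, as \<open>p < 1\<close>, the mirror image of \<open>v\<close> carries at least as much surface area as \<open>v\<close>. Near \<open>w\<close> the
  inequality is strict, because \<open>h (R w) = h (- w) = 0 < h w\<close>. So the integral is negative.

  The positive and the negative part of the centroid integral are both the area of the shadow of \<open>K\<close>
  along \<open>b\<close>, multiplied by the norm of \<open>b\<close>. In this form the identity becomes a comparison of areas: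
  the upper side of \<open>K\<close> covers the shadow (\<open>shadow_le_upper\<close>), and the parts of the lower side have
  shadows that do not overlap (\<open>\<alpha>_superadditive\<close>). It remains to compare a small piece of the boundary,
  with normals near \<open>v\<close>, with its shadow. The piece is nearly contained in a hyperplane
  orthogonal to \<open>v\<close>, on which projection along \<open>b\<close> multiplies Hausdorff measure by a constant, by
  uniqueness of translation invariant measures
  (\<open>hausdorff_measure_linear_image_proportional\<close>). What matters about this constant is that it is the
  same for \<open>v\<close> and \<open>R v\<close> (\<open>proj_hyperplane_factor_reflect\<close>), which follows from symmetry. In this way
  an inequality between the surface areas of mirror images turns into the same inequality between their
  shadows (\<open>\<alpha>_compare\<close>), and \<open>reflection_contradiction\<close> concludes.

  That the boundary areas defining \<open>S\<close> are countably additive in the set of normals follows from the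
  equation, since its right-hand side is not zero; and additivity makes the boundary points with several
  normals negligible (\<open>emeasure_S\<close>, \<open>null_overlap\<close>).
\<close>

section \<open>Hausdorff measure of Lipschitz images and of cubes\<close>

lemma hausdorff_measure_leI:
  assumes "\<And>\<delta>. 0 < \<delta> \<Longrightarrow> hausdorff_content m \<delta> A \<le> c"
  shows "hausdorff_measure m A \<le> c"
  unfolding hausdorff_measure_def by (rule SUP_least) (use assms in auto)

lemma hausdorff_measure_Lipschitz_image:
  fixes f :: "'a::euclidean_space \<Rightarrow> 'b::euclidean_space"
  assumes L: "0 < L"
    and f: "\<And>x y. x \<in> A \<Longrightarrow> y \<in> A \<Longrightarrow> norm (f x - f y) \<le> L * norm (x - y)"
  shows "hausdorff_measure m (f ` A) \<le> ennreal (L ^ m) * hausdorff_measure m A"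
proof (rule hausdorff_measure_leI)
  fix \<delta> :: real assume "0 < \<delta>"
  have "ennreal ((1 / L) ^ m) * hausdorff_content m \<delta> (f ` A) \<le> hausdorff_content m (\<delta> / L) A"
    unfolding hausdorff_content_def[of m "\<delta> / L"]
  proof (rule INF_greatest)
    fix U :: "nat \<Rightarrow> 'a set"
    assume "U \<in> {U. A \<subseteq> (\<Union>i. U i) \<and> (\<forall>i. bounded (U i) \<and> diameter (U i) \<le> \<delta> / L)}"
    then have U: "A \<subseteq> (\<Union>i. U i)" "\<And>i. bounded (U i)" "\<And>i. diameter (U i) \<le> \<delta> / L"
      by auto
    define V where "V i = f ` (U i \<inter> A)" for i
    have le: "norm (f x - f y) \<le> L * diameter (U i)" if "x \<in> U i \<inter> A" "y \<in> U i \<inter> A" for x y i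
    proof -
      have "norm (f x - f y) \<le> L * norm (x - y)"
        using that by (intro f) auto
      also have "\<dots> \<le> L * diameter (U i)"
        using L that diameter_bounded_bound[OF U(2), of x i y] by (simp add: dist_norm)
      finally show ?thesis .
    qed
    have dV: "diameter (V i) \<le> L * diameter (U i)" for i
      by (rule diameter_le) (use L le diameter_ge_0[OF U(2)] in \<open>auto simp: V_def\<close>)
    have bV: "bounded (V i)" for i
    proof (cases "V i = {}")
      case False
      then obtain a where a: "a \<in> U i \<inter> A" by (auto simp: V_def)
      have "V i \<subseteq> cball (f a) (L * diameter (U i))"
        using le[OF a, of ] by (auto simp: V_def dist_norm)
      then show ?thesis by (rule bounded_subset[OF bounded_cball])
    qed auto
    have "hausdorff_content m \<delta> (f ` A) \<le> (\<Sum>i. hausdorff_weight m (V i))"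
    proof (rule hausdorff_content_le)
      show "f ` A \<subseteq> (\<Union>i. V i)" using U(1) by (fastforce simp: V_def)
      fix i show "diameter (V i) \<le> \<delta>"
        using dV[of i] U(3)[of i] L by (simp add: field_simps)
    qed (rule bV)
    also have "\<dots> \<le> (\<Sum>i. ennreal (L ^ m) * hausdorff_weight m (U i))"
    proof (intro suminf_le)
      fix i
      have "unit_ball_vol m * (diameter (V i) / 2) ^ m
          \<le> unit_ball_vol m * ((L * diameter (U i)) / 2) ^ m"
        using dV[of i] diameter_ge_0[OF bV, of i] by (intro mult_left_mono power_mono) auto
      also have "\<dots> = L ^ m * (unit_ball_vol m * (diameter (U i) / 2) ^ m)"
        by (simp add: power_mult_distrib power_divide)
      finally show "hausdorff_weight m (V i) \<le> ennreal (L ^ m) * hausdorff_weight m (U i)"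
        using L diameter_ge_0[OF U(2), of i]
        by (auto simp: hausdorff_weight_def V_def ennreal_mult[symmetric] intro!: ennreal_leI)
    qed auto
    also have "\<dots> = ennreal (L ^ m) * (\<Sum>i. hausdorff_weight m (U i))"
      by simp
    finally have "ennreal ((1 / L) ^ m) * hausdorff_content m \<delta> (f ` A)
        \<le> ennreal ((1 / L) ^ m) * (ennreal (L ^ m) * (\<Sum>i. hausdorff_weight m (U i)))"
      by (rule mult_left_mono) simp
    also have "\<dots> = (\<Sum>i. hausdorff_weight m (U i))"
      using L by (simp add: mult.assoc[symmetric] ennreal_mult[symmetric] power_mult_distrib[symmetric])
    finally show "ennreal ((1 / L) ^ m) * hausdorff_content m \<delta> (f ` A)
        \<le> (\<Sum>i. hausdorff_weight m (U i))" .
  qed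
  also have "\<dots> \<le> hausdorff_measure m A"
    using L \<open>0 < \<delta>\<close> by (intro hausdorff_content_le_measure) auto
  finally have "ennreal (L ^ m) * (ennreal ((1 / L) ^ m) * hausdorff_content m \<delta> (f ` A))
      \<le> ennreal (L ^ m) * hausdorff_measure m A"
    by (rule mult_left_mono) simp
  then show "hausdorff_content m \<delta> (f ` A) \<le> ennreal (L ^ m) * hausdorff_measure m A"
    using L by (simp add: mult.assoc[symmetric] ennreal_mult[symmetric] power_mult_distrib[symmetric])
qed

lemma hausdorff_measure_contraction:
  fixes f :: "'a::euclidean_space \<Rightarrow> 'b::euclidean_space"
  assumes "\<And>x y. x \<in> A \<Longrightarrow> y \<in> A \<Longrightarrow> norm (f x - f y) \<le> norm (x - y)"
  shows "hausdorff_measure m (f ` A) \<le> hausdorff_measure m A"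
  using hausdorff_measure_Lipschitz_image[of 1 A f m] assms by simp

lemma hausdorff_measure_isometry:
  fixes f :: "'a::euclidean_space \<Rightarrow> 'b::euclidean_space"
  assumes f: "\<And>x y. x \<in> A \<Longrightarrow> y \<in> A \<Longrightarrow> norm (f x - f y) = norm (x - y)"
  shows "hausdorff_measure m (f ` A) = hausdorff_measure m A"
proof (rule antisym)
  show "hausdorff_measure m (f ` A) \<le> hausdorff_measure m A"
    by (rule hausdorff_measure_contraction) (simp add: f)
  have inj: "inj_on f A"
    by (rule inj_onI) (use f in fastforce)
  have "hausdorff_measure m (the_inv_into A f ` f ` A) \<le> hausdorff_measure m (f ` A)"
    by (rule hausdorff_measure_contraction) (auto simp: the_inv_into_f_f[OF inj] f)
  then show "hausdorff_measure m A \<le> hausdorff_measure m (f ` A)"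
    using inj by (simp add: image_image the_inv_into_f_f cong: image_cong_simp)
qed

lemma hausdorff_measure_linear_image_le:
  fixes f :: "'a::euclidean_space \<Rightarrow> 'b::euclidean_space"
  assumes "linear f"
  obtains L where "0 < L" "\<And>A. hausdorff_measure m (f ` A) \<le> ennreal (L ^ m) * hausdorff_measure m A"
proof -
  obtain L where L: "L > 0" "\<And>x. norm (f x) \<le> L * norm x"
    using linear_bounded_pos[OF assms] by auto
  show thesis
  proof
    show "hausdorff_measure m (f ` A) \<le> ennreal (L ^ m) * hausdorff_measure m A" for A
      by (rule hausdorff_measure_Lipschitz_image[OF L(1)])
        (use L(2) in \<open>simp add: linear_diff[OF assms, symmetric]\<close>)
  qed (rule L)
qed

lemma hausdorff_content_le_finite:
  assumes I: "finite I" and A: "A \<subseteq> (\<Union>i\<in>I. U i)" and "0 \<le> \<delta>"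
    and U: "\<And>i. i \<in> I \<Longrightarrow> bounded (U i)" "\<And>i. i \<in> I \<Longrightarrow> diameter (U i) \<le> \<delta>"
  shows "hausdorff_content m \<delta> A \<le> (\<Sum>i\<in>I. hausdorff_weight m (U i))"
proof -
  obtain h where h: "bij_betw h {0..<card I} I"
    using ex_bij_betw_nat_finite[OF I] by auto
  define V where "V i = (if i < card I then U (h i) else {})" for i
  have hI: "h i \<in> I" if "i < card I" for i
    using h that by (auto simp: bij_betw_def)
  have "hausdorff_content m \<delta> A \<le> (\<Sum>i. hausdorff_weight m (V i))"
  proof (rule hausdorff_content_le)
    show "A \<subseteq> (\<Union>i. V i)"
    proof
      fix x assume "x \<in> A"
      then obtain i where "i \<in> I" "x \<in> U i" using A by auto
      moreover then obtain j where "j < card I" "i = h j"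
        using h by (force simp: bij_betw_def)
      ultimately show "x \<in> (\<Union>i. V i)" by (auto simp: V_def)
    qed
  qed (use U hI \<open>0 \<le> \<delta>\<close> in \<open>auto simp: V_def\<close>)
  also have "\<dots> = (\<Sum>i\<in>{0..<card I}. hausdorff_weight m (V i))"
    by (rule suminf_finite) (auto simp: V_def)
  also have "\<dots> = (\<Sum>i\<in>{0..<card I}. hausdorff_weight m (U (h i)))"
    by (rule sum.cong) (auto simp: V_def)
  also have "\<dots> = (\<Sum>i\<in>I. hausdorff_weight m (U i))"
    by (rule sum.reindex_bij_betw[OF h])
  finally show ?thesis .
qed

text \<open>
Subdividing the cube into \<open>N ^ m\<close> cubes of diameter at most \<open>m / N\<close> gives covers whose total
weight does not depend on \<open>N\<close>.
\<close>

lemma hausdorff_measure_coordinate_cube_finite: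
  fixes B :: "'a::euclidean_space set"
  assumes B: "B \<subseteq> Basis"
  shows "hausdorff_measure (card B) {x. (\<forall>b\<in>B. 0 \<le> x \<bullet> b \<and> x \<bullet> b \<le> 1) \<and> (\<forall>b\<in>Basis - B. x \<bullet> b = 0)} < \<infinity>"
proof -
  define m where "m = card B"
  have fB: "finite B" using B finite_Basis by (rule finite_subset)
  let ?A = "{x. (\<forall>b\<in>B. 0 \<le> x \<bullet> b \<and> x \<bullet> b \<le> 1) \<and> (\<forall>b\<in>Basis - B. x \<bullet> b = 0)}"
  let ?c = "unit_ball_vol m * (real m / 2) ^ m"
  have "hausdorff_measure m ?A \<le> ennreal ?c"
  proof (rule hausdorff_measure_leI)
    fix \<delta> :: real assume \<delta>: "0 < \<delta>"
    \<comment> \<open>fine enough for the subcubes to have diameter at most \<open>\<delta>\<close>\<close>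
    define N where "N = Suc (nat \<lceil>real m / \<delta>\<rceil>)"
    have N: "N > 0" "real m / N \<le> \<delta>"
    proof -
      have "real m / \<delta> \<le> N" by (simp add: N_def) linarith
      moreover have "real N > 0" by (simp add: N_def)
      ultimately show "real m / N \<le> \<delta>"
        using \<delta> by (simp only: pos_divide_le_eq mult.commute)
    qed (simp add: N_def)
    define I where "I = B \<rightarrow>\<^sub>E {..<N}"
    define U where "U f = {x. (\<forall>b\<in>B. f b / N \<le> x \<bullet> b \<and> x \<bullet> b \<le> (f b + 1) / N) \<and> (\<forall>b\<in>Basis - B. x \<bullet> b = 0)}"
      for f :: "'a \<Rightarrow> nat"
    have nrm: "norm (x - y) \<le> real m / N" if "x \<in> U f" "y \<in> U f" for x y f
    proof -
      have "norm (x - y) \<le> (\<Sum>b\<in>Basis. \<bar>(x - y) \<bullet> b\<bar>)" by (rule norm_le_l1)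
      also have "\<dots> = (\<Sum>b\<in>B. \<bar>(x - y) \<bullet> b\<bar>)"
        by (rule sum.mono_neutral_right) (use B that in \<open>auto simp: U_def inner_diff_left\<close>)
      also have "\<dots> \<le> (\<Sum>b\<in>B. 1 / N)"
      proof (rule sum_mono)
        fix b assume "b \<in> B"
        then have "f b / N \<le> x \<bullet> b" "x \<bullet> b \<le> (f b + 1) / N" "f b / N \<le> y \<bullet> b" "y \<bullet> b \<le> (f b + 1) / N"
          using that by (auto simp: U_def)
        then show "\<bar>(x - y) \<bullet> b\<bar> \<le> 1 / N"
          by (simp add: inner_diff_left add_divide_distrib)
      qed
      finally show ?thesis by (simp add: m_def)
    qed
    have bU: "bounded (U f)" for f
    proof (cases "U f = {}")
      case False
      then obtain a where "a \<in> U f" by auto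
      then have "U f \<subseteq> cball a (real m / N)"
        using nrm[of a f] by (auto simp: dist_norm)
      then show ?thesis by (rule bounded_subset[OF bounded_cball])
    qed auto
    have dU: "diameter (U f) \<le> real m / N" for f
      by (rule diameter_le) (use nrm in auto)
    have "hausdorff_content m \<delta> ?A \<le> (\<Sum>f\<in>I. hausdorff_weight m (U f))"
    proof (rule hausdorff_content_le_finite)
      show "finite I" unfolding I_def by (intro finite_PiE fB) auto
      show "?A \<subseteq> (\<Union>f\<in>I. U f)"
      proof
        fix x assume x: "x \<in> ?A"
        \<comment> \<open>the right end of the unit interval belongs to the last subinterval\<close>
        define f where "f = (\<lambda>b\<in>B. if x \<bullet> b = 1 then N - 1 else nat \<lfloor>N * (x \<bullet> b)\<rfloor>)"
        have *: "f b < N \<and> f b / N \<le> x \<bullet> b \<and> x \<bullet> b \<le> (f b + 1) / N" if "b \<in> B" for b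
        proof (cases "x \<bullet> b = 1")
          case False
          then have xb: "0 \<le> x \<bullet> b" "x \<bullet> b < 1" using x that by force+
          have "f b = nat \<lfloor>N * (x \<bullet> b)\<rfloor>" using False that by (simp add: f_def)
          then have f: "real (f b) = of_int \<lfloor>N * (x \<bullet> b)\<rfloor>" using xb N by simp
          have "real (f b) \<le> N * (x \<bullet> b)" unfolding f by linarith
          moreover have "N * (x \<bullet> b) < real (f b) + 1" unfolding f by linarith
          moreover have "N * (x \<bullet> b) < N" using xb N by simp
          ultimately have "real (f b) < N" "real (f b) \<le> N * (x \<bullet> b)" "N * (x \<bullet> b) < real (f b) + 1"
            by linarith+
          then show ?thesis using N(1) by (simp add: field_simps)
        qed (use that N in \<open>auto simp: f_def field_simps\<close>)
        have "f \<in> I" using * by (auto simp: I_def f_def)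
        moreover have "x \<in> U f" using * x by (auto simp: U_def)
        ultimately show "x \<in> (\<Union>f\<in>I. U f)" by auto
      qed
    qed (use dU bU N \<delta> order_trans in \<open>auto intro: order_trans\<close>)
    also have "\<dots> \<le> (\<Sum>f\<in>I. ennreal (unit_ball_vol m * (real m / N / 2) ^ m))"
      using dU diameter_ge_0[OF bU] unfolding hausdorff_weight_def
      by (intro sum_mono) (auto intro!: ennreal_leI mult_left_mono power_mono divide_right_mono)
    also have "\<dots> = ennreal (real N ^ m * (unit_ball_vol m * (real m / N / 2) ^ m))"
      by (simp add: I_def card_PiE fB m_def ennreal_mult ennreal_power ennreal_of_nat_eq_real_of_nat)
    also have "real N ^ m * (unit_ball_vol m * (real m / N / 2) ^ m) = ?c"
      using N by (simp add: power_divide power_mult_distrib field_simps)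
    finally show "hausdorff_content m \<delta> ?A \<le> ennreal ?c" .
  qed
  also have "\<dots> < \<infinity>" by simp
  finally show ?thesis by (simp add: m_def)
qed

lemma ennreal_le_mult_imp_divide_le:
  assumes "0 < C" "ennreal X \<le> ennreal C * S"
  shows "ennreal (X / C) \<le> S"
proof (cases S)
  case (real s)
  then have "ennreal X \<le> ennreal (C * s)" using assms by (simp add: ennreal_mult)
  then have "X \<le> C * s" using assms(1) real by (simp add: ennreal_le_iff)
  then show ?thesis using real assms(1) by (simp add: ennreal_leI pos_divide_le_eq mult.commute)
qed simp

text \<open>
The mass distribution principle with Lebesgue measure: a covering set of diameter \<open>d\<close>, thickened to
a box that extends from \<open>-1\<close> to \<open>1\<close> in the remaining coordinates, has volume at most a fixed
multiple of its weight, and the boxes cover the thickened cube.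
\<close>

lemma hausdorff_measure_coordinate_cube_pos:
  fixes B :: "'a::euclidean_space set"
  assumes B: "B \<subseteq> Basis" and r: "0 < r"
  shows "0 < hausdorff_measure (card B) {x. (\<forall>b\<in>B. \<bar>x \<bullet> b\<bar> \<le> r) \<and> (\<forall>b\<in>Basis - B. x \<bullet> b = 0)}"
proof -
  define m where "m = card B"
  have fB: "finite B" using B finite_Basis by (rule finite_subset)
  let ?A = "{x. (\<forall>b\<in>B. \<bar>x \<bullet> b\<bar> \<le> r) \<and> (\<forall>b\<in>Basis - B. x \<bullet> b = 0)}"
  define k where "k = card (Basis - B)"
  have vol: "emeasure lborel (cbox (\<Sum>b\<in>Basis. l b *\<^sub>R b) (\<Sum>b\<in>Basis. u b *\<^sub>R b))
      = ennreal ((2 * d) ^ m * 2 ^ k)"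
    if "0 \<le> d" "\<And>b. b \<in> B \<Longrightarrow> u b - l b = 2 * d" "\<And>b. b \<in> Basis - B \<Longrightarrow> u b - l b = 2"
    for l u :: "'a \<Rightarrow> real" and d
  proof -
    have "l b \<le> u b" if "b \<in> Basis" for b
      using \<open>0 \<le> d\<close> that(1) \<open>\<And>b. b \<in> B \<Longrightarrow> u b - l b = 2 * d\<close>[of b] \<open>\<And>b. b \<in> Basis - B \<Longrightarrow> u b - l b = 2\<close>[of b]
      by (cases "b \<in> B") auto
    then have "emeasure lborel (cbox (\<Sum>b\<in>Basis. l b *\<^sub>R b) (\<Sum>b\<in>Basis. u b *\<^sub>R b))
      = (\<Prod>b\<in>Basis. u b - l b)"
      by (simp add: emeasure_lborel_cbox_eq inner_diff_left)
    also have "(\<Prod>b\<in>Basis. u b - l b) = (\<Prod>b\<in>B. u b - l b) * (\<Prod>b\<in>Basis - B. u b - l b)"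
      using B by (metis finite_Basis mult.commute prod.subset_diff)
    also have "\<dots> = (2 * d) ^ m * 2 ^ k"
      using that by (simp add: m_def k_def)
    finally show ?thesis .
  qed
  define c where "c = unit_ball_vol m"
  have c: "c > 0" by (simp add: c_def)
  let ?s = "\<lambda>f :: 'a \<Rightarrow> real. (\<Sum>b\<in>Basis. f b *\<^sub>R b)"
  \<comment> \<open>the box around a set of diameter \<open>d\<close> has volume \<open>(2 d) ^ m * 2 ^ k\<close>, its weight is \<open>c * (d / 2) ^ m\<close>\<close>
  define C where "C = 4 ^ m * 2 ^ k / c"
  have C: "C > 0" using c by (simp add: C_def)
  have "ennreal ((2 * r) ^ m * 2 ^ k / C) \<le> hausdorff_content m 1 ?A"
    unfolding hausdorff_content_def
    proof (rule INF_greatest)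
      fix U :: "nat \<Rightarrow> 'a set"
      assume "U \<in> {U. ?A \<subseteq> (\<Union>i. U i) \<and> (\<forall>i. bounded (U i) \<and> diameter (U i) \<le> 1)}"
      then have U: "?A \<subseteq> (\<Union>i. U i)" "\<And>i. bounded (U i)" by auto
      define d where "d i = diameter (U i)" for i
      have d: "d i \<ge> 0" for i unfolding d_def by (rule diameter_ge_0[OF U(2)])
      define a where "a i = (SOME x. x \<in> U i)" for i
      have a: "a i \<in> U i" if "U i \<noteq> {}" for i
        using that unfolding a_def by (auto intro: someI)
      define W where "W i = (if U i = {} then {} else
         cbox (?s (\<lambda>b. if b \<in> B then a i \<bullet> b - d i else -1)) (?s (\<lambda>b. if b \<in> B then a i \<bullet> b + d i else 1)))" for i
      let ?Q = "cbox (?s (\<lambda>b. if b \<in> B then - r else -1)) (?s (\<lambda>b. if b \<in> B then r else 1))"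
      have "?Q \<subseteq> (\<Union>i. W i)"
      proof
        fix x assume "x \<in> ?Q"
        then have x: "\<And>b. b \<in> B \<Longrightarrow> - r \<le> x \<bullet> b \<and> x \<bullet> b \<le> r"
             "\<And>b. b \<in> Basis - B \<Longrightarrow> - 1 \<le> x \<bullet> b \<and> x \<bullet> b \<le> 1"
          using B by (auto simp: mem_box subset_iff split: if_splits)
        define y where "y = ?s (\<lambda>b. if b \<in> B then x \<bullet> b else 0)"
        have y: "y \<bullet> b = (if b \<in> B then x \<bullet> b else 0)" if "b \<in> Basis" for b
          using that by (simp add: y_def)
        have "y \<in> ?A" using x y B by (auto simp: abs_le_iff subset_iff) (smt (verit))+
        then obtain i where i: "y \<in> U i" using U(1) by blast
        have "\<bar>x \<bullet> b - a i \<bullet> b\<bar> \<le> d i" if "b \<in> B" for b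
        proof -
          have "b \<in> Basis" using that B by auto
          then have "\<bar>x \<bullet> b - a i \<bullet> b\<bar> = \<bar>(y - a i) \<bullet> b\<bar>"
            using y that by (simp add: inner_diff_left)
          also have "\<dots> \<le> norm (y - a i)" using \<open>b \<in> Basis\<close> by (rule Basis_le_norm)
          also have "\<dots> \<le> d i"
            using diameter_bounded_bound[OF U(2) i a[of i]] i by (auto simp: d_def dist_norm)
          finally show ?thesis .
        qed
        then have "x \<in> W i"
          using i x(2) by (auto simp: W_def mem_box abs_le_iff) (smt (verit))+
        then show "x \<in> (\<Union>i. W i)" by auto
      qed
      then have "emeasure lborel ?Q \<le> emeasure lborel (\<Union>i. W i)"
        by (intro emeasure_mono sets.countable_UN) (auto simp: W_def)
      also have "\<dots> \<le> (\<Sum>i. emeasure lborel (W i))"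
        by (rule emeasure_subadditive_countably) (auto simp: W_def)
      also have "\<dots> \<le> (\<Sum>i. ennreal C * hausdorff_weight m (U i))"
      proof (intro suminf_le)
        fix i
        show "emeasure lborel (W i) \<le> ennreal C * hausdorff_weight m (U i)"
        proof (cases "U i = {}")
          case False
          then have "W i = cbox (?s (\<lambda>b. if b \<in> B then a i \<bullet> b - d i else -1)) (?s (\<lambda>b. if b \<in> B then a i \<bullet> b + d i else 1))"
            by (simp add: W_def)
          also have "emeasure lborel \<dots> = ennreal ((2 * d i) ^ m * 2 ^ k)"
            using d by (intro vol) auto
          also have "(2 * d i) ^ m = 4 ^ m * (d i / 2) ^ m"
            by (simp only: power_mult_distrib[symmetric]) simp
          also have "4 ^ m * (d i / 2) ^ m * 2 ^ k = C * (c * (d i / 2) ^ m)"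
            using c by (simp add: C_def)
          also have "ennreal \<dots> = ennreal C * ennreal (c * (d i / 2) ^ m)"
            using c C d[of i] by (intro ennreal_mult) auto
          also have "ennreal (c * (d i / 2) ^ m) = hausdorff_weight m (U i)"
            using False by (simp add: hausdorff_weight_def c_def d_def)
          finally show ?thesis by simp
        qed (simp add: W_def)
      qed auto
      also have "\<dots> = ennreal C * (\<Sum>i. hausdorff_weight m (U i))"
        by (rule ennreal_suminf_cmult)
      also have "emeasure lborel ?Q = ennreal ((2 * r) ^ m * 2 ^ k)"
        using r by (intro vol) auto
      finally show "ennreal ((2 * r) ^ m * 2 ^ k / C) \<le> (\<Sum>i. hausdorff_weight m (U i))"
        by (rule ennreal_le_mult_imp_divide_le[OF C])
    qed
  moreover have "0 < ennreal ((2 * r) ^ m * 2 ^ k / C)" using C r by simp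
  ultimately have "0 < hausdorff_content m 1 ?A"
    by (rule less_le_trans[rotated])
  also have "\<dots> \<le> hausdorff_measure m ?A" by (rule hausdorff_content_le_measure) simp
  finally show ?thesis by (simp add: m_def)
qed

section \<open>Hausdorff measure on linear subspaces\<close>

text \<open>
Hausdorff measure sees only distances, so an isometry reduces every subspace to a coordinate
subspace.
\<close>

lemma obtain_coordinate_subspace:
  fixes V :: "'a::euclidean_space set"
  assumes V: "subspace V"
  obtains B :: "'a set" and f g where "B \<subseteq> Basis" "card B = dim V" "linear f" "linear g"
    "f ` {x. \<forall>b\<in>Basis - B. x \<bullet> b = 0} = V" "g ` V = {x. \<forall>b\<in>Basis - B. x \<bullet> b = 0}"
    "\<And>x. x \<in> {x. \<forall>b\<in>Basis - B. x \<bullet> b = 0} \<Longrightarrow> norm (f x) = norm x"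
    "\<And>x. x \<in> V \<Longrightarrow> norm (g x) = norm x"
proof -
  obtain B :: "'a set" where B: "B \<subseteq> Basis" "card B = dim V"
    using obtain_subset_with_card_n[OF dim_subset_UNIV[of V]] by metis
  have W: "{x. \<forall>b\<in>Basis - B. x \<bullet> b = 0} = {x::'a. \<forall>i\<in>Basis. i \<notin> B \<longrightarrow> x \<bullet> i = 0}"
    by auto
  obtain f g where "linear f" "linear g" "f ` {x. \<forall>b\<in>Basis - B. x \<bullet> b = 0} = V"
     "g ` V = {x. \<forall>b\<in>Basis - B. x \<bullet> b = 0}"
    "\<And>x. x \<in> {x. \<forall>b\<in>Basis - B. x \<bullet> b = 0} \<Longrightarrow> norm (f x) = norm x"
    "\<And>x. x \<in> V \<Longrightarrow> norm (g x) = norm x"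
  proof (rule isometries_subspaces[of "{x. \<forall>b\<in>Basis - B. x \<bullet> b = 0}" V])
    show "subspace {x. \<forall>b\<in>Basis - B. x \<bullet> b = 0}" unfolding W by (rule subspace_substandard)
    show "dim {x. \<forall>b\<in>Basis - B. x \<bullet> b = 0} = dim V"
      unfolding W using dim_substandard[OF B(1)] B(2) by simp
  qed (use V in blast)+
  then show thesis using B that by blast
qed

lemma hausdorff_measure_subspace_ball_pos:
  fixes V :: "'a::euclidean_space set"
  assumes V: "subspace V" and r: "0 < r"
  shows "0 < hausdorff_measure (dim V) (V \<inter> cball 0 r)"
proof -
  obtain B :: "'a set" and f g where B: "B \<subseteq> Basis" "card B = dim V" and f: "linear f"
    "f ` {x. \<forall>b\<in>Basis - B. x \<bullet> b = 0} = V"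
    "\<And>x. x \<in> {x. \<forall>b\<in>Basis - B. x \<bullet> b = 0} \<Longrightarrow> norm (f x) = norm x"
    by (rule obtain_coordinate_subspace[OF V]) blast
  interpret f: linear f by fact
  define s where "s = r / DIM('a)"
  have s: "0 < s" using r by (simp add: s_def)
  let ?A = "{x. (\<forall>b\<in>B. \<bar>x \<bullet> b\<bar> \<le> s) \<and> (\<forall>b\<in>Basis - B. x \<bullet> b = 0)}"
  have "norm x \<le> r" if "x \<in> ?A" for x
  proof -
    have "norm x \<le> (\<Sum>b\<in>Basis. \<bar>x \<bullet> b\<bar>)" by (rule norm_le_l1)
    also have "\<dots> \<le> (\<Sum>b\<in>(Basis::'a set). s)"
      using that s by (intro sum_mono) (smt (verit) DiffI mem_Collect_eq)
    finally show ?thesis by (simp add: s_def)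
  qed
  then have sub: "f ` ?A \<subseteq> V \<inter> cball 0 r"
    using f(2,3) by auto
  have "0 < hausdorff_measure (dim V) ?A"
    using hausdorff_measure_coordinate_cube_pos[OF B(1) s] B(2) by simp
  also have "\<dots> = hausdorff_measure (dim V) (f ` ?A)"
    by (rule hausdorff_measure_isometry[symmetric])
      (use f(3) in \<open>auto simp: f.diff[symmetric] inner_diff_left\<close>)
  also have "\<dots> \<le> hausdorff_measure (dim V) (V \<inter> cball 0 r)"
    by (rule hausdorff_measure_mono[OF sub])
  finally show ?thesis .
qed

lemma hausdorff_measure_subspace_ball_finite:
  fixes V :: "'a::euclidean_space set"
  assumes V: "subspace V"
  shows "hausdorff_measure (dim V) (V \<inter> cball 0 r) < \<infinity>"
proof -
  obtain B :: "'a set" and f g where B: "B \<subseteq> Basis" "card B = dim V" and g: "linear g"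
    "g ` V = {x. \<forall>b\<in>Basis - B. x \<bullet> b = 0}" "\<And>x. x \<in> V \<Longrightarrow> norm (g x) = norm x"
    by (rule obtain_coordinate_subspace[OF V]) blast
  interpret g: linear g by fact
  \<comment> \<open>a half side length that is positive for every \<open>r\<close>\<close>
  define s where "s = \<bar>r\<bar> + 1"
  have s: "0 < s" by (simp add: s_def)
  have fB: "finite B" using B(1) finite_Basis by (rule finite_subset)
  let ?U = "{x. (\<forall>b\<in>B. 0 \<le> x \<bullet> b \<and> x \<bullet> b \<le> 1) \<and> (\<forall>b\<in>Basis - B. x \<bullet> b = 0)}"
  define \<phi> where "\<phi> x = (2 * s) *\<^sub>R x - s *\<^sub>R (\<Sum>b\<in>B. b)" for x :: 'a
  have sB: "(\<Sum>b\<in>B. b) \<bullet> c = (if c \<in> B then 1 else 0)" if "c \<in> Basis" for c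
  proof -
    have "(\<Sum>b\<in>B. b) \<bullet> c = (\<Sum>b\<in>B. if b = c then 1 else 0)"
      unfolding inner_sum_left using B(1) that by (intro sum.cong) (auto simp: inner_Basis)
    then show ?thesis using fB by simp
  qed
  have "g ` (V \<inter> cball 0 r) \<subseteq> \<phi> ` ?U"
  proof
    fix y assume "y \<in> g ` (V \<inter> cball 0 r)"
    then obtain x where x: "x \<in> V" "norm x \<le> r" "y = g x" by auto
    then have y: "norm y \<le> s" "\<forall>b\<in>Basis - B. y \<bullet> b = 0"
      using g(2,3) by (auto simp: s_def)
    define z where "z = (1 / (2 * s)) *\<^sub>R (y + s *\<^sub>R (\<Sum>b\<in>B. b))"
    have "y = \<phi> z" using s by (simp add: \<phi>_def z_def)
    moreover have "z \<in> ?U"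
    proof -
      have "0 \<le> z \<bullet> b \<and> z \<bullet> b \<le> 1" if "b \<in> B" for b
      proof -
        have "b \<in> Basis" using that B by auto
        then have "\<bar>y \<bullet> b\<bar> \<le> s" using Basis_le_norm[of b y] y by linarith
        moreover have "z \<bullet> b = (y \<bullet> b + s) / (2 * s)"
          using sB[OF \<open>b \<in> Basis\<close>] that by (simp add: z_def inner_add_left)
        ultimately show ?thesis using s by (auto simp: abs_le_iff pos_le_divide_eq pos_divide_le_eq)
      qed
      moreover have "z \<bullet> b = 0" if "b \<in> Basis - B" for b
        using sB[of b] y(2) that by (simp add: z_def inner_add_left)
      ultimately show ?thesis by auto
    qed
    ultimately show "y \<in> \<phi> ` ?U" by auto
  qed
  have "hausdorff_measure (dim V) (V \<inter> cball 0 r) = hausdorff_measure (dim V) (g ` (V \<inter> cball 0 r))"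
    by (rule hausdorff_measure_isometry[symmetric])
      (use g(3) V in \<open>auto simp: g.diff[symmetric] subspace_diff\<close>)
  also have "\<dots> \<le> hausdorff_measure (dim V) (\<phi> ` ?U)"
    by (rule hausdorff_measure_mono) fact
  also have "\<dots> \<le> ennreal ((2 * s) ^ dim V) * hausdorff_measure (dim V) ?U"
    by (rule hausdorff_measure_Lipschitz_image)
      (use s in \<open>auto simp: \<phi>_def scaleR_diff_right[symmetric]\<close>)
  also have "\<dots> < \<infinity>"
    using hausdorff_measure_coordinate_cube_finite[OF B(1)] B(2)
    by (simp add: ennreal_mult_less_top)
  finally show ?thesis .
qed

definition hausdorff_borel :: "nat \<Rightarrow> 'a::metric_space measure" where
  "hausdorff_borel m = measure_of UNIV (sets borel) (hausdorff_measure m)"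

lemma sets_hausdorff_borel [simp, measurable_cong]: "sets (hausdorff_borel m) = sets borel"
  by (simp add: hausdorff_borel_def) (metis sets.sigma_sets_eq space_borel)

lemma space_hausdorff_borel [simp]: "space (hausdorff_borel m) = UNIV"
  by (simp add: hausdorff_borel_def)

lemma emeasure_hausdorff_borel:
  assumes "A \<in> sets borel"
  shows "emeasure (hausdorff_borel m) A = hausdorff_measure m A"
proof (rule emeasure_measure_of[OF hausdorff_borel_def])
  show "countably_additive (sets (hausdorff_borel m)) (hausdorff_measure m)"
    by (rule countably_additiveI) (auto intro: hausdorff_measure_suminf)
qed (use assms in \<open>auto simp: positive_def\<close>)

text \<open>
A measure on the whole space, so that measures carried by different subspaces
can be compared on one Borel algebra.
\<close>

definition hausdorff_on :: "nat \<Rightarrow> 'a::euclidean_space set \<Rightarrow> 'a measure" where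
  "hausdorff_on m V = density (hausdorff_borel m) (indicator V)"

lemma sets_hausdorff_on [simp, measurable_cong]: "sets (hausdorff_on m V) = sets borel"
  by (simp add: hausdorff_on_def)

lemma space_hausdorff_on [simp]: "space (hausdorff_on m V) = UNIV"
  by (simp add: hausdorff_on_def)

lemma emeasure_hausdorff_on:
  assumes "subspace V" "A \<in> sets borel"
  shows "emeasure (hausdorff_on m V) A = hausdorff_measure m (A \<inter> V)"
proof -
  have V: "V \<in> sets borel" using closed_subspace[OF assms(1)] by simp
  have "emeasure (hausdorff_on m V) A = (\<integral>\<^sup>+x. indicator (A \<inter> V) x \<partial>hausdorff_borel m)"
    unfolding hausdorff_on_def using V assms(2)
    by (subst emeasure_density)
      (auto intro!: nn_integral_cong simp: indicator_def simp del: nn_integral_indicator)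
  also have "\<dots> = hausdorff_measure m (A \<inter> V)"
    by (subst nn_integral_indicator) (use V assms(2) in \<open>auto simp: emeasure_hausdorff_borel\<close>)
  finally show ?thesis .
qed

section \<open>Linear images of subsets of a subspace\<close>

lemma sigma_finite_if_finite_on_balls:
  fixes M :: "'a::euclidean_space measure"
  assumes "sets M = sets borel" "\<And>r. emeasure M (cball 0 r) < \<infinity>"
  shows "sigma_finite_measure M"
proof
  have sp: "space M = UNIV" using sets_eq_imp_space_eq[OF assms(1)] by simp
  show "\<exists>A. countable A \<and> A \<subseteq> sets M \<and> \<Union>A = space M \<and> (\<forall>a\<in>A. emeasure M a \<noteq> \<infinity>)"
  proof (intro exI[of _ "range (\<lambda>n::nat. cball 0 (real n))"] conjI)
    show "\<Union>(range (\<lambda>n::nat. cball 0 (real n))) = space M"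
      unfolding sp by (auto simp: real_arch_simple)
  qed (use assms in \<open>auto simp: less_top\<close>)
qed

lemma borel_measurable_vimage_add:
  fixes A :: "'a::euclidean_space set"
  assumes "A \<in> sets borel"
  shows "(\<lambda>x. x + a) -` A \<in> sets borel"
  using measurable_sets[of "\<lambda>x. x + a" borel borel A] assms by simp

text \<open>
Uniqueness of Haar measure by Weil's argument: integrate \<open>indicator A x * indicator B (x + y)\<close>
over both variables in the two possible orders, and use invariance in the inner integral.
\<close>

lemma translation_invariant_measures_proportional:
  fixes M N :: "'a::euclidean_space measure"
  assumes V: "subspace V"
    and M: "sets M = sets borel" "sigma_finite_measure M" "emeasure M (- V) = 0"
    and N: "sets N = sets borel" "sigma_finite_measure N" "emeasure N (- V) = 0"
    and transM: "\<And>a A. a \<in> V \<Longrightarrow> A \<in> sets borel \<Longrightarrow> emeasure M ((\<lambda>x. x + a) -` A) = emeasure M A"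
    and transN: "\<And>a A. a \<in> V \<Longrightarrow> A \<in> sets borel \<Longrightarrow> emeasure N ((\<lambda>x. x + a) -` A) = emeasure N A"
    and symN: "\<And>A. A \<in> sets borel \<Longrightarrow> emeasure N (uminus -` A) = emeasure N A"
    and A: "A \<in> sets borel" and B: "B \<in> sets borel"
  shows "emeasure M A * emeasure N B = emeasure M B * emeasure N A"
proof -
  interpret M: sigma_finite_measure M by fact
  interpret N: sigma_finite_measure N by fact
  interpret P: pair_sigma_finite M N ..
  have spM [simp]: "space M = UNIV" using sets_eq_imp_space_eq[OF M(1)] by simp
  have spN [simp]: "space N = UNIV" using sets_eq_imp_space_eq[OF N(1)] by simp
  note [measurable_cong] = M(1) N(1)
  note [measurable] = A B
  have Vb: "- V \<in> sets borel" using closed_subspace[OF V] by auto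
  have AEM: "AE x in M. x \<in> V" by (rule AE_I[of _ _ "- V"]) (use M Vb in auto)
  have AEN: "AE x in N. x \<in> V" by (rule AE_I[of _ _ "- V"]) (use N Vb in auto)
  have m1: "(\<lambda>(x,y). indicator A x * indicator B (x + y) :: ennreal) \<in> borel_measurable (M \<Otimes>\<^sub>M N)"
    by measurable
  have m2: "(\<lambda>(x,y). indicator A (x - y) * indicator B x :: ennreal) \<in> borel_measurable (M \<Otimes>\<^sub>M N)"
    by measurable
  have eM: "(\<integral>\<^sup>+x. indicator S x * f \<partial>M) = f * emeasure M S" if "S \<in> sets borel" for S and f :: ennreal
    using that M(1) by (subst nn_integral_multc) (auto simp: mult.commute)
  have "(\<integral>\<^sup>+x. \<integral>\<^sup>+y. indicator A x * indicator B (x + y) \<partial>N \<partial>M)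
      = (\<integral>\<^sup>+x. indicator A x * emeasure N B \<partial>M)"
  proof (rule nn_integral_cong_AE, use AEM in eventually_elim)
    fix x assume x: "x \<in> V"
    have bx: "(\<lambda>y. y + x) -` B \<in> sets borel"
      by (rule borel_measurable_vimage_add[OF B])
    have "(\<integral>\<^sup>+y. indicator A x * indicator B (x + y) \<partial>N)
        = (\<integral>\<^sup>+y. indicator A x * indicator ((\<lambda>y. y + x) -` B) y \<partial>N)"
      by (simp add: indicator_vimage add.commute)
    also have "\<dots> = indicator A x * emeasure N ((\<lambda>y. y + x) -` B)"
      using bx N(1) by (simp add: nn_integral_cmult)
    finally show "(\<integral>\<^sup>+y. indicator A x * indicator B (x + y) \<partial>N) = indicator A x * emeasure N B"
      by (simp add: transN[OF x B])
  qed
  also have "\<dots> = emeasure M A * emeasure N B"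
    by (subst eM[OF A]) (rule mult.commute)
  finally have L: "(\<integral>\<^sup>+x. \<integral>\<^sup>+y. indicator A x * indicator B (x + y) \<partial>N \<partial>M) = emeasure M A * emeasure N B" .
  have "(\<integral>\<^sup>+x. \<integral>\<^sup>+y. indicator A x * indicator B (x + y) \<partial>N \<partial>M)
      = (\<integral>\<^sup>+y. \<integral>\<^sup>+x. indicator A x * indicator B (x + y) \<partial>M \<partial>N)"
    using P.Fubini'[OF m1] by simp
  also have "\<dots> = (\<integral>\<^sup>+y. \<integral>\<^sup>+x. indicator A (x - y) * indicator B x \<partial>M \<partial>N)"
  proof (rule nn_integral_cong_AE, use AEN in eventually_elim)
    fix y assume y: "y \<in> V"
    define S where "S = {x. x - y \<in> A \<and> x \<in> B}"
    have S: "S \<in> sets borel" unfolding S_def by measurable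
    have bS: "(\<lambda>x. x + y) -` S \<in> sets borel"
      by (rule borel_measurable_vimage_add[OF S])
    have "(\<integral>\<^sup>+x. indicator A x * indicator B (x + y) \<partial>M) = (\<integral>\<^sup>+x. indicator ((\<lambda>x. x + y) -` S) x \<partial>M)"
      by (rule nn_integral_cong) (auto simp: S_def indicator_def)
    also have "\<dots> = (\<integral>\<^sup>+x. indicator S x \<partial>M)"
      using S bS M(1) transM[OF y S] by simp
    also have "\<dots> = (\<integral>\<^sup>+x. indicator A (x - y) * indicator B x \<partial>M)"
      by (rule nn_integral_cong) (auto simp: S_def indicator_def)
    finally show "(\<integral>\<^sup>+x. indicator A x * indicator B (x + y) \<partial>M)
       = (\<integral>\<^sup>+x. indicator A (x - y) * indicator B x \<partial>M)" .
  qed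
  also have "\<dots> = (\<integral>\<^sup>+x. \<integral>\<^sup>+y. indicator A (x - y) * indicator B x \<partial>N \<partial>M)"
    using P.Fubini'[OF m2] by simp
  also have "\<dots> = (\<integral>\<^sup>+x. indicator B x * emeasure N A \<partial>M)"
  proof (rule nn_integral_cong_AE, use AEM in eventually_elim)
    fix x assume x: "x \<in> V"
    define S where "S = uminus -` A"
    have S: "S \<in> sets borel"
      using measurable_sets[of uminus borel borel A] A by (simp add: S_def)
    have bS: "(\<lambda>y. y + (- x)) -` S \<in> sets borel"
      by (rule borel_measurable_vimage_add[OF S])
    have "(\<integral>\<^sup>+y. indicator A (x - y) * indicator B x \<partial>N)
        = (\<integral>\<^sup>+y. indicator ((\<lambda>y. y + (- x)) -` S) y * indicator B x \<partial>N)"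
      by (rule nn_integral_cong) (auto simp: S_def indicator_def)
    also have "\<dots> = emeasure N ((\<lambda>y. y + (- x)) -` S) * indicator B x"
      using bS N(1) by (simp add: nn_integral_multc)
    also have "emeasure N ((\<lambda>y. y + (- x)) -` S) = emeasure N A"
      using transN[OF _ S, of "- x"] x V symN[OF A] by (simp add: subspace_neg S_def)
    finally show "(\<integral>\<^sup>+y. indicator A (x - y) * indicator B x \<partial>N) = indicator B x * emeasure N A"
      by (simp add: mult.commute)
  qed
  also have "\<dots> = emeasure M B * emeasure N A"
    by (subst eM[OF B]) (rule mult.commute)
  finally show ?thesis using L by simp
qed

lemma hausdorff_measure_translate:
  fixes A :: "'a::euclidean_space set"
  shows "hausdorff_measure m ((\<lambda>x. x + a) ` A) = hausdorff_measure m A"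
  by (rule hausdorff_measure_isometry) simp

lemma hausdorff_measure_minus:
  fixes A :: "'a::euclidean_space set"
  shows "hausdorff_measure m (uminus ` A) = hausdorff_measure m A"
  by (rule hausdorff_measure_isometry) (simp add: norm_minus_commute)

text \<open>
Both \<open>E \<mapsto> \<H>(E)\<close> and \<open>E \<mapsto> \<H>(T ` E)\<close> are translation invariant on \<open>V\<close>, hence proportional. The
factor stays implicit; later arguments compare such factors with each other.
\<close>

lemma hausdorff_measure_linear_image_proportional:
  fixes T g :: "'a::euclidean_space \<Rightarrow> 'a"
  assumes V: "subspace V" and T: "linear T" and g: "linear g"
    and gT: "\<And>x. x \<in> V \<Longrightarrow> g (T x) = x"
  obtains c where "0 < c" "c < \<infinity>"
    "\<And>E. E \<in> sets borel \<Longrightarrow> E \<subseteq> V \<Longrightarrow> hausdorff_measure (dim V) (T ` E) = c * hausdorff_measure (dim V) E"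
proof -
  interpret T: linear T by fact
  define m where "m = dim V"
  let ?H = "hausdorff_measure m"
  have TV: "subspace (T ` V)" by (rule linear_subspace_image[OF T V])
  have gm: "g \<in> borel_measurable borel"
    using g by (intro borel_measurable_continuous_onI linear_continuous_on) (simp add: linear_conv_bounded_linear)
  define M where "M = hausdorff_on m V"
  define N where "N = distr (hausdorff_on m (T ` V)) borel g"
  have eM: "emeasure M A = ?H (A \<inter> V)" if "A \<in> sets borel" for A
    using that V by (simp add: M_def emeasure_hausdorff_on)
  have eN: "emeasure N A = ?H (T ` (A \<inter> V))" if "A \<in> sets borel" for A
  proof -
    have "emeasure N A = emeasure (hausdorff_on m (T ` V)) (g -` A)"
      unfolding N_def using gm that by (subst emeasure_distr) auto
    also have "\<dots> = ?H (g -` A \<inter> T ` V)"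
      by (rule emeasure_hausdorff_on[OF TV]) (use measurable_sets[OF gm that] in simp)
    also have "g -` A \<inter> T ` V = T ` (A \<inter> V)"
      using gT by force
    finally show ?thesis .
  qed
  obtain L where L: "0 < L" "\<And>A. ?H (T ` A) \<le> ennreal (L ^ m) * ?H A"
    using hausdorff_measure_linear_image_le[OF T] by blast
  obtain L' where L': "0 < L'" "\<And>A. ?H (g ` A) \<le> ennreal (L' ^ m) * ?H A"
    using hausdorff_measure_linear_image_le[OF g] by blast
  have fin: "?H (cball 0 r \<inter> V) < \<infinity>" for r
    using hausdorff_measure_subspace_ball_finite[OF V] by (simp add: m_def Int_commute)
  have finT: "?H (T ` (cball 0 r \<inter> V)) < \<infinity>" for r
    by (rule le_less_trans[OF L(2)]) (use fin[of r] in \<open>simp add: ennreal_mult_less_top\<close>)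
  have shift: "(\<lambda>x. x + a) -` A \<inter> V = (\<lambda>x. x + (- a)) ` (A \<inter> V)" if a: "a \<in> V" for a A
  proof (intro set_eqI iffI)
    fix x assume "x \<in> (\<lambda>x. x + a) -` A \<inter> V"
    then show "x \<in> (\<lambda>x. x + (- a)) ` (A \<inter> V)"
      using a V by (intro image_eqI[of _ _ "x + a"]) (auto simp: subspace_add)
  next
    fix x assume "x \<in> (\<lambda>x. x + (- a)) ` (A \<inter> V)"
    then show "x \<in> (\<lambda>x. x + a) -` A \<inter> V"
      using a V by (auto simp: subspace_diff)
  qed
  have cross: "emeasure M A * emeasure N B = emeasure M B * emeasure N A"
    if A: "A \<in> sets borel" and B: "B \<in> sets borel" for A B
  proof (rule translation_invariant_measures_proportional[OF V _ _ _ _ _ _ _ _ _ A B])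
    show sM: "sets M = sets borel" and sN: "sets N = sets borel" by (simp_all add: M_def N_def)
    show "sigma_finite_measure M"
      by (rule sigma_finite_if_finite_on_balls[OF sM]) (use fin in \<open>simp add: eM\<close>)
    show "sigma_finite_measure N"
      by (rule sigma_finite_if_finite_on_balls[OF sN]) (use finT in \<open>simp add: eN\<close>)
    have V': "- V \<in> sets borel" using closed_subspace[OF V] by auto
    show "emeasure M (- V) = 0" "emeasure N (- V) = 0" using V' by (simp_all add: eM eN)
  next
    fix a A assume a: "a \<in> V" and A: "A \<in> sets (borel :: 'a measure)"
    show "emeasure M ((\<lambda>x. x + a) -` A) = emeasure M A"
      using borel_measurable_vimage_add[OF A, of a] A
      by (simp add: eM shift[OF a] hausdorff_measure_translate del: add_uminus_conv_diff)
    have "T ` (\<lambda>x. x + (- a)) ` (A \<inter> V) = (\<lambda>x. x + (- T a)) ` T ` (A \<inter> V)"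
      by (simp add: image_image T.diff)
    then show "emeasure N ((\<lambda>x. x + a) -` A) = emeasure N A"
      using borel_measurable_vimage_add[OF A, of a] A
      by (simp add: eN shift[OF a] hausdorff_measure_translate del: add_uminus_conv_diff)
  next
    fix A assume A: "A \<in> sets (borel :: 'a measure)"
    have "uminus -` A \<inter> V = uminus ` (A \<inter> V)"
      using V by (force simp: image_iff subspace_neg)
    moreover have "T ` uminus ` (A \<inter> V) = uminus ` T ` (A \<inter> V)"
      by (simp add: image_image T.neg)
    moreover have "uminus -` A \<in> sets borel"
      using measurable_sets[of uminus borel borel A] A by simp
    ultimately show "emeasure N (uminus -` A) = emeasure N A"
      using A by (simp add: eN hausdorff_measure_minus)
  qed
  define B where "B = V \<inter> cball 0 (1::real)"
  have Bb: "B \<in> sets borel" using closed_subspace[OF V] by (simp add: B_def)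
  have MB: "0 < emeasure M B" "emeasure M B < \<infinity>"
    using hausdorff_measure_subspace_ball_pos[OF V, of 1] fin[of 1] Bb
    by (auto simp: eM B_def m_def Int_commute)
  have NB: "emeasure N B < \<infinity>" using finT[of 1] Bb by (simp add: eN B_def Int_commute)
  have NB0: "0 < emeasure N B"
  proof (rule ccontr)
    assume "\<not> ?thesis"
    then have "?H (T ` (B \<inter> V)) = 0" using Bb by (simp add: eN)
    then have "?H (g ` T ` (B \<inter> V)) \<le> 0" using L'(2)[of "T ` (B \<inter> V)"] by simp
    moreover have "g ` T ` (B \<inter> V) = B \<inter> V" using gT by (force simp: image_image)
    ultimately show False using MB Bb by (simp add: eM)
  qed
  show thesis
  proof (rule that[of "emeasure N B / emeasure M B"])
    show "0 < emeasure N B / emeasure M B" using MB NB0 by (simp add: ennreal_zero_less_divide)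
    show "emeasure N B / emeasure M B < \<infinity>"
      using MB NB by (auto simp: ennreal_divide_eq_top_iff less_top[symmetric] zero_less_iff_neq_zero)
    fix E assume E: "E \<in> sets borel" "E \<subseteq> V"
    then have EV: "E \<inter> V = E" by auto
    have "?H (T ` E) * emeasure M B = ?H E * emeasure N B"
      using cross[OF E(1) Bb] E EV by (simp add: eM eN mult.commute)
    then have "?H (T ` E) * emeasure M B / emeasure M B = ?H E * emeasure N B / emeasure M B" by simp
    moreover have "?H (T ` E) * emeasure M B / emeasure M B = ?H (T ` E)"
      using MB by (intro ennreal_mult_divide_eq) auto
    ultimately show "hausdorff_measure (dim V) (T ` E) = emeasure N B / emeasure M B * hausdorff_measure (dim V) E"
      by (simp add: m_def ennreal_times_divide mult.commute)
  qed
qed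

section \<open>Oblique projections along a direction\<close>

text \<open>
The projection along \<open>b\<close> onto the hyperplane orthogonal to \<open>v\<close>. The choice \<open>v = b\<close> gives the
orthogonal projection along \<open>b\<close>.
\<close>

definition oblique_proj :: "'a::euclidean_space \<Rightarrow> 'a \<Rightarrow> 'a \<Rightarrow> 'a" where
  "oblique_proj v b x = x - ((v \<bullet> x) / (v \<bullet> b)) *\<^sub>R b"

lemma linear_oblique_proj: "linear (oblique_proj v b)"
  by (rule linearI) (simp_all add: oblique_proj_def inner_add_right add_divide_distrib algebra_simps)

lemma inner_oblique_proj: "v \<bullet> b \<noteq> 0 \<Longrightarrow> v \<bullet> oblique_proj v b x = 0"
  by (simp add: oblique_proj_def inner_diff_right)

lemma oblique_proj_oblique_proj:
  "v \<bullet> b \<noteq> 0 \<Longrightarrow> oblique_proj u b (oblique_proj v b x) = oblique_proj u b x" if "u \<bullet> b \<noteq> 0"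
  using that by (simp add: oblique_proj_def inner_diff_right diff_divide_distrib scaleR_left_diff_distrib)

lemma oblique_proj_id: "v \<bullet> x = 0 \<Longrightarrow> oblique_proj v b x = x"
  by (simp add: oblique_proj_def)

lemma norm_orthogonal_proj_le: "norm (oblique_proj b b x) \<le> norm x"
proof (cases "b = 0")
  case False
  let ?t = "((b \<bullet> x) / (b \<bullet> b)) *\<^sub>R b"
  have "orthogonal (oblique_proj b b x) ?t"
    using inner_oblique_proj[of b b x] False by (simp add: orthogonal_def inner_commute)
  moreover have "x = oblique_proj b b x + ?t" by (simp add: oblique_proj_def)
  ultimately have "(norm x)\<^sup>2 = (norm (oblique_proj b b x))\<^sup>2 + (norm ?t)\<^sup>2"
    by (metis norm_add_Pythagorean)
  then show ?thesis by (metis le_add_same_cancel1 norm_ge_zero power2_le_imp_le zero_le_power2)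
qed (simp add: oblique_proj_def)

lemma orthogonal_proj_diff_le:
  "norm (oblique_proj b b x - oblique_proj b b y) \<le> norm (x - y)"
  using norm_orthogonal_proj_le[of b "x - y"] by (simp add: linear_diff[OF linear_oblique_proj])

lemma hausdorff_measure_orthogonal_proj_le:
  "hausdorff_measure m (oblique_proj b b ` A) \<le> hausdorff_measure m A"
  by (rule hausdorff_measure_contraction) (rule orthogonal_proj_diff_le)

lemma continuous_on_oblique_proj: "continuous_on A (oblique_proj v b)"
  by (rule linear_continuous_on) (simp add: linear_oblique_proj linear_conv_bounded_linear[symmetric])

lemma hausdorff_measure_pos_if_proj_disc:
  fixes A :: "'a::euclidean_space set"
  assumes "d \<noteq> 0" "0 < s"
    and disc: "\<And>e. d \<bullet> e = 0 \<Longrightarrow> norm e \<le> s \<Longrightarrow> a + e \<in> oblique_proj d d ` A"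
  shows "0 < hausdorff_measure (DIM('a) - 1) A"
proof -
  let ?D = "{x. d \<bullet> x = 0} \<inter> cball 0 s"
  have "0 < hausdorff_measure (DIM('a) - 1) ?D"
    using hausdorff_measure_subspace_ball_pos[OF subspace_hyperplane \<open>0 < s\<close>, of d] dim_hyperplane[OF \<open>d \<noteq> 0\<close>]
    by simp
  also have "\<dots> = hausdorff_measure (DIM('a) - 1) ((\<lambda>e. e + a) ` ?D)"
    by (rule hausdorff_measure_translate[symmetric])
  also have "\<dots> \<le> hausdorff_measure (DIM('a) - 1) (oblique_proj d d ` A)"
    by (rule hausdorff_measure_mono) (use disc in \<open>auto simp: add.commute\<close>)
  also have "\<dots> \<le> hausdorff_measure (DIM('a) - 1) A"
    by (rule hausdorff_measure_orthogonal_proj_le)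
  finally show ?thesis .
qed

text \<open>
On a set that is nearly flat in the sense that all its chords are almost orthogonal to \<open>v\<close>, the
projection along \<open>b\<close> onto the hyperplane orthogonal to \<open>v\<close> moves differences of points by a small
relative amount only. It is therefore almost an isometry there, although \<open>b\<close> may be far from \<open>v\<close>.
\<close>

lemma hausdorff_measure_oblique_proj:
  fixes A :: "'a::euclidean_space set"
  assumes vb: "v \<bullet> b \<noteq> 0" and \<delta>: "\<delta> * norm b \<le> \<epsilon> * \<bar>v \<bullet> b\<bar>" and \<epsilon>: "0 \<le> \<epsilon>" "\<epsilon> < 1"
    and A: "\<And>x y. x \<in> A \<Longrightarrow> y \<in> A \<Longrightarrow> \<bar>v \<bullet> (x - y)\<bar> \<le> \<delta> * norm (x - y)"
  shows "hausdorff_measure m (oblique_proj v b ` A) \<le> ennreal ((1 + \<epsilon>) ^ m) * hausdorff_measure m A"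
    and "hausdorff_measure m A \<le> ennreal ((1 / (1 - \<epsilon>)) ^ m) * hausdorff_measure m (oblique_proj v b ` A)"
proof -
  let ?q = "oblique_proj v b"
  have near: "norm (?q x - ?q y - (x - y)) \<le> \<epsilon> * norm (x - y)" if "x \<in> A" "y \<in> A" for x y
  proof -
    have "?q x - ?q y - (x - y) = - ((v \<bullet> (x - y)) / (v \<bullet> b)) *\<^sub>R b"
      unfolding linear_diff[OF linear_oblique_proj, symmetric] by (simp add: oblique_proj_def)
    then have "norm (?q x - ?q y - (x - y)) = \<bar>v \<bullet> (x - y)\<bar> / \<bar>v \<bullet> b\<bar> * norm b"
      by simp
    also have "\<dots> \<le> (\<delta> * norm (x - y)) / \<bar>v \<bullet> b\<bar> * norm b"
      using A[OF that] by (intro mult_right_mono divide_right_mono) auto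
    also have "\<dots> = (\<delta> * norm b) / \<bar>v \<bullet> b\<bar> * norm (x - y)" by simp
    also have "\<dots> \<le> \<epsilon> * norm (x - y)"
      using \<delta> vb by (intro mult_right_mono) (auto simp: pos_divide_le_eq)
    finally show ?thesis .
  qed
  have up: "norm (?q x - ?q y) \<le> (1 + \<epsilon>) * norm (x - y)" if "x \<in> A" "y \<in> A" for x y
    using near[OF that] norm_triangle_ineq[of "?q x - ?q y - (x - y)" "x - y"] by (simp add: algebra_simps)
  have lo: "norm (x - y) \<le> (1 / (1 - \<epsilon>)) * norm (?q x - ?q y)" if "x \<in> A" "y \<in> A" for x y
  proof -
    have "norm (x - y) \<le> norm (?q x - ?q y) + \<epsilon> * norm (x - y)"
      using near[OF that] norm_triangle_ineq4[of "?q x - ?q y" "?q x - ?q y - (x - y)"] by simp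
    then show ?thesis using \<epsilon> by (simp add: field_simps)
  qed
  show "hausdorff_measure m (?q ` A) \<le> ennreal ((1 + \<epsilon>) ^ m) * hausdorff_measure m A"
    by (rule hausdorff_measure_Lipschitz_image) (use \<epsilon> up in auto)
  have inj: "inj_on ?q A"
  proof (rule inj_onI)
    fix x y assume "x \<in> A" "y \<in> A" "?q x = ?q y"
    then show "x = y" using lo[of x y] by simp
  qed
  have "hausdorff_measure m (the_inv_into A ?q ` ?q ` A)
      \<le> ennreal ((1 / (1 - \<epsilon>)) ^ m) * hausdorff_measure m (?q ` A)"
    by (rule hausdorff_measure_Lipschitz_image) (use \<epsilon> lo in \<open>auto simp: the_inv_into_f_f[OF inj]\<close>)
  then show "hausdorff_measure m A \<le> ennreal ((1 / (1 - \<epsilon>)) ^ m) * hausdorff_measure m (?q ` A)"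
    using inj by (simp add: image_image the_inv_into_f_f cong: image_cong_simp)
qed

section \<open>Support functions, outer normals and shadows of a convex body\<close>

text \<open>
The part of the boundary whose \<open>(n - 1)\<close>-dimensional measure is the surface area measure of \<open>\<omega>\<close>.
\<close>

definition reverse_spherical_image :: "'a::euclidean_space set \<Rightarrow> 'a set \<Rightarrow> 'a set" where
  "reverse_spherical_image K \<omega> = {x \<in> frontier K. \<exists>v\<in>\<omega>. x \<bullet> v = support_function K v}"

locale body =
  fixes K :: "'a::euclidean_space set"
  assumes convex_body: "convex_body K"
begin

abbreviation h :: "'a \<Rightarrow> real" where "h \<equiv> support_function K"
abbreviation P :: "'a set \<Rightarrow> 'a set" where "P \<equiv> reverse_spherical_image K"
abbreviation \<H> :: "'a set \<Rightarrow> ennreal" where "\<H> \<equiv> hausdorff_measure (DIM('a) - 1)"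

lemma compact_K: "compact K" and convex_K: "convex K" and interior_K: "interior K \<noteq> {}"
  using convex_body by (auto simp: convex_body_def)

lemma closed_K: "closed K" by (rule compact_imp_closed[OF compact_K])
lemma bounded_K: "bounded K" by (rule compact_imp_bounded[OF compact_K])
lemma nonempty_K: "K \<noteq> {}" using interior_K interior_subset by auto
lemma frontier_subset_K: "frontier K \<subseteq> K" using closed_K frontier_subset_eq by auto

lemma bdd_above_inner: "bdd_above ((\<bullet>) v ` K)"
proof -
  have "compact ((\<bullet>) v ` K)"
    by (intro compact_continuous_image compact_K continuous_intros)
  then show ?thesis by (intro bounded_imp_bdd_above compact_imp_bounded)
qed

lemma inner_le_support: "x \<in> K \<Longrightarrow> x \<bullet> v \<le> h v"
  unfolding support_function_def using bdd_above_inner[of v]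
  by (subst inner_commute) (rule cSUP_upper)

lemma support_attained: obtains x where "x \<in> K" "x \<bullet> v = h v"
proof -
  obtain x where x: "x \<in> K" "\<And>y. y \<in> K \<Longrightarrow> v \<bullet> y \<le> v \<bullet> x"
    using continuous_attains_sup[OF compact_K nonempty_K continuous_on_inner[OF continuous_on_const continuous_on_id], of v]
    by auto
  have "h v \<le> x \<bullet> v"
    unfolding support_function_def by (rule cSUP_least[OF nonempty_K]) (use x in \<open>auto simp: inner_commute\<close>)
  then show thesis using that x(1) inner_le_support[OF x(1)] by (meson antisym)
qed

lemma support_scaleR: "0 \<le> c \<Longrightarrow> h (c *\<^sub>R v) = c * h v"
proof -
  assume c: "0 \<le> c"
  obtain x where x: "x \<in> K" "x \<bullet> v = h v" by (rule support_attained)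
  obtain y where y: "y \<in> K" "y \<bullet> (c *\<^sub>R v) = h (c *\<^sub>R v)" by (rule support_attained)
  have "h (c *\<^sub>R v) \<le> c * h v"
    using y(2) mult_left_mono[OF inner_le_support[OF y(1), of v] c] by simp
  moreover have "c * h v \<le> h (c *\<^sub>R v)" using inner_le_support[OF x(1), of "c *\<^sub>R v"] x(2) by simp
  ultimately show ?thesis by simp
qed

lemma support_add_le: "h (u + v) \<le> h u + h v"
proof -
  obtain x where x: "x \<in> K" "x \<bullet> (u + v) = h (u + v)" by (rule support_attained)
  then show ?thesis
    using inner_le_support[OF x(1), of u] inner_le_support[OF x(1), of v] by (simp add: inner_add_right)
qed

lemma continuous_on_support: "continuous_on A h"
proof -
  obtain B where B: "\<And>x. x \<in> K \<Longrightarrow> norm x \<le> B" "0 < B"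
    using bounded_K unfolding bounded_pos by auto
  have le: "h u \<le> h v + B * norm (u - v)" for u v
  proof -
    obtain x where x: "x \<in> K" "x \<bullet> u = h u" by (rule support_attained)
    have "x \<bullet> (u - v) \<le> norm x * norm (u - v)" by (rule norm_cauchy_schwarz)
    also have "\<dots> \<le> B * norm (u - v)" using B(1)[OF x(1)] by (rule mult_right_mono) simp
    finally show ?thesis using x inner_le_support[OF x(1), of v] by (simp add: inner_diff_right)
  qed
  have "dist (h u) (h v) \<le> B * dist u v" for u v
    using le[of u v] le[of v u] by (simp add: dist_norm norm_minus_commute)
  then have "B-lipschitz_on A h" using B(2) by (auto intro!: lipschitz_onI)
  then show ?thesis by (rule lipschitz_on_continuous_on)
qed

lemma support_interior: "cball x r \<subseteq> K \<Longrightarrow> 0 \<le> r \<Longrightarrow> x \<bullet> v + r * norm v \<le> h v"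
proof (cases "v = 0")
  case False
  assume "cball x r \<subseteq> K" "0 \<le> r"
  then have "x + (r / norm v) *\<^sub>R v \<in> K" using False by (auto simp: dist_norm subset_iff)
  from inner_le_support[OF this, of v] show ?thesis
    using False by (simp add: inner_add_left power2_norm_eq_inner[symmetric] power2_eq_square)
next
  case True
  then show ?thesis using inner_le_support[of _ 0] nonempty_K support_scaleR[of 0 0] by simp
qed

lemma inner_less_support: "x \<in> interior K \<Longrightarrow> v \<noteq> 0 \<Longrightarrow> x \<bullet> v < h v"
proof -
  assume "x \<in> interior K" "v \<noteq> 0"
  then obtain r where "0 < r" "cball x r \<subseteq> K" by (auto simp: mem_interior_cball)
  then show ?thesis using support_interior[of x r v] \<open>v \<noteq> 0\<close>
    by (smt (verit) mult_pos_pos zero_less_norm_iff)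
qed

lemma frontierI: "x \<in> K \<Longrightarrow> v \<noteq> 0 \<Longrightarrow> x \<bullet> v = h v \<Longrightarrow> x \<in> frontier K"
  using inner_less_support[of x v] closed_K by (auto simp: frontier_def)

lemma frontier_normal:
  assumes "x \<in> frontier K" obtains v where "norm v = 1" "x \<bullet> v = h v"
proof -
  have "x \<in> closure K" "x \<notin> rel_interior K"
    using assms interior_K by (auto simp: frontier_def rel_interior_nonempty_interior)
  then obtain a where a: "a \<noteq> 0" "\<And>y. y \<in> closure K \<Longrightarrow> a \<bullet> x \<le> a \<bullet> y"
    using supporting_hyperplane_relative_frontier[OF convex_K, of x] by metis
  define v where "v = (- 1 / norm a) *\<^sub>R a"
  have nv: "norm v = 1" using a(1) by (simp add: v_def)
  obtain y where y: "y \<in> K" "y \<bullet> v = h v" by (rule support_attained)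
  have "a \<bullet> x \<le> a \<bullet> y" using a(2) y(1) closure_subset by blast
  then have "y \<bullet> v \<le> x \<bullet> v"
    using a(1) by (simp add: v_def inner_commute divide_right_mono)
  moreover have "x \<bullet> v \<le> h v" using assms frontier_subset_K by (intro inner_le_support) auto
  ultimately show thesis using that[OF nv] y by simp
qed

lemma reverse_spherical_image_mono: "\<omega> \<subseteq> \<omega>' \<Longrightarrow> P \<omega> \<subseteq> P \<omega>'"
  by (auto simp: reverse_spherical_image_def)

lemma reverse_spherical_image_UN: "P (\<Union>i\<in>I. \<omega> i) = (\<Union>i\<in>I. P (\<omega> i))"
  by (auto simp: reverse_spherical_image_def)

lemma reverse_spherical_image_Un: "P (\<omega> \<union> \<omega>') = P \<omega> \<union> P \<omega>'"
  by (auto simp: reverse_spherical_image_def)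

lemma reverse_spherical_image_empty [simp]: "P {} = {}"
  by (simp add: reverse_spherical_image_def)

lemma reverse_spherical_image_sphere: "P unit_sphere = frontier K"
  by (auto simp: reverse_spherical_image_def elim: frontier_normal)
    (metis frontier_normal mem_sphere_0)

lemma reverse_spherical_imageI:
  "x \<in> K \<Longrightarrow> v \<in> \<omega> \<Longrightarrow> v \<noteq> 0 \<Longrightarrow> x \<bullet> v = h v \<Longrightarrow> x \<in> P \<omega>"
  by (auto simp: reverse_spherical_image_def intro: frontierI)

lemma compact_reverse_spherical_image:
  assumes "compact \<omega>" shows "compact (P \<omega>)"
proof -
  let ?S = "(frontier K \<times> \<omega>) \<inter> {z. fst z \<bullet> snd z - h (snd z) = 0}"
  have "compact (frontier K \<times> \<omega>)"
    using assms compact_K by (intro compact_Times) (auto simp: compact_frontier)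
  moreover have "closed {z :: 'a \<times> 'a. fst z \<bullet> snd z - h (snd z) = 0}"
    by (intro closed_Collect_eq continuous_intros continuous_on_compose2[OF continuous_on_support[of UNIV]]) auto
  ultimately have "compact (fst ` ?S)"
    by (intro compact_continuous_image continuous_intros compact_Int_closed)
  moreover have "fst ` ?S = P \<omega>"
    by (force simp: reverse_spherical_image_def)
  ultimately show ?thesis by simp
qed

lemma exit_point:
  assumes "c \<in> interior K" "d \<noteq> 0"
  obtains \<tau> v where "0 < \<tau>" "c + \<tau> *\<^sub>R d \<in> K" "norm v = 1" "(c + \<tau> *\<^sub>R d) \<bullet> v = h v" "0 < d \<bullet> v"
proof -
  obtain \<tau> where \<tau>: "0 < \<tau>" "c + \<tau> *\<^sub>R d \<in> frontier K"
    using ray_to_frontier[OF bounded_K assms] by metis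
  obtain v where v: "norm v = 1" "(c + \<tau> *\<^sub>R d) \<bullet> v = h v"
    using frontier_normal[OF \<tau>(2)] by metis
  have "c \<bullet> v < h v" using v(1) by (intro inner_less_support assms) auto
  then have "0 < \<tau> * (d \<bullet> v)" using v(2) by (simp add: inner_add_left)
  then have "0 < d \<bullet> v" using \<tau>(1) by (simp add: zero_less_mult_iff)
  then show thesis using that \<tau> v frontier_subset_K by blast
qed

text \<open>
The boundary points of \<open>K\<close> that can be seen from an outer point \<open>x\<close> form a set of positive area. Shoot
rays parallel to \<open>x - c\<close> from points near an inner point \<open>c\<close>. They leave \<open>K\<close> before they come
close to \<open>x\<close>, so the supporting hyperplane at the exit point also separates \<open>x\<close> from \<open>K\<close>; and the
exit points project onto a full disc in the hyperplane orthogonal to the rays.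
\<close>

lemma visible_part_pos:
  assumes x: "x \<notin> K"
  shows "0 < \<H> (P {v \<in> unit_sphere. h v < x \<bullet> v})"
proof -
  obtain c where c: "c \<in> interior K" using interior_K by auto
  then obtain r where r: "0 < r" "cball c r \<subseteq> K" by (auto simp: mem_interior_cball)
  define d where "d = x - c"
  have d: "d \<noteq> 0" using x c interior_subset by (auto simp: d_def)
  obtain \<Delta> where \<Delta>: "0 < \<Delta>" "\<And>y. y \<in> K \<Longrightarrow> \<Delta> \<le> dist x y"
    using separate_point_closed[OF closed_K x] by auto
  obtain s where s: "0 < s" "s < r / 2" "s < \<Delta> / 2" "s * norm d < (\<Delta> / 2) * (r / 2)"
  proof -
    \<comment> \<open>the shifted rays must stay deep inside \<open>K\<close> at their start and far from \<open>K\<close> near \<open>x\<close>;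
      the last bound makes the shift smaller than the gap seen at the exit point\<close>
    define s where "s = min (min (r / 4) (\<Delta> / 4)) (\<Delta> * r / (8 * norm d))"
    have "0 < s" "s < r / 2" "s < \<Delta> / 2" using r(1) \<Delta>(1) d by (auto simp: s_def min_less_iff_disj)
    moreover have "s * norm d \<le> \<Delta> * r / (8 * norm d) * norm d"
      by (rule mult_right_mono) (auto simp: s_def)
    then have "s * norm d < (\<Delta> / 2) * (r / 2)"
      using d r(1) \<Delta>(1) by simp (smt (verit) mult_pos_pos)
    ultimately show thesis using that by blast
  qed
  show ?thesis
  proof (rule hausdorff_measure_pos_if_proj_disc[OF d \<open>0 < s\<close>])
    fix e assume e: "d \<bullet> e = 0" "norm e \<le> s"
    have ball: "cball (c + e) (r / 2) \<subseteq> K"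
    proof
      fix y assume "y \<in> cball (c + e) (r / 2)"
      then have "norm (c + e - y) \<le> r / 2" by (simp add: dist_norm)
      then have "norm (c - y) \<le> r"
        using norm_triangle_ineq4[of "c + e - y" e] e s by simp
      then show "y \<in> K" using r by (auto simp: dist_norm subset_iff)
    qed
    have "c + e \<in> interior K" using ball r(1) by (auto simp: mem_interior_cball intro: exI[of _ "r / 2"])
    then obtain \<tau> v where \<tau>: "0 < \<tau>" "c + e + \<tau> *\<^sub>R d \<in> K" "norm v = 1"
      "(c + e + \<tau> *\<^sub>R d) \<bullet> v = h v" "0 < d \<bullet> v"
      using exit_point[OF _ d] by metis
    have y: "dist x (c + e + \<tau> *\<^sub>R d) \<ge> \<Delta>" using \<Delta>(2)[OF \<tau>(2)] .
    have x: "x - (c + e + \<tau> *\<^sub>R d) = (1 - \<tau>) *\<^sub>R d - e" by (simp add: d_def algebra_simps)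
    have "\<Delta> / 2 \<le> \<bar>1 - \<tau>\<bar> * norm d"
      using y e s norm_triangle_ineq4[of "(1 - \<tau>) *\<^sub>R d" e] unfolding dist_norm x by simp
    have "\<tau> < 1"
    proof (rule ccontr)
      assume "\<not> \<tau> < 1"
      then have "1 \<le> \<tau>" by simp
      moreover have "c + e \<in> K" using ball r(1) by (simp add: subset_iff)
      ultimately have "(1 - 1 / \<tau>) *\<^sub>R (c + e) + (1 / \<tau>) *\<^sub>R (c + e + \<tau> *\<^sub>R d) \<in> K"
        using \<tau>(2) by (intro convexD_alt[OF convex_K]) auto
      also have "(1 - 1 / \<tau>) *\<^sub>R (c + e) + (1 / \<tau>) *\<^sub>R (c + e + \<tau> *\<^sub>R d) = c + e + d"
        using \<open>1 \<le> \<tau>\<close> by (simp add: algebra_simps)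
      finally have "c + e + d \<in> K" .
      then have "\<Delta> \<le> dist x (c + e + d)" by (rule \<Delta>(2))
      then show False using e s by (simp add: dist_norm d_def)
    qed
    then have 1: "\<Delta> / 2 \<le> (1 - \<tau>) * norm d" using \<open>\<Delta> / 2 \<le> \<bar>1 - \<tau>\<bar> * norm d\<close> by simp
    have "(c + e) \<bullet> v + r / 2 \<le> h v" using support_interior[OF ball, of v] r \<tau>(3) by simp
    then have "r / 2 \<le> \<tau> * (d \<bullet> v)" using \<tau>(4) by (simp add: inner_add_left)
    also have "\<dots> \<le> 1 * (d \<bullet> v)" using \<open>\<tau> < 1\<close> \<tau>(5) by (intro mult_right_mono) auto
    finally have 2: "r / 2 \<le> d \<bullet> v" by simp
    have "s * norm d < ((1 - \<tau>) * norm d) * (d \<bullet> v)"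
      using s(4) mult_mono[OF 1 2] r(1) 1 \<Delta>(1) by linarith
    then have "s * norm d < ((1 - \<tau>) * (d \<bullet> v)) * norm d" by (simp add: mult_ac)
    then have "s < (1 - \<tau>) * (d \<bullet> v)" using d by (simp add: mult_less_cancel_right)
    moreover have "e \<bullet> v \<le> s" using norm_cauchy_schwarz[of e v] e \<tau>(3) by simp
    moreover have "x \<bullet> v = h v + (1 - \<tau>) * (d \<bullet> v) - e \<bullet> v"
    proof -
      have "(x - (c + e + \<tau> *\<^sub>R d)) \<bullet> v = ((1 - \<tau>) *\<^sub>R d - e) \<bullet> v"
        by (simp only: x)
      then show ?thesis using \<tau>(4) by (simp add: inner_diff_left)
    qed
    ultimately have "h v < x \<bullet> v" by linarith
    then have mem: "c + e + \<tau> *\<^sub>R d \<in> P {v \<in> unit_sphere. h v < x \<bullet> v}"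
      using \<tau> by (intro reverse_spherical_imageI[of _ v]) auto
    have "oblique_proj d d (c + e + \<tau> *\<^sub>R d) = oblique_proj d d c + e"
      using d e by (simp add: oblique_proj_def inner_add_right add_divide_distrib algebra_simps)
    then show "oblique_proj d d c + e \<in> oblique_proj d d ` P {v \<in> unit_sphere. h v < x \<bullet> v}"
      using imageI[OF mem, of "oblique_proj d d"] by simp
  qed
qed

text \<open>
Each of two boundary points lies below the supporting hyperplane at the other one. If both have
normals close to \<open>v0\<close>, their difference is almost orthogonal to \<open>v0\<close>.
\<close>

lemma nearly_flat:
  assumes \<omega>: "\<And>v. v \<in> \<omega> \<Longrightarrow> norm (v - v0) \<le> \<delta>" and x: "x \<in> P \<omega>" and y: "y \<in> P \<omega>"
  shows "\<bar>v0 \<bullet> (x - y)\<bar> \<le> \<delta> * norm (x - y)"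
proof -
  have one: "v0 \<bullet> (y - x) \<le> \<delta> * norm (x - y)" if xy: "x \<in> P \<omega>" "y \<in> P \<omega>" for x y
  proof -
    obtain v where v: "v \<in> \<omega>" "x \<bullet> v = h v" using xy(1) by (auto simp: reverse_spherical_image_def)
    have "y \<in> K" using xy(2) frontier_subset_K by (auto simp: reverse_spherical_image_def)
    then have "v \<bullet> (y - x) \<le> 0" using inner_le_support[of y v] v by (simp add: inner_diff_right inner_commute)
    moreover have "(v0 - v) \<bullet> (y - x) \<le> norm (v - v0) * norm (x - y)"
      using norm_cauchy_schwarz[of "v0 - v" "y - x"] by (simp add: norm_minus_commute)
    moreover have "norm (v - v0) * norm (x - y) \<le> \<delta> * norm (x - y)"
      using \<omega>[OF v(1)] by (rule mult_right_mono) simp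
    ultimately show ?thesis by (simp add: inner_diff_left)
  qed
  show ?thesis using one[OF x y] one[OF y x] by (simp add: inner_diff_right norm_minus_commute abs_le_iff)
qed

text \<open>
Finitely many caps of the sphere suffice, and over each of them the boundary is a
Lipschitz graph over a bounded subset of a hyperplane.
\<close>

lemma frontier_finite: "\<H> (frontier K) < \<infinity>"
proof -
  obtain T where T: "T \<subseteq> (unit_sphere :: 'a set)" "finite T" "(unit_sphere :: 'a set) \<subseteq> (\<Union>u\<in>T. ball u (1/2))"
  proof (rule compactE_image[OF compact_sphere[of "0::'a" 1], of unit_sphere "\<lambda>u. ball u (1/2)"])
    show "(unit_sphere :: 'a set) \<subseteq> (\<Union>u\<in>unit_sphere. ball u (1/2))" by force
  qed (use that in auto)
  have fin: "\<H> (P (ball u (1/2))) < \<infinity>" if u: "norm u = 1" for u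
  proof -
    let ?A = "P (ball u (1/2))"
    have le: "\<H> ?A \<le> ennreal ((1 / (1 - 1/2)) ^ (DIM('a) - 1)) * \<H> (oblique_proj u u ` ?A)"
      by (rule hausdorff_measure_oblique_proj(2)[of _ _ "1/2"])
        (use u nearly_flat[of "ball u (1/2)" u "1/2"] in \<open>auto simp: dist_norm norm_minus_commute power2_norm_eq_inner[symmetric]\<close>)
    have "\<H> (oblique_proj u u ` ?A) < \<infinity>"
    proof -
      obtain B where B: "\<And>x. x \<in> K \<Longrightarrow> norm x \<le> B"
        using bounded_K unfolding bounded_pos by auto
      have "norm (oblique_proj u u x) \<le> B" if "x \<in> ?A" for x
        using that frontier_subset_K B[of x] norm_orthogonal_proj_le[of u x]
        by (auto simp: reverse_spherical_image_def)
      then have "oblique_proj u u ` ?A \<subseteq> {x. u \<bullet> x = 0} \<inter> cball 0 B"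
        using u by (auto intro!: inner_oblique_proj)
      then have "\<H> (oblique_proj u u ` ?A) \<le> \<H> ({x. u \<bullet> x = 0} \<inter> cball 0 B)"
        by (rule hausdorff_measure_mono)
      also have "\<dots> < \<infinity>"
        using hausdorff_measure_subspace_ball_finite[OF subspace_hyperplane, of u B] dim_hyperplane[of u] u
        by force
      finally show ?thesis .
    qed
    then show ?thesis by (intro le_less_trans[OF le]) (simp add: ennreal_mult_less_top)
  qed
  have "\<H> (\<Union>u\<in>T. P (ball u (1/2))) < \<infinity>"
    using \<open>finite T\<close> T(1)
  proof (induction T rule: finite_induct)
    case (insert u T)
    have "\<H> (\<Union>u\<in>insert u T. P (ball u (1/2))) \<le> \<H> (P (ball u (1/2))) + \<H> (\<Union>u\<in>T. P (ball u (1/2)))"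
      using hausdorff_measure_Un_le by simp
    also have "\<dots> < \<infinity>" using insert fin[of u] by (auto simp: less_top[symmetric])
    finally show ?case .
  qed simp
  moreover have "frontier K \<subseteq> (\<Union>u\<in>T. P (ball u (1/2)))"
    using T(3) reverse_spherical_image_mono unfolding reverse_spherical_image_sphere[symmetric]
      reverse_spherical_image_UN[symmetric] by blast
  ultimately show ?thesis using hausdorff_measure_mono le_less_trans by blast
qed

end

section \<open>Reflections and the projection factor of a hyperplane\<close>

definition reflect :: "'a::euclidean_space \<Rightarrow> 'a \<Rightarrow> 'a" where
  "reflect w x = x - (2 * ((w \<bullet> x) / (w \<bullet> w))) *\<^sub>R w"

lemma linear_reflect: "linear (reflect w)"
  by (rule linearI) (simp_all add: reflect_def inner_add_right add_divide_distrib algebra_simps)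

lemma reflect_reflect [simp]: "reflect w (reflect w x) = x"
proof (cases "w = 0")
  case False
  then have "w \<bullet> reflect w x = - (w \<bullet> x)" by (simp add: reflect_def inner_diff_right)
  then show ?thesis by (simp add: reflect_def[of w "reflect w x"]) (simp add: reflect_def)
qed (simp add: reflect_def)

lemma inj_reflect: "inj (reflect w)"
  by (rule inj_on_inverseI) (rule reflect_reflect)

lemma norm_reflect [simp]: "norm (reflect w x) = norm x"
proof (cases "w = 0")
  case False
  have "reflect w x \<bullet> reflect w x = x \<bullet> x"
    using False by (simp add: reflect_def inner_diff_left inner_diff_right inner_commute field_simps)
  then show ?thesis by (simp add: norm_eq_sqrt_inner)
qed (simp add: reflect_def)

lemma norm_reflect_diff [simp]: "norm (reflect w x - reflect w y) = norm (x - y)"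
  by (metis linear_diff linear_reflect norm_reflect)

lemma inner_reflect: "norm w = 1 \<Longrightarrow> w \<bullet> reflect w x = - (w \<bullet> x)"
  by (simp add: reflect_def inner_diff_right power2_norm_eq_inner[symmetric])

lemma reflect_mem_subspace: "subspace V \<Longrightarrow> w \<in> V \<Longrightarrow> x \<in> V \<Longrightarrow> reflect w x \<in> V"
  unfolding reflect_def by (intro subspace_diff subspace_scale)

lemma hausdorff_measure_reflect: "hausdorff_measure m (reflect w ` A) = hausdorff_measure m A"
  by (rule hausdorff_measure_isometry) simp

lemma continuous_on_reflect: "continuous_on A (reflect w)"
  by (rule linear_continuous_on) (simp add: linear_reflect linear_conv_bounded_linear[symmetric])

lemma proj_hyperplane_factor:
  fixes v b :: "'a::euclidean_space"
  assumes vb: "v \<bullet> b \<noteq> 0"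
  obtains c where "0 < c" "c < \<infinity>"
    "\<And>E. E \<in> sets borel \<Longrightarrow> E \<subseteq> {x. v \<bullet> x = 0} \<Longrightarrow>
       hausdorff_measure (DIM('a) - 1) (oblique_proj b b ` E) = c * hausdorff_measure (DIM('a) - 1) E"
proof -
  have v: "v \<noteq> 0" and b: "b \<bullet> b \<noteq> 0" using vb by auto
  have inv: "oblique_proj v b (oblique_proj b b x) = x" if "x \<in> {x. v \<bullet> x = 0}" for x
    using oblique_proj_oblique_proj[OF vb b] oblique_proj_id that by auto
  show thesis
    by (rule hausdorff_measure_linear_image_proportional[OF subspace_hyperplane[of v]
          linear_oblique_proj[of b b] linear_oblique_proj[of v b] inv])
      (use that dim_hyperplane[OF v] in auto)
qed

text \<open>
By uniqueness of translation invariant measures, the transvection \<open>A\<close> scales area on the hyperplane by some factor \<open>c\<close>. The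
reflection \<open>Q\<close> that changes the sign of \<open>z\<close> conjugates \<open>A\<close> to its inverse, so the inverse scales by
\<open>c\<close> as well and \<open>c\<close> equals \<open>1\<close>.
\<close>

lemma hausdorff_measure_transvection:
  fixes v w z :: "'a::euclidean_space"
  assumes v: "v \<noteq> 0" and zv: "z \<bullet> v = 0" and zw: "z \<bullet> w = 0"
  defines "A \<equiv> (\<lambda>x. x - (2 * (w \<bullet> x)) *\<^sub>R z)"
  defines "E \<equiv> {x. v \<bullet> x = 0} \<inter> cball 0 1"
  shows "hausdorff_measure (DIM('a) - 1) (A ` E) = hausdorff_measure (DIM('a) - 1) E"
proof -
  let ?H = "hausdorff_measure (DIM('a) - 1)"
  let ?V = "{x. v \<bullet> x = 0}"
  have linA: "linear A"
    unfolding A_def by (rule linearI) (simp_all add: inner_add_right algebra_simps)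
  define g where "g x = x + (2 * (w \<bullet> x)) *\<^sub>R z" for x
  have ling: "linear g"
    unfolding g_def by (rule linearI) (simp_all add: inner_add_right algebra_simps)
  have gA: "g (A x) = x" for x
    using zw by (simp add: g_def A_def inner_diff_right inner_commute)
  obtain c where c: "0 < c" "c < \<infinity>" "\<And>E. E \<in> sets borel \<Longrightarrow> E \<subseteq> ?V \<Longrightarrow> ?H (A ` E) = c * ?H E"
    by (rule hausdorff_measure_linear_image_proportional[OF subspace_hyperplane[of v] linA ling gA])
      (use dim_hyperplane[OF v] in auto)
  let ?Q = "reflect z"
  have QAQA: "?Q (A (?Q (A x))) = x" for x
  proof (cases "z = 0")
    case False
    have wQ: "w \<bullet> ?Q y = w \<bullet> y" for y
      using zw by (simp add: reflect_def inner_diff_right inner_commute)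
    have Qz: "?Q z = - z" using False by (simp add: reflect_def scaleR_2)
    have wA: "w \<bullet> A x = w \<bullet> x" using zw by (simp add: A_def inner_diff_right inner_commute)
    have "?Q (A x) = ?Q x + (2 * (w \<bullet> x)) *\<^sub>R z"
      by (simp add: A_def linear_diff[OF linear_reflect] linear_scale[OF linear_reflect] Qz)
    moreover have "A y = y - (2 * (w \<bullet> y)) *\<^sub>R z" for y
      by (simp add: A_def)
    moreover have "w \<bullet> ?Q (A x) = w \<bullet> x" by (simp only: wQ wA)
    ultimately have "A (?Q (A x)) = ?Q x" by simp
    then show ?thesis by simp
  qed (simp add: A_def reflect_def)
  have cE: "compact E" unfolding E_def by (intro closed_Int_compact closed_hyperplane compact_cball)
  have EV: "E \<subseteq> ?V" by (auto simp: E_def)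
  have QV: "?Q x \<in> ?V" if "x \<in> ?V" for x
    using that zv by (simp add: reflect_def inner_diff_right inner_commute)
  have AV: "A x \<in> ?V" if "x \<in> ?V" for x
    using that zv by (simp add: A_def inner_diff_right inner_commute)
  have contA: "continuous_on S A" for S
    using linA by (simp add: linear_conv_bounded_linear linear_continuous_on)
  have cQA: "compact (?Q ` A ` E)"
    by (intro compact_continuous_image contA continuous_on_reflect cE)
  have "?H E = ?H (?Q ` A ` ?Q ` A ` E)" by (simp add: image_image QAQA)
  also have "\<dots> = ?H (A ` ?Q ` A ` E)" by (rule hausdorff_measure_reflect)
  also have "\<dots> = c * ?H (?Q ` A ` E)"
    by (rule c(3)) (use borel_compact[OF cQA] EV AV QV in \<open>auto simp: subset_iff\<close>)
  also have "?H (?Q ` A ` E) = ?H (A ` E)" by (rule hausdorff_measure_reflect)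
  finally have 1: "?H E = c * ?H (A ` E)" .
  have 2: "?H (A ` E) = c * ?H E"
    by (rule c(3)) (use borel_compact[OF cE] EV in auto)
  \<comment> \<open>monotonicity in \<open>c\<close> replaces taking the square root of \<open>c * c = 1\<close>\<close>
  show ?thesis
  proof (cases "c \<le> 1")
    case True
    have "?H (A ` E) \<le> ?H E" unfolding 2 using mult_right_mono[OF True, of "?H E"] by simp
    moreover have "?H E \<le> ?H (A ` E)" using 1 mult_right_mono[OF True, of "?H (A ` E)"] by simp
    ultimately show ?thesis by (rule antisym)
  next
    case False
    then have "1 \<le> c" by simp
    then have "?H E \<le> ?H (A ` E)" unfolding 2 using mult_right_mono[of 1 c "?H E"] by simp
    moreover have "?H (A ` E) \<le> ?H E" using 1 mult_right_mono[OF \<open>1 \<le> c\<close>, of "?H (A ` E)"] by simp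
    ultimately show ?thesis by (intro antisym)
  qed
qed

text \<open>
The heart of the reflection argument: projecting along \<open>b\<close> shrinks areas by the same factor in the
hyperplanes orthogonal to \<open>v\<close> and to its mirror image. The map \<open>x - 2 (w \<bullet> x) b\<close> carries the first
hyperplane to the second without changing the projection along \<open>b\<close>, and followed by the reflection it
is a transvection of the first hyperplane, which preserves area.
\<close>

lemma proj_hyperplane_factor_reflect:
  fixes v w b :: "'a::euclidean_space"
  assumes w: "norm w = 1" and bw: "b \<bullet> w = 1" and bv: "b \<bullet> v = w \<bullet> v" and wv: "w \<bullet> v \<noteq> 0"
  obtains c where "0 < c" "c < \<infinity>"
    "\<And>E. E \<in> sets borel \<Longrightarrow> E \<subseteq> {x. v \<bullet> x = 0} \<Longrightarrow>
       hausdorff_measure (DIM('a) - 1) (oblique_proj b b ` E) = c * hausdorff_measure (DIM('a) - 1) E"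
    "\<And>E. E \<in> sets borel \<Longrightarrow> E \<subseteq> {x. reflect w v \<bullet> x = 0} \<Longrightarrow>
       hausdorff_measure (DIM('a) - 1) (oblique_proj b b ` E) = c * hausdorff_measure (DIM('a) - 1) E"
proof -
  let ?H = "hausdorff_measure (DIM('a) - 1)"
  let ?T = "oblique_proj b b"
  have ww: "w \<bullet> w = 1" using w by (simp add: power2_norm_eq_inner[symmetric])
  have vb: "v \<bullet> b \<noteq> 0" using bv wv by (simp add: inner_commute)
  have Rvb: "reflect w v \<bullet> b = - (w \<bullet> v)"
    using ww bw bv by (simp add: reflect_def inner_diff_left inner_diff_right inner_commute)
  obtain c where c: "0 < c" "c < \<infinity>"
    "\<And>E. E \<in> sets borel \<Longrightarrow> E \<subseteq> {x. v \<bullet> x = 0} \<Longrightarrow> ?H (?T ` E) = c * ?H E"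
    using proj_hyperplane_factor[OF vb] by metis
  have Rvb0: "reflect w v \<bullet> b \<noteq> 0" using Rvb wv by simp
  obtain c' where c': "0 < c'" "c' < \<infinity>"
    "\<And>E. E \<in> sets borel \<Longrightarrow> E \<subseteq> {x. reflect w v \<bullet> x = 0} \<Longrightarrow> ?H (?T ` E) = c' * ?H E"
    using proj_hyperplane_factor[OF Rvb0] by metis
  define E where "E = {x. v \<bullet> x = 0} \<inter> cball 0 1"
  define z where "z = b - w"
  define S where "S x = x - (2 * (w \<bullet> x)) *\<^sub>R b" for x
  have v: "v \<noteq> 0" using wv by auto
  have E: "E \<in> sets borel" "E \<subseteq> {x. v \<bullet> x = 0}" "compact E"
    unfolding E_def by (auto intro!: closed_Int_compact closed_hyperplane compact_cball)
  have HE: "0 < ?H E" "?H E < \<infinity>"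
    using hausdorff_measure_subspace_ball_pos[OF subspace_hyperplane, of 1 v]
      hausdorff_measure_subspace_ball_finite[OF subspace_hyperplane, of v 1] dim_hyperplane[OF v]
    by (auto simp: E_def)
  have TS: "?T (S x) = ?T x" for x
  proof -
    have "b \<bullet> b \<noteq> 0" using bw by auto
    then show ?thesis by (simp add: oblique_proj_def S_def inner_diff_right diff_divide_distrib algebra_simps)
  qed
  have SE: "S ` E \<subseteq> {x. reflect w v \<bullet> x = 0}"
  proof safe
    fix x assume "x \<in> E"
    then have "v \<bullet> x = 0" by (simp add: E_def)
    have "reflect w v \<bullet> S x = reflect w v \<bullet> x - 2 * (w \<bullet> x) * (reflect w v \<bullet> b)"
      by (simp add: S_def inner_diff_right)
    also have "reflect w v \<bullet> x = - 2 * (w \<bullet> v) * (w \<bullet> x)"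
      using \<open>v \<bullet> x = 0\<close> ww by (simp add: reflect_def inner_diff_left)
    finally show "reflect w v \<bullet> S x = 0" using Rvb by simp
  qed
  have contS: "continuous_on E S" unfolding S_def by (intro continuous_intros)
  have SEb: "S ` E \<in> sets borel"
    using compact_continuous_image[OF contS E(3)] by (auto dest: compact_imp_closed)
  have RS: "reflect w (S x) = x - (2 * (w \<bullet> x)) *\<^sub>R z" for x
  proof -
    have "w \<bullet> S x = - (w \<bullet> x)" using bw by (simp add: S_def inner_diff_right inner_commute)
    then show ?thesis using ww by (simp add: reflect_def) (simp add: S_def z_def algebra_simps)
  qed
  have "?H (S ` E) = ?H (reflect w ` S ` E)" by (rule hausdorff_measure_reflect[symmetric])
  also have "\<dots> = ?H ((\<lambda>x. x - (2 * (w \<bullet> x)) *\<^sub>R z) ` E)" by (simp add: image_image RS)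
  also have "\<dots> = ?H E"
    unfolding E_def by (rule hausdorff_measure_transvection[OF v])
      (use bw ww bv in \<open>simp_all add: z_def inner_diff_left\<close>)
  finally have HS: "?H (S ` E) = ?H E" .
  have "c * ?H E = ?H (?T ` E)" using c(3)[OF E(1,2)] by simp
  also have "\<dots> = ?H (?T ` S ` E)" by (simp add: image_image TS)
  also have "\<dots> = c' * ?H E" using c'(3)[OF SEb SE] HS by simp
  finally have "?H E * c = ?H E * c'" by (simp add: mult.commute)
  then have "c = c'"
    using HE by (auto simp: ennreal_mult_cancel_left less_top[symmetric])
  then show thesis using that c c'(3) by blast
qed

section \<open>Cones and subspaces\<close>

text \<open>
The vector \<open>q\<close> shows that the cone contains no line and has a compact base, which can be separated
strictly from \<open>H\<close>.
\<close>

lemma cone_disjoint_subspace_separation: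
  fixes C H :: "'a::euclidean_space set"
  assumes C: "closed C" "convex C"
    and q: "0 < r" "\<And>v. v \<in> C \<Longrightarrow> r * norm v \<le> q \<bullet> v"
    and scale: "\<And>c v. 0 \<le> c \<Longrightarrow> v \<in> C \<Longrightarrow> c *\<^sub>R v \<in> C"
    and H: "subspace H" "H \<noteq> UNIV" and CH: "C \<inter> H \<subseteq> {0}"
  obtains z where "z \<noteq> 0" "\<And>y. y \<in> H \<Longrightarrow> z \<bullet> y = 0" "\<And>v. v \<in> C \<Longrightarrow> z \<bullet> v \<le> 0"
proof (cases "C \<subseteq> {0}")
  case True
  obtain z where "z \<noteq> 0" "\<And>y. y \<in> span H \<Longrightarrow> orthogonal z y"
    using orthogonal_to_subspace_exists_gen[of H UNIV] H by (metis psubsetI span_UNIV span_eq_iff subset_UNIV)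
  then show thesis using that True H(1) by (metis inner_zero_right order_refl orthogonal_def singletonD span_eq_iff subset_iff)
next
  case False
  define X where "X = C \<inter> {v. q \<bullet> v = 1}"
  have pos: "0 < q \<bullet> v" if "v \<in> C" "v \<noteq> 0" for v
    using q(2)[OF that(1)] that(2) q(1) by (smt (verit) mult_pos_pos zero_less_norm_iff)
  have "X \<noteq> {}"
  proof -
    obtain v where v: "v \<in> C" "v \<noteq> 0" using False by auto
    then have "(1 / (q \<bullet> v)) *\<^sub>R v \<in> X" using pos[OF v] scale[of "1 / (q \<bullet> v)" v] by (auto simp: X_def)
    then show ?thesis by auto
  qed
  have "bounded X"
    using q by (intro boundedI[of _ "1 / r"]) (force simp: X_def pos_le_divide_eq mult.commute)
  then have "compact X"
    unfolding X_def compact_eq_bounded_closed using C(1) by (auto intro!: closed_Int closed_hyperplane)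
  moreover have "convex X" unfolding X_def by (intro convex_Int C convex_hyperplane)
  moreover have "H \<inter> X = {}" using CH by (force simp: X_def)
  ultimately obtain a \<beta> where a: "\<forall>x\<in>H. a \<bullet> x < \<beta>" "\<forall>x\<in>X. a \<bullet> x > \<beta>"
    using separating_hyperplane_closed_compact[OF subspace_imp_convex[OF H(1)] closed_subspace[OF H(1)]] \<open>X \<noteq> {}\<close>
    by metis
  have \<beta>: "0 < \<beta>" using a(1) subspace_0[OF H(1)] by force
  have aH: "a \<bullet> y = 0" if y: "y \<in> H" for y
  proof (rule ccontr)
    assume n: "a \<bullet> y \<noteq> 0"
    have "(\<beta> / (a \<bullet> y)) *\<^sub>R y \<in> H" using y H(1) by (simp add: subspace_scale)
    then have "a \<bullet> ((\<beta> / (a \<bullet> y)) *\<^sub>R y) < \<beta>" using a(1) by blast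
    then show False using n by simp
  qed
  have aC: "0 \<le> a \<bullet> v" if v: "v \<in> C" for v
  proof (cases "v = 0")
    case False
    then have "(1 / (q \<bullet> v)) *\<^sub>R v \<in> X" using pos[OF v] scale[of "1 / (q \<bullet> v)" v] v by (auto simp: X_def)
    then have "0 < a \<bullet> ((1 / (q \<bullet> v)) *\<^sub>R v)" using a(2) \<beta> by force
    then show ?thesis using pos[OF v False] by (simp add: zero_less_divide_iff)
  qed simp
  have "a \<noteq> 0" using a(2) \<open>X \<noteq> {}\<close> \<beta> by force
  then show thesis using that[of "- a"] aH aC by auto
qed

text \<open>
Let \<open>u\<close> be the point of smallest norm in the base \<open>q \<bullet> v = 1\<close> of the cone \<open>C \<inter> H\<close>. Minimality makes
\<open>u \<bullet> v\<close> positive for all nonzero \<open>v\<close> in \<open>C \<inter> H\<close>. This positivity extends from \<open>C \<inter> H\<close> to all of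
\<open>C\<close> once \<open>u\<close> is corrected by a suitable \<open>z\<close> orthogonal to \<open>H\<close>: otherwise \<open>u\<close> could be separated from
the sum of the dual cone of \<open>C\<close> and the orthogonal complement of \<open>H\<close>, and by the bipolar theorem the
separating functional would be an element of \<open>C \<inter> H\<close> on which \<open>u\<close> is not positive. The directions
\<open>w\<close> and \<open>b\<close> are the negatives of \<open>u\<close> and of the corrected vector, scaled so that \<open>w\<close> is a unit vector.
\<close>

lemma cone_meets_subspace_direction:
  fixes C H :: "'a::euclidean_space set"
  assumes C: "closed C" "convex C"
    and q: "0 < r" "\<And>v. v \<in> C \<Longrightarrow> r * norm v \<le> q \<bullet> v"
    and scale: "\<And>c v. 0 \<le> c \<Longrightarrow> v \<in> C \<Longrightarrow> c *\<^sub>R v \<in> C"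
    and H: "subspace H" and CH: "\<not> C \<inter> H \<subseteq> {0}"
  obtains w b where "norm w = 1" "w \<in> H" "- w \<in> C" "\<And>y. y \<in> H \<Longrightarrow> b \<bullet> y = w \<bullet> y"
    "\<And>v. v \<in> C \<Longrightarrow> b \<bullet> v \<le> 0"
proof -
  have pos: "0 < q \<bullet> v" if "v \<in> C" "v \<noteq> 0" for v
    using q(2)[OF that(1)] that(2) q(1) by (smt (verit) mult_pos_pos zero_less_norm_iff)
  define Y where "Y = C \<inter> H \<inter> {v. q \<bullet> v = 1}"
  have YI: "(1 / (q \<bullet> v)) *\<^sub>R v \<in> Y" if "v \<in> C" "v \<in> H" "v \<noteq> 0" for v
    using that pos[OF that(1,3)] scale[of "1 / (q \<bullet> v)" v] H by (auto simp: Y_def subspace_scale)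
  have "Y \<noteq> {}" using CH YI by fastforce
  have "closed Y" unfolding Y_def by (intro closed_Int C closed_subspace H closed_hyperplane)
  have "convex Y" unfolding Y_def by (intro convex_Int C subspace_imp_convex H convex_hyperplane)
  obtain u where u: "u \<in> Y" "\<And>y. y \<in> Y \<Longrightarrow> dist 0 u \<le> dist 0 y"
    using distance_attains_inf[OF \<open>closed Y\<close> \<open>Y \<noteq> {}\<close>, of 0] by blast
  have u0: "u \<noteq> 0" "u \<in> C" "u \<in> H" using u(1) by (auto simp: Y_def)
  have uY: "u \<bullet> u \<le> u \<bullet> y" if "y \<in> Y" for y
    using any_closest_point_dot[OF \<open>convex Y\<close> \<open>closed Y\<close> u(1) that, of 0] u(2)
    by (simp add: inner_diff_right)
  have upos: "0 < u \<bullet> v" if v: "v \<in> C" "v \<in> H" "v \<noteq> 0" for v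
  proof -
    have "0 < u \<bullet> u" using u0 by simp
    also have "\<dots> \<le> u \<bullet> ((1 / (q \<bullet> v)) *\<^sub>R v)" by (rule uY[OF YI[OF v]])
    finally show ?thesis using pos[OF v(1,3)] by (simp add: zero_less_divide_iff)
  qed
  define D where "D = {a. \<forall>v\<in>C. 0 \<le> a \<bullet> v}"
  define G where "G = {a + z |a z. a \<in> D \<and> z \<in> {z. \<forall>y\<in>H. z \<bullet> y = 0}}"
  have "convex D"
    unfolding D_def convex_def by (auto simp: inner_add_left)
  moreover have "convex {z. \<forall>y\<in>H. z \<bullet> y = 0}"
    unfolding convex_def by (auto simp: inner_add_left)
  ultimately have "convex (\<Union>a\<in>D. \<Union>z\<in>{z. \<forall>y\<in>H. z \<bullet> y = 0}. {a + z})"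
    by (rule convex_sums)
  also have "(\<Union>a\<in>D. \<Union>z\<in>{z. \<forall>y\<in>H. z \<bullet> y = 0}. {a + z}) = G"
    by (auto simp: G_def)
  finally have "convex G" .
  have scaleD: "t *\<^sub>R a \<in> D" if "a \<in> D" "0 \<le> t" for a t using that by (auto simp: D_def)
  have DG: "a \<in> G" if "a \<in> D" for a using that unfolding G_def by (intro CollectI exI[of _ a] exI[of _ 0]) auto
  have zG: "z \<in> G" if "\<And>y. y \<in> H \<Longrightarrow> z \<bullet> y = 0" for z
    using that unfolding G_def by (intro CollectI exI[of _ 0] exI[of _ z]) (auto simp: D_def)
  have "u \<in> G"
  proof (rule ccontr)
    assume "u \<notin> G"
    have "G \<noteq> {}" using zG[of 0] by auto
    then obtain g \<beta> where g: "g \<noteq> 0" "g \<bullet> u \<le> \<beta>" "\<And>x. x \<in> G \<Longrightarrow> \<beta> \<le> g \<bullet> x"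
      using separating_hyperplane_sets[of "{u}" G] \<open>convex G\<close> \<open>u \<notin> G\<close> by auto
    have \<beta>: "\<beta> \<le> 0" using g(3)[OF zG[of 0]] by simp
    have nonneg: "0 \<le> g \<bullet> x" if x: "\<And>t. 0 \<le> t \<Longrightarrow> t *\<^sub>R x \<in> G" for x
    proof (rule ccontr)
      assume n: "\<not> 0 \<le> g \<bullet> x"
      define t where "t = (\<beta> - 1) / (g \<bullet> x)"
      have "0 \<le> t" using n \<beta> by (simp add: t_def divide_nonpos_neg)
      then have "\<beta> \<le> t * (g \<bullet> x)" using g(3)[OF x] by simp
      then show False using n by (simp add: t_def)
    qed
    have gD: "0 \<le> g \<bullet> a" if "a \<in> D" for a
      by (rule nonneg) (use scaleD that DG in blast)
    have gz: "g \<bullet> z = 0" if z: "\<And>y. y \<in> H \<Longrightarrow> z \<bullet> y = 0" for z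
      using nonneg[of z] nonneg[of "- z"] zG z by (simp add: antisym)
    have gH: "g \<in> H"
    proof -
      obtain y z where yz: "y \<in> span H" "\<And>x. x \<in> span H \<Longrightarrow> orthogonal z x" "g = y + z"
        using orthogonal_subspace_decomp_exists[of H g] by metis
      have "H = span H" using H by (metis span_eq_iff)
      then have "g \<bullet> z = 0" using gz yz(2) by (auto simp: orthogonal_def)
      moreover have "y \<bullet> z = 0" using yz(1,2) by (auto simp: orthogonal_def inner_commute)
      ultimately have "z = 0" using yz(3) by (simp add: inner_add_left)
      then show ?thesis using yz \<open>H = span H\<close> by simp
    qed
    have gC: "g \<in> C"
    proof (rule ccontr)
      assume "g \<notin> C"
      then obtain a \<gamma> where a: "a \<bullet> g < \<gamma>" "\<And>x. x \<in> C \<Longrightarrow> \<gamma> < a \<bullet> x"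
        using separating_hyperplane_closed_point[OF C(2,1)] by metis
      have "0 \<in> C" using scale[of 0 u] u0 by simp
      then have \<gamma>: "\<gamma> < 0" using a(2)[of 0] by simp
      have "a \<in> D"
      proof -
        have "0 \<le> a \<bullet> x" if x: "x \<in> C" for x
        proof (rule ccontr)
          assume n: "\<not> 0 \<le> a \<bullet> x"
          then have "0 \<le> \<gamma> / (a \<bullet> x)" using \<gamma> by (simp add: divide_nonpos_neg)
          then have "\<gamma> < a \<bullet> ((\<gamma> / (a \<bullet> x)) *\<^sub>R x)" using a(2) scale x by blast
          then show False using n by simp
        qed
        then show ?thesis by (simp add: D_def)
      qed
      then show False using gD[of a] a(1) \<gamma> by (simp add: inner_commute)
    qed
    show False using upos[OF gC gH g(1)] g(2) \<beta> by (simp add: inner_commute)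
  qed
  then obtain a z where az: "u = a + z" "a \<in> D" "\<And>y. y \<in> H \<Longrightarrow> z \<bullet> y = 0"
    by (auto simp: G_def)
  define w where "w = (- 1 / norm u) *\<^sub>R u"
  define b where "b = (- 1 / norm u) *\<^sub>R a"
  show thesis
  proof (rule that[of w b])
    show "norm w = 1" using u0 by (simp add: w_def)
    show "w \<in> H" using u0 H by (simp add: w_def subspace_scale subspace_neg)
    show "- w \<in> C" using scale[of "1 / norm u" u] u0 by (simp add: w_def)
    show "b \<bullet> y = w \<bullet> y" if "y \<in> H" for y
      using az(3)[OF that] by (simp add: w_def b_def az(1) inner_add_left)
    show "b \<bullet> v \<le> 0" if "v \<in> C" for v
      using az(2) that by (simp add: b_def D_def)
  qed
qed

section \<open>What the equation says about the surface area measure\<close>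

text \<open>
The cap projects onto a neighbourhood of the origin in the orthogonal complement of \<open>w\<close> in \<open>H\<close>.
\<close>

lemma subspace_sphere_cap_pos:
  fixes H :: "'a::euclidean_space set"
  assumes H: "subspace H" and w: "w \<in> H" "norm w = 1" and r: "0 < r"
  shows "0 < hausdorff_measure (dim H - 1) ({v \<in> unit_sphere. norm (v - w) < r} \<inter> H)"
proof -
  let ?V = "{y \<in> H. \<forall>x \<in> span {w}. orthogonal x y}"
  have w0: "w \<noteq> 0" using w by auto
  have "span {w} \<subseteq> H" using H w by (simp add: span_minimal)
  then have "dim ?V + dim (span {w}) = dim H"
    by (rule dim_subspace_orthogonal_to_vectors[OF subspace_span H])
  then have dimV: "dim ?V = dim H - 1" using w0 by (simp add: dim_span)
  have subV: "subspace ?V"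
    using H unfolding subspace_def by (auto simp: orthogonal_clauses)
  have orth: "w \<bullet> y = 0" if "y \<in> ?V" for y
    using that span_base[of w "{w}"] by (auto simp: orthogonal_def)
  define s where "s = min (1 / 2) (r / 3)"
  have s: "0 < s" "s \<le> 1 / 2" "2 * s < r" using r by (auto simp: s_def)
  let ?A = "{v \<in> unit_sphere. norm (v - w) < r} \<inter> H"
  have "?V \<inter> cball 0 s \<subseteq> oblique_proj w w ` ?A"
  proof
    fix y assume y: "y \<in> ?V \<inter> cball 0 s"
    then have ny: "norm y \<le> s" and wy: "w \<bullet> y = 0" using orth by auto
    define c where "c = sqrt (1 - (norm y)\<^sup>2)"
    have "(norm y)\<^sup>2 \<le> norm y"
      using ny s by (simp add: power2_eq_square mult_left_le_one_le)
    then have y1: "(norm y)\<^sup>2 \<le> 1" "(norm y)\<^sup>2 \<le> norm y" using ny s by linarith+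
    have c: "c\<^sup>2 = 1 - (norm y)\<^sup>2" "0 \<le> c" "c \<le> 1" using y1 by (auto simp: c_def)
    have "1 - (norm y)\<^sup>2 \<le> c"
      using c mult_right_mono[of c 1 c] by (simp add: power2_eq_square)
    define v where "v = y + c *\<^sub>R w"
    have "(norm v)\<^sup>2 = (norm y)\<^sup>2 + (norm (c *\<^sub>R w))\<^sup>2"
      unfolding v_def by (rule norm_add_Pythagorean) (simp add: orthogonal_def wy inner_commute)
    then have "(norm v)\<^sup>2 = 1\<^sup>2" using c w by (simp add: power_mult_distrib)
    then have "norm v = 1" by (rule power2_eq_imp_eq) auto
    moreover have "norm (v - w) < r"
    proof -
      have "v - w = y - (1 - c) *\<^sub>R w" by (simp add: v_def algebra_simps)
      then have "norm (v - w) \<le> norm y + (1 - c)"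
        using norm_triangle_ineq4[of y "(1 - c) *\<^sub>R w"] w c by simp
      then show ?thesis using \<open>1 - (norm y)\<^sup>2 \<le> c\<close> y1 ny s by linarith
    qed
    moreover have "v \<in> H" using y H w unfolding v_def by (intro subspace_add subspace_scale) auto
    moreover have "oblique_proj w w v = y"
      using wy w0 by (simp add: oblique_proj_def v_def inner_add_right)
    ultimately show "y \<in> oblique_proj w w ` ?A"
      by (intro image_eqI[of _ _ v]) auto
  qed
  then have "hausdorff_measure (dim H - 1) (?V \<inter> cball 0 s)
      \<le> hausdorff_measure (dim H - 1) (oblique_proj w w ` ?A)"
    by (rule hausdorff_measure_mono)
  also have "\<dots> \<le> hausdorff_measure (dim H - 1) ?A"
    by (rule hausdorff_measure_orthogonal_proj_le)
  finally show ?thesis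
    using hausdorff_measure_subspace_ball_pos[OF subV s(1)] unfolding dimV by (rule less_le_trans[rotated])
qed

locale Lp_solution = body K for K :: "'a::euclidean_space set" +
  fixes p :: real and H :: "'a set"
  assumes zero_mem: "0 \<in> K" and p_less_1: "p < 1"
    and subspace_H: "subspace H" and dim_H_pos: "1 \<le> dim H" and dim_H_le: "dim H \<le> DIM('a) - 1"
    and Lp_equation: "Lp_surface_area_measure p K = subspace_sphere_measure (dim H) H"
begin

abbreviation S :: "'a measure" where "S \<equiv> surface_area_measure K"
abbreviation \<mu> :: "'a measure" where "\<mu> \<equiv> subspace_sphere_measure (dim H) H"

lemma support_nonneg: "0 \<le> h v"
  using inner_le_support[OF zero_mem, of v] by simp

lemma sets_S [simp, measurable_cong]: "sets S = sphere_borel"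
proof -
  interpret sigma_algebra unit_sphere "sphere_borel :: 'a set set"
    using sets.sigma_algebra_axioms[of "restrict_space borel (unit_sphere :: 'a set)"]
    by (simp add: space_restrict_space)
  show ?thesis unfolding surface_area_measure_def by (simp add: sigma_sets_eq space_closed)
qed

lemma space_S [simp]: "space S = unit_sphere"
  using sets_eq_imp_space_eq[OF sets_S] by (simp add: space_restrict_space)

lemma sets_\<mu> [simp, measurable_cong]: "sets \<mu> = sphere_borel"
  using Lp_equation unfolding Lp_surface_area_measure_def by (metis sets_S sets_density)

lemma space_\<mu> [simp]: "space \<mu> = unit_sphere"
  using sets_eq_imp_space_eq[OF sets_\<mu>] by (simp add: space_restrict_space)

lemma measurable_support: "h \<in> borel_measurable (restrict_space borel unit_sphere)"
  by (intro measurable_restrict_space1 borel_measurable_continuous_onI continuous_on_support)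

lemma measurable_support_S [measurable]: "h \<in> borel_measurable S" "h \<in> borel_measurable \<mu>"
  using measurable_support by (simp_all cong: measurable_cong_sets)

lemma \<mu>_eq_density: "\<mu> = density S (\<lambda>v. ennreal (h v powr (1 - p)))"
  using Lp_equation by (simp add: Lp_surface_area_measure_def)

lemma emeasure_\<mu>: "\<omega> \<in> sphere_borel \<Longrightarrow> emeasure \<mu> \<omega> = hausdorff_measure (dim H - 1) (\<omega> \<inter> H)"
  by (rule emeasure_subspace_sphere_measure[OF subspace_H])

lemma cap_pos:
  assumes "w \<in> H" "norm w = 1" "0 < r"
  shows "0 < emeasure \<mu> {v \<in> unit_sphere. norm (v - w) < r}"
proof -
  have "{v. norm (v - w) < r} \<in> sets borel" by measurable
  then have "{v \<in> unit_sphere. norm (v - w) < r} \<in> sphere_borel"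
    by (auto simp: sphere_borel_iff Collect_conj_eq)
  then show ?thesis using subspace_sphere_cap_pos[OF subspace_H assms] by (simp add: emeasure_\<mu>)
qed

text \<open>
The surface area measure is obtained from a set function by \<^const>\<open>measure_of\<close>, which yields the
zero measure if the set function fails to be countably additive. The zero measure is impossible here,
because its densities vanish and \<open>\<mu>\<close> does not. Countable additivity thus follows from the equation
itself.
\<close>

lemma emeasure_S:
  assumes "\<omega> \<in> sphere_borel"
  shows "emeasure S \<omega> = \<H> (P \<omega>)"
proof -
  let ?\<sigma> = "\<lambda>\<omega>. \<H> (P \<omega>)"
  interpret sigma_algebra unit_sphere "sphere_borel :: 'a set set"
    using sets.sigma_algebra_axioms[of "restrict_space borel (unit_sphere :: 'a set)"]
    by (simp add: space_restrict_space)
  have S_eq: "S = measure_of unit_sphere sphere_borel ?\<sigma>"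
    unfolding surface_area_measure_def reverse_spherical_image_def by simp
  have conv: "emeasure S = (\<lambda>\<omega>. if \<omega> \<in> sphere_borel \<and> measure_space unit_sphere sphere_borel ?\<sigma> then ?\<sigma> \<omega> else 0)"
    unfolding S_eq emeasure_measure_of_conv sigma_sets_eq ..
  have "measure_space unit_sphere sphere_borel ?\<sigma>"
  proof (rule ccontr)
    assume "\<not> ?thesis"
    then have "unit_sphere \<in> null_sets S" unfolding null_sets_def using conv top by simp
    moreover have "absolutely_continuous S \<mu>"
      unfolding \<mu>_eq_density by (rule absolutely_continuousI_density) measurable
    ultimately have "unit_sphere \<in> null_sets \<mu>" by (auto simp: absolutely_continuous_def)
    then have null: "emeasure \<mu> unit_sphere = 0" by auto
    obtain u where "u \<in> H" "u \<noteq> 0"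
    proof -
      have "\<not> H \<subseteq> {0}" using dim_H_pos by (metis dim_eq_0 not_one_le_zero)
      then show thesis using that by auto
    qed
    then have w: "(1 / norm u) *\<^sub>R u \<in> H" "norm ((1 / norm u) *\<^sub>R u) = 1"
      using subspace_H by (simp_all add: subspace_scale)
    have "emeasure \<mu> {v \<in> unit_sphere. norm (v - (1 / norm u) *\<^sub>R u) < 1} \<le> emeasure \<mu> unit_sphere"
      by (rule emeasure_mono) (use top in auto)
    then show False using cap_pos[OF w, of 1] null by simp
  qed
  then show ?thesis using conv assms by simp
qed

lemma finite_measure_S: "finite_measure S"
proof
  interpret sigma_algebra unit_sphere "sphere_borel :: 'a set set"
    using sets.sigma_algebra_axioms[of "restrict_space borel (unit_sphere :: 'a set)"]
    by (simp add: space_restrict_space)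
  show "emeasure S (space S) \<noteq> \<infinity>"
    using frontier_finite by (simp add: emeasure_S top reverse_spherical_image_sphere less_top[symmetric])
qed

lemma emeasure_\<mu>_integral:
  "\<omega> \<in> sphere_borel \<Longrightarrow> emeasure \<mu> \<omega> = (\<integral>\<^sup>+v. ennreal (h v powr (1 - p)) * indicator \<omega> v \<partial>S)"
  by (subst \<mu>_eq_density, subst emeasure_density) auto

text \<open>
On normals outside \<open>H\<close> the density \<open>h powr (1 - p)\<close> has integral zero, so the surface area measure is
carried by \<open>H\<close> and the zeros of \<open>h\<close>, which are the normals at the origin.
\<close>

lemma null_off_H:
  assumes \<omega>: "\<omega> \<in> sphere_borel" and "\<omega> \<inter> H = {}" and nz: "\<And>v. v \<in> \<omega> \<Longrightarrow> h v \<noteq> 0"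
  shows "\<H> (P \<omega>) = 0"
proof -
  have "emeasure \<mu> \<omega> = 0" using assms by (simp add: emeasure_\<mu>)
  then have "(\<integral>\<^sup>+v. ennreal (h v powr (1 - p)) * indicator \<omega> v \<partial>S) = 0"
    using emeasure_\<mu>_integral[OF \<omega>] by simp
  then have "AE v in S. ennreal (h v powr (1 - p)) * indicator \<omega> v = 0"
    by (subst (asm) nn_integral_0_iff_AE) (use \<omega> in auto)
  then have "AE v in S. v \<notin> \<omega>"
  proof (rule AE_mp, intro AE_I2 impI notI)
    fix v assume "ennreal (h v powr (1 - p)) * indicator \<omega> v = 0" "v \<in> \<omega>"
    then show False using nz[of v] support_nonneg[of v] by (auto simp: ennreal_eq_0_iff)
  qed
  then have "emeasure S \<omega> = 0" using \<omega> sets.sets_into_space[of \<omega> S]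
    by (subst (asm) AE_iff_measurable[of \<omega>]) auto
  then show ?thesis by (simp add: emeasure_S[OF \<omega>])
qed

lemma \<mu>_zero_support:
  assumes \<omega>: "\<omega> \<in> sphere_borel" and z: "\<And>v. v \<in> \<omega> \<Longrightarrow> h v = 0"
  shows "emeasure \<mu> \<omega> = 0"
proof -
  have "(\<integral>\<^sup>+v. ennreal (h v powr (1 - p)) * indicator \<omega> v \<partial>S) = (\<integral>\<^sup>+v. 0 \<partial>S)"
    by (rule nn_integral_cong) (auto simp: z indicator_def)
  then show ?thesis by (simp add: emeasure_\<mu>_integral[OF \<omega>])
qed

lemma integral_\<mu>_S:
  assumes \<omega>: "\<omega> \<in> sphere_borel"
  shows "(\<integral>\<^sup>+v. ennreal (h v powr (p - 1)) * indicator \<omega> v \<partial>\<mu>) = \<H> (P (\<omega> \<inter> {v. h v \<noteq> 0}))"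
proof -
  have \<omega>': "\<omega> \<inter> {v. h v \<noteq> 0} \<in> sphere_borel"
  proof -
    have "{v. h v \<noteq> 0} \<in> sets borel"
      using borel_measurable_continuous_onI[OF continuous_on_support[of UNIV]] by measurable
    then show ?thesis using \<omega> by (auto simp: sphere_borel_iff)
  qed
  have "(\<integral>\<^sup>+v. ennreal (h v powr (p - 1)) * indicator \<omega> v \<partial>\<mu>)
      = (\<integral>\<^sup>+v. ennreal (h v powr (1 - p)) * (ennreal (h v powr (p - 1)) * indicator \<omega> v) \<partial>S)"
    unfolding \<mu>_eq_density by (rule nn_integral_density) (use \<omega> in measurable)
  also have "\<dots> = (\<integral>\<^sup>+v. indicator (\<omega> \<inter> {v. h v \<noteq> 0}) v \<partial>S)"
  proof (rule nn_integral_cong)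
    fix v
    show "ennreal (h v powr (1 - p)) * (ennreal (h v powr (p - 1)) * indicator \<omega> v)
       = indicator (\<omega> \<inter> {v. h v \<noteq> 0}) v"
      using support_nonneg[of v]
      by (auto simp: indicator_def ennreal_mult[symmetric] powr_add[symmetric])
  qed
  also have "\<dots> = \<H> (P (\<omega> \<inter> {v. h v \<noteq> 0}))"
    using \<omega>' by (simp add: emeasure_S)
  finally show ?thesis .
qed

lemma reflect_image_sphere_borel:
  assumes "\<omega> \<in> sphere_borel" shows "reflect w ` \<omega> \<in> sphere_borel"
proof -
  have "reflect w ` \<omega> = reflect w -` \<omega>" by (force simp: image_iff)
  moreover have "reflect w -` \<omega> \<in> sets borel"
    using measurable_sets[OF borel_measurable_continuous_onI[OF continuous_on_reflect[of UNIV w]], of \<omega>]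
      assms by (simp add: sphere_borel_iff)
  ultimately show ?thesis using assms by (auto simp: sphere_borel_iff)
qed

lemma distr_\<mu>_reflect:
  assumes w: "w \<in> H"
  shows "reflect w \<in> measurable \<mu> \<mu>" "distr \<mu> \<mu> (reflect w) = \<mu>"
proof -
  have "reflect w \<in> measurable (restrict_space borel unit_sphere) (restrict_space borel unit_sphere)"
    by (intro measurable_restrict_space2 measurable_restrict_space1
        borel_measurable_continuous_onI continuous_on_reflect) (auto simp: space_restrict_space)
  then show m: "reflect w \<in> measurable \<mu> \<mu>"
    by (simp cong: measurable_cong_sets)
  show "distr \<mu> \<mu> (reflect w) = \<mu>"
  proof (rule measure_eqI)
    fix \<omega> assume "\<omega> \<in> sets (distr \<mu> \<mu> (reflect w))"
    then have \<omega>: "\<omega> \<in> sphere_borel" by simp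
    have "reflect w -` \<omega> \<inter> space \<mu> = reflect w ` \<omega>"
      using \<omega> by (force simp: image_iff sphere_borel_iff)
    then have "emeasure (distr \<mu> \<mu> (reflect w)) \<omega> = emeasure \<mu> (reflect w ` \<omega>)"
      using \<omega> by (simp add: emeasure_distr[OF m])
    also have "\<dots> = hausdorff_measure (dim H - 1) (reflect w ` \<omega> \<inter> H)"
      by (rule emeasure_\<mu>[OF reflect_image_sphere_borel[OF \<omega>]])
    also have "reflect w ` \<omega> \<inter> H = reflect w ` (\<omega> \<inter> H)"
      using reflect_mem_subspace[OF subspace_H w] by (force simp: image_iff)
    also have "hausdorff_measure (dim H - 1) \<dots> = emeasure \<mu> \<omega>"
      by (simp add: hausdorff_measure_reflect emeasure_\<mu>[OF \<omega>])
    finally show "emeasure (distr \<mu> \<mu> (reflect w)) \<omega> = emeasure \<mu> \<omega>" .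
  qed simp
qed

text \<open>
Where \<open>h\<close> is positive, the surface area measure is \<open>h powr (p - 1)\<close> times the reflection invariant
measure \<open>\<mu>\<close>. The zeros of \<open>h\<close> form a \<open>\<mu>\<close>-null set and can only add area on the right-hand side.
\<close>

lemma compare_reflected:
  assumes w: "w \<in> H" and \<omega>: "\<omega> \<in> sphere_borel" and \<gamma>: "0 \<le> \<gamma>"
    and pos: "\<And>v. v \<in> \<omega> \<Longrightarrow> h v \<noteq> 0"
    and le: "\<And>v. v \<in> \<omega> \<Longrightarrow> h (reflect w v) \<noteq> 0 \<Longrightarrow> h v powr (p - 1) \<le> \<gamma> * h (reflect w v) powr (p - 1)"
  shows "\<H> (P \<omega>) \<le> ennreal \<gamma> * \<H> (P (reflect w ` \<omega>))"
proof -
  let ?g = "\<lambda>v. ennreal (h v powr (p - 1))"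
  let ?R\<omega> = "reflect w ` \<omega>"
  have R\<omega>: "?R\<omega> \<in> sphere_borel" by (rule reflect_image_sphere_borel[OF \<omega>])
  have hm: "h \<in> borel_measurable borel"
    by (rule borel_measurable_continuous_onI[OF continuous_on_support])
  have Rm: "reflect w \<in> borel_measurable borel"
    by (rule borel_measurable_continuous_onI[OF continuous_on_reflect])
  let ?Z = "\<omega> \<inter> {v. h (reflect w v) = 0}"
  have Z: "?Z \<in> sphere_borel"
  proof -
    have "{v. h (reflect w v) = 0} \<in> sets borel" using hm Rm by measurable
    then show ?thesis using \<omega> by (auto simp: sphere_borel_iff)
  qed
  have "emeasure \<mu> ?Z = emeasure (distr \<mu> \<mu> (reflect w)) ?Z" by (simp add: distr_\<mu>_reflect(2)[OF w])
  also have "\<dots> = emeasure \<mu> (reflect w -` ?Z \<inter> space \<mu>)"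
    using Z by (simp add: emeasure_distr[OF distr_\<mu>_reflect(1)[OF w]])
  also have "\<dots> = 0"
  proof (rule \<mu>_zero_support)
    show "reflect w -` ?Z \<inter> space \<mu> \<in> sphere_borel"
      using measurable_sets[OF distr_\<mu>_reflect(1)[OF w], of ?Z] Z by simp
  qed auto
  finally have AE: "AE v in \<mu>. v \<notin> ?Z"
    using Z sets.sets_into_space[of ?Z \<mu>] by (subst AE_iff_measurable[of ?Z]) auto
  have gm: "(\<lambda>v. ?g v * indicator ?R\<omega> v) \<in> borel_measurable \<mu>"
    using R\<omega> by measurable
  have "\<omega> \<inter> {v. h v \<noteq> 0} = \<omega>" using pos by auto
  then have "\<H> (P \<omega>) = (\<integral>\<^sup>+v. ?g v * indicator \<omega> v \<partial>\<mu>)"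
    using integral_\<mu>_S[OF \<omega>] by simp
  also have "\<dots> \<le> (\<integral>\<^sup>+v. ennreal \<gamma> * (?g (reflect w v) * indicator ?R\<omega> (reflect w v)) \<partial>\<mu>)"
  proof (rule nn_integral_mono_AE, use AE in eventually_elim)
    fix v assume v: "v \<notin> ?Z"
    show "?g v * indicator \<omega> v \<le> ennreal \<gamma> * (?g (reflect w v) * indicator ?R\<omega> (reflect w v))"
    proof (cases "v \<in> \<omega>")
      case True
      then have "h (reflect w v) \<noteq> 0" using v by auto
      then have "?g v \<le> ennreal (\<gamma> * h (reflect w v) powr (p - 1))"
        using le[OF True] by (intro ennreal_leI)
      then show ?thesis using True \<gamma> by (simp add: ennreal_mult)
    qed simp
  qed
  also have "\<dots> = ennreal \<gamma> * (\<integral>\<^sup>+v. ?g (reflect w v) * indicator ?R\<omega> (reflect w v) \<partial>\<mu>)"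
    by (rule nn_integral_cmult[OF measurable_compose[OF distr_\<mu>_reflect(1)[OF w] gm]])
  also have "(\<integral>\<^sup>+v. ?g (reflect w v) * indicator ?R\<omega> (reflect w v) \<partial>\<mu>)
      = (\<integral>\<^sup>+v. ?g v * indicator ?R\<omega> v \<partial>distr \<mu> \<mu> (reflect w))"
    by (rule nn_integral_distr[symmetric, OF distr_\<mu>_reflect(1)[OF w]]) (use R\<omega> in measurable)
  also have "\<dots> = \<H> (P (?R\<omega> \<inter> {v. h v \<noteq> 0}))"
    unfolding distr_\<mu>_reflect(2)[OF w] by (rule integral_\<mu>_S[OF R\<omega>])
  also have "ennreal \<gamma> * \<dots> \<le> ennreal \<gamma> * \<H> (P ?R\<omega>)"
    by (intro mult_left_mono hausdorff_measure_mono reverse_spherical_image_mono) auto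
  finally show ?thesis .
qed

lemma sphere_borel_compact: "compact \<omega> \<Longrightarrow> \<omega> \<subseteq> unit_sphere \<Longrightarrow> \<omega> \<in> sphere_borel"
  by (simp add: sphere_borel_iff borel_compact)

text \<open>
The area of the overlap is what additivity of the surface area measure on disjoint sets leaves over:
the boundary points with two different normals are negligible.
\<close>

lemma null_overlap:
  assumes c: "compact \<omega>" "compact \<omega>'" and s: "\<omega> \<subseteq> unit_sphere" "\<omega>' \<subseteq> unit_sphere" and disj: "\<omega> \<inter> \<omega>' = {}"
  shows "\<H> (P \<omega> \<inter> P \<omega>') = 0"
proof -
  let ?M = "hausdorff_borel (DIM('a) - 1) :: 'a measure"
  have b: "P \<omega> \<in> sets ?M" "P \<omega>' \<in> sets ?M"
    using compact_reverse_spherical_image c by (auto intro: borel_compact)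
  have sb: "\<omega> \<in> sphere_borel" "\<omega>' \<in> sphere_borel" using c s by (auto intro: sphere_borel_compact)
  have "emeasure ?M (P \<omega>) + emeasure ?M (P \<omega>') = emeasure ?M (P \<omega> \<union> P \<omega>') + emeasure ?M (P \<omega> \<inter> P \<omega>')"
    by (rule emeasure_Un_Int[OF b])
  then have 1: "\<H> (P \<omega>) + \<H> (P \<omega>') = \<H> (P (\<omega> \<union> \<omega>')) + \<H> (P \<omega> \<inter> P \<omega>')"
    using b by (simp add: emeasure_hausdorff_borel reverse_spherical_image_Un)
  have "emeasure S \<omega> + emeasure S \<omega>' = emeasure S (\<omega> \<union> \<omega>')"
    using disj sb by (intro plus_emeasure) auto
  moreover have "\<omega> \<union> \<omega>' \<in> sphere_borel" using sb by (rule sets.Un)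
  ultimately have 2: "\<H> (P \<omega>) + \<H> (P \<omega>') = \<H> (P (\<omega> \<union> \<omega>'))"
    using sb by (simp add: emeasure_S)
  have "\<H> (P (\<omega> \<union> \<omega>')) < \<infinity>"
    by (rule le_less_trans[OF hausdorff_measure_mono frontier_finite]) (auto simp: reverse_spherical_image_def)
  moreover have "\<H> (P (\<omega> \<union> \<omega>')) + 0 = \<H> (P (\<omega> \<union> \<omega>')) + \<H> (P \<omega> \<inter> P \<omega>')" using 1 2 by simp
  ultimately show ?thesis by (subst (asm) ennreal_add_left_cancel) (auto simp: less_top[symmetric])
qed

lemma inner_regular_S:
  assumes \<omega>: "\<omega> \<in> sphere_borel" and e: "0 < (e::real)"
  obtains \<omega>' where "compact \<omega>'" "\<omega>' \<subseteq> \<omega>" "\<H> (P (\<omega> - \<omega>')) \<le> ennreal e"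
proof -
  interpret finite_measure S by (rule finite_measure_S)
  have idm: "(\<lambda>x. x) \<in> measurable S borel"
    using measurable_restrict_space1[of "\<lambda>x. x" borel borel unit_sphere] by (simp cong: measurable_cong_sets)
  define M where "M = distr S borel (\<lambda>x. x)"
  have eM: "emeasure M A = emeasure S A" if "A \<in> sphere_borel" for A
  proof -
    have "A \<in> sets borel" "A \<inter> unit_sphere = A" using that by (auto simp: sphere_borel_iff)
    then show ?thesis unfolding M_def by (simp add: emeasure_distr[OF idm])
  qed
  have top: "emeasure M (space M) \<noteq> \<infinity>"
    unfolding M_def using emeasure_finite by (simp add: emeasure_distr[OF idm])
  have "\<exists>K\<in>{K. K \<subseteq> \<omega> \<and> compact K}. emeasure M \<omega> < emeasure M K + ennreal e"
  proof (rule SUP_approx_ennreal[OF e])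
    show "emeasure M \<omega> = (SUP K \<in> {K. K \<subseteq> \<omega> \<and> compact K}. emeasure M K)"
      by (rule inner_regular) (use \<omega> top in \<open>auto simp: M_def sphere_borel_iff\<close>)
  qed (use \<omega> in \<open>auto simp: eM\<close>)
  then obtain \<omega>' where \<omega>': "\<omega>' \<subseteq> \<omega>" "compact \<omega>'" "emeasure M \<omega> < emeasure M \<omega>' + ennreal e"
    by blast
  have sb: "\<omega>' \<in> sphere_borel"
    using \<omega>' \<omega> by (intro sphere_borel_compact) (auto simp: sphere_borel_iff)
  have "emeasure S (\<omega> - \<omega>') = emeasure S \<omega> - emeasure S \<omega>'"
    by (rule emeasure_Diff) (use \<omega> sb \<omega>' in auto)
  also have "\<dots> \<le> ennreal e"
    using \<omega>'(3) by (simp add: eM \<omega> sb ennreal_minus_le_iff add.commute less_imp_le)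
  finally have "\<H> (P (\<omega> - \<omega>')) \<le> ennreal e"
    using emeasure_S[of "\<omega> - \<omega>'"] \<omega> sb by (simp add: sets.Diff)
  then show thesis using that \<omega>' by blast
qed

end

section \<open>The direction of reflection\<close>

context Lp_solution
begin

lemma sphere_borel_Collect:
  assumes "{v. Q v} \<in> sets borel" shows "{v \<in> unit_sphere. Q v} \<in> sphere_borel"
  using assms by (auto simp: sphere_borel_iff Collect_conj_eq)

lemma measurable_support_borel [measurable]: "h \<in> borel_measurable borel"
  by (rule borel_measurable_continuous_onI[OF continuous_on_support])

text \<open>
\<open>K\<close> is the intersection of its supporting half-spaces with normals in \<open>H\<close> or at the origin: an outer
point sees a boundary part of positive area, which must contain such a normal.
\<close>

lemma visible_normal:
  assumes "x \<notin> K"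
  obtains v where "norm v = 1" "v \<in> H \<or> h v = 0" "h v < x \<bullet> v"
proof (rule ccontr)
  assume none: "\<not> thesis"
  let ?\<omega> = "{v \<in> unit_sphere. h v < x \<bullet> v}"
  have "?\<omega> \<in> sphere_borel" by (rule sphere_borel_Collect) measurable
  then have "\<H> (P ?\<omega>) = 0"
    using that none by (intro null_off_H) auto
  then show False using visible_part_pos[OF assms] by simp
qed

text \<open>
The normals at the origin form a cone \<open>C\<close>. If it met \<open>H\<close> only in \<open>0\<close>, there would be a \<open>z\<close>
orthogonal to \<open>H\<close> with \<open>z \<bullet> v \<le> 0\<close> on \<open>C\<close>; no half-space with normal in \<open>H\<close> or \<open>C\<close> would then
bound the ray spanned by \<open>z\<close>, and \<open>K\<close> would be unbounded. In particular the origin is a boundary point.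
\<close>

lemma reflection_direction:
  obtains w b where "norm w = 1" "w \<in> H" "h (- w) = 0" "\<And>y. y \<in> H \<Longrightarrow> b \<bullet> y = w \<bullet> y"
    "\<And>v. h v = 0 \<Longrightarrow> b \<bullet> v \<le> 0"
proof -
  define C where "C = {v. h v = 0}"
  have C_le: "C = {v. h v \<le> 0}" using support_nonneg by (auto simp: C_def intro: antisym)
  have clC: "closed C"
    unfolding C_def by (intro closed_Collect_eq continuous_on_support continuous_on_const)
  have scale: "c *\<^sub>R v \<in> C" if "0 \<le> c" "v \<in> C" for c v
    using that by (simp add: C_def support_scaleR)
  have convC: "convex C"
  proof (rule convexI)
    fix x y and u v :: real assume "x \<in> C" "y \<in> C" "0 \<le> u" "0 \<le> v"
    then show "u *\<^sub>R x + v *\<^sub>R y \<in> C"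
      using support_add_le[of "u *\<^sub>R x" "v *\<^sub>R y"] scale[of u x] scale[of v y] support_nonneg
      by (auto simp: C_le)
  qed
  obtain c where "c \<in> interior K" using interior_K by auto
  then obtain r where r: "0 < r" "cball c r \<subseteq> K" by (auto simp: mem_interior_cball)
  have q: "r * norm v \<le> (- c) \<bullet> v" if "v \<in> C" for v
    using support_interior[OF r(2), of v] r(1) that by (simp add: C_def)
  show thesis
  proof (cases "C \<inter> H \<subseteq> {0}")
    case True
    have "H \<noteq> UNIV"
    proof
      assume "H = UNIV"
      then have "dim H = DIM('a)" by simp
      then show False using dim_H_le DIM_positive[where 'a = 'a] by linarith
    qed
    then obtain z where z: "z \<noteq> 0" "\<And>y. y \<in> H \<Longrightarrow> z \<bullet> y = 0" "\<And>v. v \<in> C \<Longrightarrow> z \<bullet> v \<le> 0"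
      using cone_disjoint_subspace_separation[OF clC convC r(1) q scale subspace_H _ True] by metis
    obtain B where B: "0 < B" "\<And>x. x \<in> K \<Longrightarrow> norm x \<le> B" using bounded_K unfolding bounded_pos by auto
    define x where "x = ((B + 1) / norm z) *\<^sub>R z"
    have "norm x = B + 1" using z(1) B(1) by (simp add: x_def)
    then have "x \<notin> K" using B(2)[of x] by auto
    then obtain v where v: "v \<in> H \<or> h v = 0" "h v < x \<bullet> v" by (rule visible_normal)
    have "x \<bullet> v \<le> 0"
    proof -
      have "z \<bullet> v \<le> 0" using v(1) z(2)[of v] z(3)[of v] by (auto simp: C_def)
      moreover have "0 \<le> (B + 1) / norm z" using B(1) by simp
      ultimately show ?thesis unfolding x_def inner_scaleR_left by (rule mult_nonneg_nonpos[rotated])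
    qed
    then show thesis using v(2) support_nonneg[of v] by simp
  next
    case False
    show thesis
    proof (rule cone_meets_subspace_direction[OF clC convC r(1) q scale subspace_H False])
      fix w b
      assume "norm w = 1" "w \<in> H" "- w \<in> C" "\<And>y. y \<in> H \<Longrightarrow> b \<bullet> y = w \<bullet> y" "\<And>v. v \<in> C \<Longrightarrow> b \<bullet> v \<le> 0"
      then show thesis using that[of w b] by (auto simp: C_def)
    qed
  qed
qed

end

section \<open>Comparing the two sides of the shadow\<close>

lemma ennreal_le_if_le_all_factors:
  fixes x y :: ennreal
  assumes le: "\<And>\<epsilon>. 0 < \<epsilon> \<Longrightarrow> \<epsilon> < 1 \<Longrightarrow> x \<le> ennreal (((1 + \<epsilon>) / (1 - \<epsilon>)) ^ m) * y"
    and y: "y < \<infinity>"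
  shows "x \<le> y"
proof -
  let ?f = "\<lambda>\<epsilon>::real. ((1 + \<epsilon>) / (1 - \<epsilon>)) ^ m"
  have "isCont ?f 0" by (intro continuous_intros) auto
  then have "(?f \<longlongrightarrow> ?f 0) (at_right 0)"
    by (auto simp: isCont_def intro: tendsto_mono[OF at_le])
  then have "((\<lambda>\<epsilon>. y * ennreal (?f \<epsilon>)) \<longlongrightarrow> y * ennreal 1) (at_right 0)"
    using y by (intro ennreal_tendsto_cmult tendsto_ennrealI) auto
  moreover have "eventually (\<lambda>\<epsilon>. x \<le> y * ennreal (?f \<epsilon>)) (at_right 0)"
    by (rule eventually_mono[OF eventually_at_right_real[of 0 1]]) (use le in \<open>auto simp: mult.commute\<close>)
  ultimately show ?thesis
    using tendsto_lowerbound[of "\<lambda>\<epsilon>. y * ennreal (?f \<epsilon>)" "y * ennreal 1" "at_right 0" x] by simp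
qed

text \<open>
Here \<open>- w\<close> is an outer normal at the origin, so \<open>K\<close> lies in the half-space \<open>0 \<le> w \<bullet> x\<close>; and \<open>b\<close>
differs from \<open>w\<close> by a vector orthogonal to \<open>H\<close>, chosen so that normals at the origin never point to
the upper side with respect to \<open>b\<close>.
\<close>

locale Lp_solution_direction = Lp_solution K p H for K :: "'a::euclidean_space set" and p and H +
  fixes w b :: 'a
  assumes norm_w: "norm w = 1" and w_H: "w \<in> H" and support_minus_w: "h (- w) = 0"
    and b_H: "\<And>y. y \<in> H \<Longrightarrow> b \<bullet> y = w \<bullet> y"
    and b_normal: "\<And>v. h v = 0 \<Longrightarrow> b \<bullet> v \<le> 0"
begin

abbreviation R :: "'a \<Rightarrow> 'a" where "R \<equiv> reflect w"
abbreviation T :: "'a \<Rightarrow> 'a" where "T \<equiv> oblique_proj b b"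
abbreviation \<alpha> :: "'a set \<Rightarrow> ennreal" where "\<alpha> \<omega> \<equiv> \<H> (T ` P \<omega>)"

lemma inner_w_w: "w \<bullet> w = 1"
  using norm_w by (simp add: power2_norm_eq_inner[symmetric])

lemma inner_b_w: "b \<bullet> w = 1"
  using b_H[OF w_H] inner_w_w by simp

lemma b_nonzero: "b \<noteq> 0" and inner_b_b: "b \<bullet> b \<noteq> 0"
  using inner_b_w by auto

lemma inner_b_R: "v \<in> H \<Longrightarrow> b \<bullet> R v = - (w \<bullet> v)"
  using b_H[OF reflect_mem_subspace[OF subspace_H w_H]] inner_reflect[OF norm_w] by simp

lemma support_pos: "v \<in> H \<Longrightarrow> 0 < w \<bullet> v \<Longrightarrow> 0 < h v"
  using b_normal[of v] b_H[of v] support_nonneg[of v] by (auto simp: less_le)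

text \<open>
This holds because the reflection moves points of the half-space \<open>0 \<le> w \<bullet> x\<close>, which contains \<open>K\<close>,
in the direction of \<open>- w\<close>.
\<close>

lemma support_R_le: "0 \<le> w \<bullet> v \<Longrightarrow> h (R v) \<le> h v"
proof -
  assume wv: "0 \<le> w \<bullet> v"
  obtain y where y: "y \<in> K" "y \<bullet> R v = h (R v)" by (rule support_attained)
  have "0 \<le> y \<bullet> w" using inner_le_support[OF y(1), of "- w"] support_minus_w by simp
  then have "y \<bullet> R v \<le> y \<bullet> v"
    using wv inner_w_w by (simp add: reflect_def inner_diff_right)
  then show ?thesis using y inner_le_support[OF y(1), of v] by simp
qed

lemma \<alpha>_mono: "\<omega> \<subseteq> \<omega>' \<Longrightarrow> \<alpha> \<omega> \<le> \<alpha> \<omega>'"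
  by (intro hausdorff_measure_mono image_mono reverse_spherical_image_mono)

lemma \<alpha>_le: "\<alpha> \<omega> \<le> \<H> (P \<omega>)"
  by (rule hausdorff_measure_orthogonal_proj_le)

lemma P_finite: "\<H> (P \<omega>) < \<infinity>"
  by (rule le_less_trans[OF hausdorff_measure_mono frontier_finite]) (auto simp: reverse_spherical_image_def)

lemma \<alpha>_finite: "\<alpha> \<omega> < \<infinity>"
  using \<alpha>_le P_finite by (rule le_less_trans)

lemma \<alpha>_Un_le: "\<alpha> (\<omega> \<union> \<omega>') \<le> \<alpha> \<omega> + \<alpha> \<omega>'"
  unfolding reverse_spherical_image_Un image_Un by (rule hausdorff_measure_Un_le)

lemma \<alpha>_approx:
  assumes "\<omega> \<in> sphere_borel" "0 < (e::real)"
  obtains \<omega>' where "compact \<omega>'" "\<omega>' \<subseteq> \<omega>" "\<alpha> \<omega> \<le> \<alpha> \<omega>' + ennreal e"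
proof -
  obtain \<omega>' where \<omega>': "compact \<omega>'" "\<omega>' \<subseteq> \<omega>" "\<H> (P (\<omega> - \<omega>')) \<le> ennreal e"
    using inner_regular_S[OF assms] by metis
  have "\<alpha> \<omega> = \<alpha> (\<omega>' \<union> (\<omega> - \<omega>'))" using \<omega>'(2) by (simp add: Un_absorb1)
  also have "\<dots> \<le> \<alpha> \<omega>' + \<alpha> (\<omega> - \<omega>')" by (rule \<alpha>_Un_le)
  also have "\<dots> \<le> \<alpha> \<omega>' + ennreal e" using \<alpha>_le \<omega>'(3) by (intro add_left_mono) (rule order_trans)
  finally show thesis using that \<omega>' by blast
qed

text \<open>
For normals close to \<open>u\<close> the boundary is nearly parallel to the hyperplane orthogonal to \<open>u\<close>, so its
shadow along \<open>b\<close> has almost \<open>c\<close> times its area. The allowed distance from \<open>u\<close> must shrink with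
\<open>u \<bullet> b\<close>, since the projection degenerates when \<open>b\<close> becomes tangential.
\<close>

lemma factor_estimate:
  assumes ub: "u \<bullet> b \<noteq> 0" and \<epsilon>: "0 \<le> \<epsilon>" "\<epsilon> < 1"
    and c: "\<And>E. E \<in> sets borel \<Longrightarrow> E \<subseteq> {x. u \<bullet> x = 0} \<Longrightarrow> \<H> (T ` E) = c * \<H> E"
    and \<omega>: "compact \<omega>" "\<And>v. v \<in> \<omega> \<Longrightarrow> norm (v - u) * norm b \<le> \<epsilon> * \<bar>u \<bullet> b\<bar>"
  shows "\<alpha> \<omega> \<le> c * (ennreal ((1 + \<epsilon>) ^ (DIM('a) - 1)) * \<H> (P \<omega>))"
    and "c * \<H> (P \<omega>) \<le> ennreal ((1 / (1 - \<epsilon>)) ^ (DIM('a) - 1)) * \<alpha> \<omega>"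
proof -
  let ?q = "oblique_proj u b"
  define \<delta> where "\<delta> = \<epsilon> * \<bar>u \<bullet> b\<bar> / norm b"
  have nb: "0 < norm b" using b_nonzero by simp
  have \<delta>: "\<delta> * norm b \<le> \<epsilon> * \<bar>u \<bullet> b\<bar>" using nb by (simp add: \<delta>_def)
  have flat: "\<bar>u \<bullet> (x - y)\<bar> \<le> \<delta> * norm (x - y)" if "x \<in> P \<omega>" "y \<in> P \<omega>" for x y
    by (rule nearly_flat[OF _ that]) (use \<omega>(2) nb in \<open>simp add: \<delta>_def pos_le_divide_eq\<close>)
  have "compact (?q ` P \<omega>)"
    by (intro compact_continuous_image continuous_on_oblique_proj compact_reverse_spherical_image \<omega>)
  then have "?q ` P \<omega> \<in> sets borel" by (rule borel_compact)
  moreover have "?q ` P \<omega> \<subseteq> {x. u \<bullet> x = 0}" using inner_oblique_proj[OF ub] by auto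
  ultimately have "\<H> (T ` ?q ` P \<omega>) = c * \<H> (?q ` P \<omega>)" by (rule c)
  moreover have "T ` ?q ` P \<omega> = T ` P \<omega>"
    by (simp add: image_image oblique_proj_oblique_proj[OF inner_b_b ub])
  ultimately have eq: "\<alpha> \<omega> = c * \<H> (?q ` P \<omega>)" by simp
  note est = hausdorff_measure_oblique_proj[OF ub \<delta> \<epsilon> flat, where m = "DIM('a) - 1"]
  show "\<alpha> \<omega> \<le> c * (ennreal ((1 + \<epsilon>) ^ (DIM('a) - 1)) * \<H> (P \<omega>))"
    unfolding eq by (rule mult_left_mono[OF est(1)]) auto
  have "c * \<H> (P \<omega>) \<le> c * (ennreal ((1 / (1 - \<epsilon>)) ^ (DIM('a) - 1)) * \<H> (?q ` P \<omega>))"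
    by (rule mult_left_mono[OF est(2)]) auto
  then show "c * \<H> (P \<omega>) \<le> ennreal ((1 / (1 - \<epsilon>)) ^ (DIM('a) - 1)) * \<alpha> \<omega>"
    unfolding eq by (simp add: mult_ac)
qed

lemma sphere_borel_subset: "\<omega> \<in> sphere_borel \<Longrightarrow> \<omega>' \<subseteq> \<omega> \<Longrightarrow> \<omega>' \<subseteq> unit_sphere"
  using sphere_borel_iff by blast

text \<open>
Near \<open>u\<close> and near its mirror image the shadow is proportional to the area with the same factor \<open>c\<close>, up
to a relative error, so an inequality between areas passes to the shadows. Compact subsets are used since
the factor is available for Borel subsets of hyperplanes only.
\<close>

lemma \<alpha>_compare_small:
  assumes \<omega>: "\<omega> \<in> sphere_borel" and u: "u \<in> H" "0 < w \<bullet> u" and \<epsilon>: "0 < \<epsilon>" "\<epsilon> < 1"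
    and near: "\<And>v. v \<in> \<omega> \<Longrightarrow> norm (v - u) * norm b \<le> \<epsilon> * (w \<bullet> u)"
    and le: "\<And>\<omega>'. \<omega>' \<in> sphere_borel \<Longrightarrow> \<omega>' \<subseteq> \<omega> \<Longrightarrow> \<H> (P \<omega>') \<le> \<gamma> * \<H> (P (R ` \<omega>'))"
  shows "\<alpha> \<omega> \<le> \<gamma> * (ennreal (((1 + \<epsilon>) / (1 - \<epsilon>)) ^ (DIM('a) - 1)) * \<alpha> (R ` \<omega>))"
proof -
  have bu: "b \<bullet> u = w \<bullet> u" by (rule b_H[OF u(1)])
  obtain c where c: "\<And>E. E \<in> sets borel \<Longrightarrow> E \<subseteq> {x. u \<bullet> x = 0} \<Longrightarrow> \<H> (T ` E) = c * \<H> E"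
    "\<And>E. E \<in> sets borel \<Longrightarrow> E \<subseteq> {x. R u \<bullet> x = 0} \<Longrightarrow> \<H> (T ` E) = c * \<H> E"
    using proj_hyperplane_factor_reflect[OF norm_w inner_b_w bu] u(2) by (metis less_irrefl)
  have ub: "u \<bullet> b = w \<bullet> u" "R u \<bullet> b = - (w \<bullet> u)"
    using bu inner_b_R[OF u(1)] by (simp_all add: inner_commute)
  have ub0: "u \<bullet> b \<noteq> 0" "R u \<bullet> b \<noteq> 0" using ub u by simp_all
  show ?thesis
  proof (rule ennreal_le_epsilon)
    fix e :: real assume e: "0 < e"
    obtain \<omega>' where \<omega>': "compact \<omega>'" "\<omega>' \<subseteq> \<omega>" "\<alpha> \<omega> \<le> \<alpha> \<omega>' + ennreal e"
      using \<alpha>_approx[OF \<omega> e] by metis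
    have sb: "\<omega>' \<in> sphere_borel"
      using \<omega>'(1) sphere_borel_subset[OF \<omega> \<omega>'(2)] by (rule sphere_borel_compact)
    have cR: "compact (R ` \<omega>')"
      by (rule compact_continuous_image[OF continuous_on_reflect \<omega>'(1)])
    have near': "norm (v - R u) * norm b \<le> \<epsilon> * \<bar>R u \<bullet> b\<bar>" if v: "v \<in> R ` \<omega>'" for v
      using near v \<omega>'(2) ub u(2) by auto
    have "\<alpha> \<omega>' \<le> c * (ennreal ((1 + \<epsilon>) ^ (DIM('a) - 1)) * \<H> (P \<omega>'))"
      by (rule factor_estimate(1)[OF ub0(1) _ \<epsilon>(2) c(1) \<omega>'(1)])
        (use \<epsilon> near \<omega>'(2) ub u in auto)
    also have "\<dots> \<le> c * (ennreal ((1 + \<epsilon>) ^ (DIM('a) - 1)) * (\<gamma> * \<H> (P (R ` \<omega>'))))"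
      by (intro mult_left_mono le sb \<omega>') auto
    also have "\<dots> = \<gamma> * (ennreal ((1 + \<epsilon>) ^ (DIM('a) - 1)) * (c * \<H> (P (R ` \<omega>'))))"
      by (simp add: mult_ac)
    also have "\<dots> \<le> \<gamma> * (ennreal ((1 + \<epsilon>) ^ (DIM('a) - 1)) * (ennreal ((1 / (1 - \<epsilon>)) ^ (DIM('a) - 1)) * \<alpha> (R ` \<omega>')))"
      by (intro mult_left_mono factor_estimate(2)[OF ub0(2) _ \<epsilon>(2) c(2) cR near']) (use \<epsilon> in auto)
    also have "\<dots> = \<gamma> * (ennreal (((1 + \<epsilon>) / (1 - \<epsilon>)) ^ (DIM('a) - 1)) * \<alpha> (R ` \<omega>'))"
      using \<epsilon> by (simp add: mult.assoc[symmetric] ennreal_mult[symmetric] power_divide)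
    also have "\<dots> \<le> \<gamma> * (ennreal (((1 + \<epsilon>) / (1 - \<epsilon>)) ^ (DIM('a) - 1)) * \<alpha> (R ` \<omega>))"
      by (intro mult_left_mono \<alpha>_mono image_mono \<omega>') auto
    finally show "\<alpha> \<omega> \<le> \<gamma> * (ennreal (((1 + \<epsilon>) / (1 - \<epsilon>)) ^ (DIM('a) - 1)) * \<alpha> (R ` \<omega>)) + ennreal e"
      using \<omega>'(3) by (meson add_right_mono order_trans)
  qed
qed

text \<open>
From a point whose outer normal has negative inner product with \<open>b\<close>, moving in the direction \<open>- b\<close>
leaves \<open>K\<close>; two such points cannot lie on one line parallel to \<open>b\<close>.
\<close>

lemma lower_points_unique:
  assumes x: "x \<in> P {v. b \<bullet> v < 0}" and y: "y \<in> P {v. b \<bullet> v < 0}" and T: "T x = T y"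
  shows "x = y"
proof -
  have no: "\<not> s > 0" if xy: "x \<in> K" "y \<in> P {v. b \<bullet> v < 0}" "y = x + s *\<^sub>R b" for x y s
  proof
    assume s: "s > 0"
    obtain v where v: "b \<bullet> v < 0" "y \<bullet> v = h v" using xy(2) by (auto simp: reverse_spherical_image_def)
    have "s * (b \<bullet> v) < 0" using s v(1) by (rule mult_pos_neg)
    then show False using v(2) inner_le_support[OF xy(1), of v] by (simp add: xy(3) inner_add_left)
  qed
  define s where "s = (b \<bullet> y) / (b \<bullet> b) - (b \<bullet> x) / (b \<bullet> b)"
  have "y = x + s *\<^sub>R b" using T by (simp add: oblique_proj_def s_def algebra_simps)
  moreover then have "x = y + (- s) *\<^sub>R b" by simp
  moreover have "x \<in> K" "y \<in> K" using x y frontier_subset_K by (auto simp: reverse_spherical_image_def)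
  ultimately have "s = 0" using no[of x y s] no[of y x "- s"] x y by force
  then show ?thesis using \<open>y = x + s *\<^sub>R b\<close> by simp
qed

text \<open>
On the lower side the shadow map is injective, and the parts of the boundary over disjoint compact sets
of normals overlap in a null set only. Inner regularity extends additivity from compact to Borel sets.
\<close>

lemma \<alpha>_superadditive:
  assumes sb: "\<omega> \<in> sphere_borel" "\<omega>' \<in> sphere_borel" and disj: "\<omega> \<inter> \<omega>' = {}"
    and lower: "\<omega> \<union> \<omega>' \<subseteq> {v. b \<bullet> v < 0}"
  shows "\<alpha> \<omega> + \<alpha> \<omega>' \<le> \<alpha> (\<omega> \<union> \<omega>')"
proof (rule ennreal_le_epsilon)
  fix e :: real assume e: "0 < e"
  then have e2: "0 < e / 2" by simp
  obtain C where C: "compact C" "C \<subseteq> \<omega>" "\<alpha> \<omega> \<le> \<alpha> C + ennreal (e / 2)"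
    using \<alpha>_approx[OF sb(1) e2] by metis
  obtain C' where C': "compact C'" "C' \<subseteq> \<omega>'" "\<alpha> \<omega>' \<le> \<alpha> C' + ennreal (e / 2)"
    using \<alpha>_approx[OF sb(2) e2] by metis
  let ?M = "hausdorff_borel (DIM('a) - 1) :: 'a measure"
  have "compact (T ` P C)" "compact (T ` P C')"
    by (intro compact_continuous_image continuous_on_oblique_proj compact_reverse_spherical_image C C')+
  then have B: "T ` P C \<in> sets borel" "T ` P C' \<in> sets borel" by (auto intro: borel_compact)
  have "T ` P C \<inter> T ` P C' \<subseteq> T ` (P C \<inter> P C')"
  proof
    fix z assume "z \<in> T ` P C \<inter> T ` P C'"
    then obtain x y where xy: "T x = T y" "x \<in> P C" "y \<in> P C'" "z = T x" by fastforce
    have "C \<subseteq> {v. b \<bullet> v < 0}" "C' \<subseteq> {v. b \<bullet> v < 0}" using C(2) C'(2) lower by blast+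
    then have "x \<in> P {v. b \<bullet> v < 0}" "y \<in> P {v. b \<bullet> v < 0}"
      using xy reverse_spherical_image_mono by blast+
    then have "x = y" using xy(1) by (rule lower_points_unique)
    then show "z \<in> T ` (P C \<inter> P C')" using xy by auto
  qed
  then have "\<H> (T ` P C \<inter> T ` P C') \<le> \<H> (P C \<inter> P C')"
    by (rule order_trans[OF hausdorff_measure_mono hausdorff_measure_orthogonal_proj_le])
  also have "\<dots> = 0"
    using C C' disj sphere_borel_subset[OF sb(1)] sphere_borel_subset[OF sb(2)]
    by (intro null_overlap) auto
  finally have "\<H> (T ` P C \<inter> T ` P C') = 0" by simp
  moreover have "emeasure ?M (T ` P C) + emeasure ?M (T ` P C')
     = emeasure ?M (T ` P C \<union> T ` P C') + emeasure ?M (T ` P C \<inter> T ` P C')"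
    by (rule emeasure_Un_Int) (use B in auto)
  ultimately have eq: "\<alpha> C + \<alpha> C' = \<alpha> (C \<union> C')"
    using B by (simp add: emeasure_hausdorff_borel reverse_spherical_image_Un image_Un sets.Int sets.Un)
  have "\<alpha> \<omega> + \<alpha> \<omega>' \<le> (\<alpha> C + ennreal (e / 2)) + (\<alpha> C' + ennreal (e / 2))"
    by (rule add_mono[OF C(3) C'(3)])
  also have "\<dots> = (\<alpha> C + \<alpha> C') + (ennreal (e / 2) + ennreal (e / 2))"
    by (simp only: add_ac)
  also have "\<dots> = \<alpha> (C \<union> C') + ennreal e"
    using e by (subst ennreal_plus[symmetric]) (simp_all add: eq[simplified])
  also have "\<dots> \<le> \<alpha> (\<omega> \<union> \<omega>') + ennreal e"
    using C(2) C'(2) by (intro add_right_mono \<alpha>_mono) auto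
  finally show "\<alpha> \<omega> + \<alpha> \<omega>' \<le> \<alpha> (\<omega> \<union> \<omega>') + ennreal e" .
qed

lemma \<alpha>_suminf_le:
  assumes sb: "\<And>i. \<omega> i \<in> sphere_borel" and disj: "disjoint_family \<omega>"
    and lower: "\<And>i. \<omega> i \<subseteq> {v. b \<bullet> v < 0}"
  shows "(\<Sum>i. \<alpha> (\<omega> i)) \<le> \<alpha> (\<Union>i. \<omega> i)"
proof -
  have "(\<Sum>i<n. \<alpha> (\<omega> i)) \<le> \<alpha> (\<Union>i<n. \<omega> i)" for n
  proof (induction n)
    case (Suc n)
    have "(\<Sum>i<Suc n. \<alpha> (\<omega> i)) \<le> \<alpha> (\<Union>i<n. \<omega> i) + \<alpha> (\<omega> n)"
      using Suc by (simp add: add_right_mono)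
    also have "\<dots> \<le> \<alpha> ((\<Union>i<n. \<omega> i) \<union> \<omega> n)"
    proof (rule \<alpha>_superadditive)
      show "(\<Union>i<n. \<omega> i) \<inter> \<omega> n = {}"
        using disj unfolding disjoint_family_on_def by (metis (no_types, lifting) UN_E UNIV_I disjoint_iff lessThan_iff less_irrefl)
      show "(\<Union>i<n. \<omega> i) \<in> sphere_borel" by (rule sets.finite_UN) (simp_all add: sb)
      show "(\<Union>i<n. \<omega> i) \<union> \<omega> n \<subseteq> {v. b \<bullet> v < 0}" using lower by blast
    qed (rule sb)
    finally show ?case by (simp add: lessThan_Suc Un_commute)
  qed simp
  moreover have "\<alpha> (\<Union>i<n. \<omega> i) \<le> \<alpha> (\<Union>i. \<omega> i)" for n by (rule \<alpha>_mono) auto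
  ultimately have "(\<Sum>i<n. \<alpha> (\<omega> i)) \<le> \<alpha> (\<Union>i. \<omega> i)" for n by (rule order_trans)
  then show ?thesis by (rule suminf_le_const[OF summableI])
qed

text \<open>
Cut \<open>\<omega>\<close> into countably many pieces on which the comparison loses only the factor
\<open>((1 + \<epsilon>) / (1 - \<epsilon>)) ^ (n - 1)\<close>, add up, and let \<open>\<epsilon>\<close> tend to \<open>0\<close>. The pieces are added with
subadditivity on the upper side and superadditivity on the lower side.
\<close>

lemma \<alpha>_compare:
  assumes \<omega>: "\<omega> \<in> sphere_borel" and up: "\<omega> \<subseteq> H \<inter> {v. 0 < w \<bullet> v}" and \<gamma>: "\<gamma> < \<infinity>"
    and le: "\<And>\<omega>'. \<omega>' \<in> sphere_borel \<Longrightarrow> \<omega>' \<subseteq> \<omega> \<Longrightarrow> \<H> (P \<omega>') \<le> \<gamma> * \<H> (P (R ` \<omega>'))"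
  shows "\<alpha> \<omega> \<le> \<gamma> * \<alpha> (R ` \<omega>)"
proof (cases "\<omega> = {}")
  case True
  then have "\<alpha> \<omega> = 0" by simp
  then show ?thesis by simp
next
  case False
  show ?thesis
  proof (rule ennreal_le_if_le_all_factors[where m = "DIM('a) - 1"])
    show "\<gamma> * \<alpha> (R ` \<omega>) < \<infinity>" using \<gamma> \<alpha>_finite[of "R ` \<omega>"] by (simp add: ennreal_mult_less_top)
    fix \<epsilon> :: real assume \<epsilon>: "0 < \<epsilon>" "\<epsilon> < 1"
    \<comment> \<open>the neighbourhoods on which \<open>factor_estimate\<close> applies; countably many of them cover \<open>\<omega>\<close>\<close>
    define U where "U u = {v. norm (v - u) * norm b < \<epsilon> * (w \<bullet> u)}" for u
    have oU: "open (U u)" for u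
      unfolding U_def by (intro open_Collect_less continuous_intros)
    obtain F where F: "F \<subseteq> U ` \<omega>" "countable F" "\<Union>F = (\<Union>u\<in>\<omega>. U u)"
      using Lindelof[of "U ` \<omega>"] oU by auto
    have "\<omega> \<subseteq> \<Union>F" unfolding F(3) using up \<epsilon> by (force simp: U_def)
    then have "F \<noteq> {}" using False by auto
    define V where "V = from_nat_into F"
    have V: "range V = F" unfolding V_def by (rule range_from_nat_into[OF \<open>F \<noteq> {}\<close> F(2)])
    have "\<exists>u\<in>\<omega>. V i = U u" for i using V F(1) by blast
    then obtain d where d: "\<And>i. d i \<in> \<omega>" "\<And>i. V i = U (d i)" by metis
    define \<omega>' where "\<omega>' = disjointed (\<lambda>i. \<omega> \<inter> U (d i))"
    have sub: "\<omega>' i \<subseteq> \<omega> \<inter> U (d i)" for i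
      unfolding \<omega>'_def by (rule disjointed_subset)
    have "\<omega> \<inter> U u \<in> sphere_borel" for u
      using \<omega> borel_open[OF oU, of u] by (auto simp: sphere_borel_iff)
    then have sb: "\<omega>' i \<in> sphere_borel" for i
      unfolding \<omega>'_def using sets.range_disjointed_sets[of "\<lambda>i. \<omega> \<inter> U (d i)" "restrict_space borel unit_sphere"]
      by auto
    have "(\<Union>i. \<omega>' i) = (\<Union>i. \<omega> \<inter> U (d i))" unfolding \<omega>'_def by (rule UN_disjointed_eq)
    also have "\<dots> = \<omega> \<inter> \<Union>F" using V d(2) by auto
    finally have UN: "(\<Union>i. \<omega>' i) = \<omega>" using \<open>\<omega> \<subseteq> \<Union>F\<close> by auto
    define \<rho> where "\<rho> = ennreal (((1 + \<epsilon>) / (1 - \<epsilon>)) ^ (DIM('a) - 1))"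
    have "\<alpha> \<omega> = \<H> (\<Union>i. T ` P (\<omega>' i))"
      by (simp add: UN[symmetric] reverse_spherical_image_UN image_UN)
    also have "\<dots> \<le> (\<Sum>i. \<alpha> (\<omega>' i))" by (rule hausdorff_measure_countably_subadditive)
    also have "\<dots> \<le> (\<Sum>i. \<gamma> * (\<rho> * \<alpha> (R ` \<omega>' i)))"
    proof (intro suminf_le)
      fix i
      show "\<alpha> (\<omega>' i) \<le> \<gamma> * (\<rho> * \<alpha> (R ` \<omega>' i))"
        unfolding \<rho>_def
      proof (rule \<alpha>_compare_small[OF sb _ _ \<epsilon>])
        show "d i \<in> H" "0 < w \<bullet> d i" using d(1)[of i] up by auto
        show "norm (v - d i) * norm b \<le> \<epsilon> * (w \<bullet> d i)" if "v \<in> \<omega>' i" for v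
          using that sub[of i] by (auto simp: U_def)
      qed (use sub le in blast)
    qed (rule summableI)+
    also have "\<dots> = \<gamma> * (\<rho> * (\<Sum>i. \<alpha> (R ` \<omega>' i)))" by simp
    finally have up_sum: "\<alpha> \<omega> \<le> \<gamma> * (\<rho> * (\<Sum>i. \<alpha> (R ` \<omega>' i)))" .
    have "(\<Sum>i. \<alpha> (R ` \<omega>' i)) \<le> \<alpha> (\<Union>i. R ` \<omega>' i)"
    proof (rule \<alpha>_suminf_le)
      show "R ` \<omega>' i \<in> sphere_borel" for i by (rule reflect_image_sphere_borel[OF sb])
      have "disjoint_family \<omega>'" unfolding \<omega>'_def by (rule disjoint_family_disjointed)
      then show "disjoint_family (\<lambda>i. R ` \<omega>' i)"
        by (simp add: disjoint_family_on_def image_Int[OF inj_reflect, symmetric])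
      show "R ` \<omega>' i \<subseteq> {v. b \<bullet> v < 0}" for i
      proof
        fix y assume "y \<in> R ` \<omega>' i"
        then obtain v where v: "v \<in> \<omega>' i" "y = R v" by blast
        then have "v \<in> H" "0 < w \<bullet> v" using sub[of i] up by blast+
        then show "y \<in> {v. b \<bullet> v < 0}" using inner_b_R v(2) by simp
      qed
    qed
    also have "(\<Union>i. R ` \<omega>' i) = R ` \<omega>" by (simp add: UN[symmetric] image_UN)
    finally have "\<gamma> * (\<rho> * (\<Sum>i. \<alpha> (R ` \<omega>' i))) \<le> \<gamma> * (\<rho> * \<alpha> (R ` \<omega>))"
      by (intro mult_left_mono) auto
    then have "\<alpha> \<omega> \<le> \<gamma> * (\<rho> * \<alpha> (R ` \<omega>))" using up_sum by (rule order_trans[rotated])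
    then show "\<alpha> \<omega> \<le> ennreal (((1 + \<epsilon>) / (1 - \<epsilon>)) ^ (DIM('a) - 1)) * (\<gamma> * \<alpha> (R ` \<omega>))"
      by (simp only: \<rho>_def mult_ac)
  qed
qed

text \<open>
Over the shadow of the interior the exit points in direction \<open>b\<close> have normals on the upper side. The
boundary of the shadow is negligible, as \<open>K\<close> is contained in dilated copies of its interior
with dilation factor arbitrarily close to \<open>1\<close>.
\<close>

lemma shadow_le: "\<H> (T ` K) \<le> \<alpha> {v \<in> unit_sphere. 0 < b \<bullet> v}"
proof (rule ennreal_le_if_le_all_factors[where m = "DIM('a) - 1"])
  show "\<alpha> {v \<in> unit_sphere. 0 < b \<bullet> v} < \<infinity>" by (rule \<alpha>_finite)
  fix \<epsilon> :: real assume \<epsilon>: "0 < \<epsilon>" "\<epsilon> < 1"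
  obtain c where c: "c \<in> interior K" using interior_K by auto
  interpret T: linear T by (rule linear_oblique_proj)
  define \<psi> where "\<psi> z = T c + (1 / (1 - \<epsilon>)) *\<^sub>R (z - T c)" for z
  have "T ` K \<subseteq> \<psi> ` (T ` interior K)"
  proof safe
    fix x assume x: "x \<in> K"
    have y: "x - \<epsilon> *\<^sub>R (x - c) \<in> interior K"
      using mem_interior_convex_shrink[OF convex_K c x] \<epsilon> by simp
    have "T (x - \<epsilon> *\<^sub>R (x - c)) - T c = (1 - \<epsilon>) *\<^sub>R (T x - T c)"
      by (simp add: T.diff T.scale T.add algebra_simps)
    then have "T x = \<psi> (T (x - \<epsilon> *\<^sub>R (x - c)))"
      using \<epsilon> by (simp add: \<psi>_def)
    then show "T x \<in> \<psi> ` (T ` interior K)" using y by auto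
  qed
  then have "\<H> (T ` K) \<le> \<H> (\<psi> ` (T ` interior K))" by (rule hausdorff_measure_mono)
  also have "\<dots> \<le> ennreal ((1 / (1 - \<epsilon>)) ^ (DIM('a) - 1)) * \<H> (T ` interior K)"
    by (rule hausdorff_measure_Lipschitz_image)
      (use \<epsilon> in \<open>auto simp: \<psi>_def scaleR_diff_right[symmetric] divide_simps\<close>)
  also have "\<dots> \<le> ennreal (((1 + \<epsilon>) / (1 - \<epsilon>)) ^ (DIM('a) - 1)) * \<alpha> {v \<in> unit_sphere. 0 < b \<bullet> v}"
  proof (intro mult_mono ennreal_leI power_mono divide_right_mono)
    have "T ` interior K \<subseteq> T ` P {v \<in> unit_sphere. 0 < b \<bullet> v}"
    proof safe
      fix x assume "x \<in> interior K"
      then obtain \<tau> v where \<tau>: "0 < \<tau>" "x + \<tau> *\<^sub>R b \<in> K" "norm v = 1" "(x + \<tau> *\<^sub>R b) \<bullet> v = h v" "0 < b \<bullet> v"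
        using exit_point b_nonzero by metis
      then have mem: "x + \<tau> *\<^sub>R b \<in> P {v \<in> unit_sphere. 0 < b \<bullet> v}"
        by (intro reverse_spherical_imageI[of _ v]) auto
      have "T (x + \<tau> *\<^sub>R b) = T x"
        using inner_b_b by (simp add: oblique_proj_def inner_add_right add_divide_distrib algebra_simps)
      then show "T x \<in> T ` P {v \<in> unit_sphere. 0 < b \<bullet> v}"
        using imageI[OF mem, of T] by simp
    qed
    then show "\<H> (T ` interior K) \<le> \<alpha> {v \<in> unit_sphere. 0 < b \<bullet> v}" by (rule hausdorff_measure_mono)
  qed (use \<epsilon> in auto)
  finally show "\<H> (T ` K) \<le> ennreal (((1 + \<epsilon>) / (1 - \<epsilon>)) ^ (DIM('a) - 1)) * \<alpha> {v \<in> unit_sphere. 0 < b \<bullet> v}" .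
qed

lemma borel_H: "H \<in> sets borel"
  using closed_subspace[OF subspace_H] by simp

text \<open>
Upper normals are not normals at the origin, hence almost all of them belong to \<open>H\<close>.
\<close>

lemma shadow_le_upper: "\<H> (T ` K) \<le> \<alpha> {v \<in> unit_sphere. v \<in> H \<and> 0 < w \<bullet> v}"
proof -
  let ?N = "{v \<in> unit_sphere. v \<notin> H \<and> 0 < b \<bullet> v}"
  have "{v. v \<notin> H \<and> 0 < b \<bullet> v} = - H \<inter> {v. 0 < b \<bullet> v}" by auto
  moreover have "- H \<inter> {v. 0 < b \<bullet> v} \<in> sets borel"
    using borel_H by (intro sets.Int) (auto simp: open_halfspace_gt)
  ultimately have "?N \<in> sphere_borel" by (intro sphere_borel_Collect) simp
  then have "\<H> (P ?N) = 0"
    by (rule null_off_H) (use b_normal in \<open>auto simp: not_less[symmetric]\<close>)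
  then have N: "\<alpha> ?N = 0" using \<alpha>_le[of ?N] by simp
  have "\<H> (T ` K) \<le> \<alpha> {v \<in> unit_sphere. 0 < b \<bullet> v}" by (rule shadow_le)
  also have "\<dots> \<le> \<alpha> ({v \<in> unit_sphere. v \<in> H \<and> 0 < w \<bullet> v} \<union> ?N)"
    by (rule \<alpha>_mono) (auto simp: b_H)
  also have "\<dots> \<le> \<alpha> {v \<in> unit_sphere. v \<in> H \<and> 0 < w \<bullet> v} + \<alpha> ?N" by (rule \<alpha>_Un_le)
  finally show ?thesis using N by simp
qed

text \<open>
At \<open>w\<close> itself the comparison of support functions is as strict as possible: \<open>h w\<close> is positive, and
\<open>h (R w) = h (- w) = 0\<close>. By continuity the gap persists nearby.
\<close>

lemma strict_gain_near_w:
  obtains r where "0 < r"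
    "\<And>v. v \<in> H \<Longrightarrow> norm (v - w) < r \<Longrightarrow> 0 < w \<bullet> v \<and> 2 * h (R v) \<le> h v \<and> norm (v - w) * norm b \<le> 1 / 2"
proof -
  have hw: "0 < h w" using support_pos[OF w_H] inner_w_w by simp
  have Rw: "R w = - w" using inner_w_w by (simp add: reflect_def scaleR_2)
  have contR: "continuous_on UNIV (\<lambda>v. h (R v))"
    by (rule continuous_on_compose2[OF continuous_on_support[of UNIV] continuous_on_reflect]) auto
  let ?U = "{v. 0 < w \<bullet> v} \<inter> {v. 0 < h v - 2 * h (R v)} \<inter> {v. norm (v - w) * norm b < 1 / 2}"
  have "open ?U"
    by (intro open_Int open_Collect_less continuous_intros continuous_on_support contR)
  moreover have "w \<in> ?U" using hw Rw support_minus_w inner_w_w by simp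
  ultimately obtain r where r: "0 < r" "ball w r \<subseteq> ?U" by (meson open_contains_ball)
  show thesis
  proof (rule that[OF r(1)])
    fix v assume "norm (v - w) < r"
    then have "v \<in> ball w r" by (simp add: dist_norm norm_minus_commute)
    then have "v \<in> ?U" using r(2) by blast
    then show "0 < w \<bullet> v \<and> 2 * h (R v) \<le> h v \<and> norm (v - w) * norm b \<le> 1 / 2" by auto
  qed
qed

text \<open>
Let \<open>A\<close> be the normals of \<open>H\<close> near \<open>w\<close> and \<open>B\<close> the other upper normals of \<open>H\<close>. The upper side has
shadow at most \<open>\<gamma> * \<alpha> (R ` A) + \<alpha> (R ` B)\<close> with \<open>\<gamma> < 1\<close>, while the disjoint lower parts over
\<open>R ` A\<close> and \<open>R ` B\<close> have shadows of total area at most that of \<open>K\<close>. So the shadow over \<open>R ` A\<close>, and with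
it the one over \<open>A\<close>, is a null set. But a null shadow with normals near \<open>w\<close> forces the surface area of
\<open>A\<close> to vanish, in contradiction to \<open>\<mu>(A) > 0\<close>.
\<close>

lemma reflection_contradiction: False
proof -
  obtain r where r: "0 < r"
    "\<And>v. v \<in> H \<Longrightarrow> norm (v - w) < r \<Longrightarrow> 0 < w \<bullet> v \<and> 2 * h (R v) \<le> h v \<and> norm (v - w) * norm b \<le> 1 / 2"
    using strict_gain_near_w by metis
  let ?U = "{v \<in> unit_sphere. v \<in> H \<and> 0 < w \<bullet> v}"
  define A where "A = {v \<in> unit_sphere. v \<in> H \<and> norm (v - w) < r}"
  have "{v. v \<in> H \<and> 0 < w \<bullet> v} = H \<inter> {v. 0 < w \<bullet> v}" by auto
  moreover have "H \<inter> {v. 0 < w \<bullet> v} \<in> sets borel"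
    using borel_H by (intro sets.Int) (auto simp: open_halfspace_gt)
  ultimately have U: "?U \<in> sphere_borel" by (intro sphere_borel_Collect) simp
  have "{v. v \<in> H \<and> norm (v - w) < r} = H \<inter> ball w r" by (auto simp: dist_norm norm_minus_commute)
  then have A: "A \<in> sphere_borel" unfolding A_def using borel_H by (intro sphere_borel_Collect) simp
  have AU: "A \<subseteq> ?U" using r(2) by (auto simp: A_def)
  define B where "B = ?U - A"
  have B: "B \<in> sphere_borel" "B \<subseteq> ?U" using U A by (auto simp: B_def sets.Diff)
  \<comment> \<open>halving the support function multiplies the density \<open>h powr (p - 1)\<close> by the inverse of \<open>\<gamma>\<close>\<close>
  define \<gamma> where "\<gamma> = (2::real) powr (p - 1)"
  have \<gamma>: "0 \<le> \<gamma>" "\<gamma> < 1" using p_less_1 by (auto simp: \<gamma>_def powr_less_one)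
  have pos: "0 < h v" if "v \<in> ?U" for v using that support_pos by auto
  have compA: "\<alpha> A \<le> ennreal \<gamma> * \<alpha> (R ` A)"
  proof (rule \<alpha>_compare[OF A])
    fix \<omega> assume \<omega>: "\<omega> \<in> sphere_borel" "\<omega> \<subseteq> A"
    show "\<H> (P \<omega>) \<le> ennreal \<gamma> * \<H> (P (R ` \<omega>))"
    proof (rule compare_reflected[OF w_H \<omega>(1) \<gamma>(1)])
      show "h v \<noteq> 0" if "v \<in> \<omega>" for v using pos[of v] that \<omega>(2) AU by force
      fix v assume v: "v \<in> \<omega>" "h (R v) \<noteq> 0"
      then have "0 < h (R v)" "2 * h (R v) \<le> h v"
        using support_nonneg[of "R v"] r(2)[of v] \<omega>(2) by (auto simp: A_def)
      then have "h v powr (p - 1) \<le> (2 * h (R v)) powr (p - 1)"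
        using p_less_1 by (intro powr_mono2') auto
      also have "\<dots> = \<gamma> * h (R v) powr (p - 1)"
        using \<open>0 < h (R v)\<close> by (simp add: \<gamma>_def powr_mult)
      finally show "h v powr (p - 1) \<le> \<gamma> * h (R v) powr (p - 1)" .
    qed
  qed (use AU in auto)
  have compB: "\<alpha> B \<le> 1 * \<alpha> (R ` B)"
  proof (rule \<alpha>_compare[OF B(1)])
    fix \<omega> assume \<omega>: "\<omega> \<in> sphere_borel" "\<omega> \<subseteq> B"
    have "\<H> (P \<omega>) \<le> ennreal 1 * \<H> (P (R ` \<omega>))"
    proof (rule compare_reflected[OF w_H \<omega>(1)])
      show "h v \<noteq> 0" if "v \<in> \<omega>" for v using pos[of v] that \<omega>(2) B by force
      fix v assume v: "v \<in> \<omega>" "h (R v) \<noteq> 0"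
      then have "0 < h (R v)" "h (R v) \<le> h v"
        using support_nonneg[of "R v"] support_R_le[of v] \<omega>(2) B(2) by auto
      then show "h v powr (p - 1) \<le> 1 * h (R v) powr (p - 1)"
        using p_less_1 powr_mono2'[of "p - 1" "h (R v)" "h v"] by simp
    qed simp
    then show "\<H> (P \<omega>) \<le> 1 * \<H> (P (R ` \<omega>))" by simp
  qed (use B in auto)
  have "\<H> (T ` K) \<le> \<alpha> ?U" by (rule shadow_le_upper)
  also have "\<dots> \<le> \<alpha> (A \<union> B)" by (rule \<alpha>_mono) (auto simp: B_def)
  also have "\<dots> \<le> \<alpha> A + \<alpha> B" by (rule \<alpha>_Un_le)
  also have "\<dots> \<le> ennreal \<gamma> * \<alpha> (R ` A) + \<alpha> (R ` B)" using compA compB by (intro add_mono) auto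
  finally have 1: "\<H> (T ` K) \<le> ennreal \<gamma> * \<alpha> (R ` A) + \<alpha> (R ` B)" .
  have "\<alpha> (R ` A) + \<alpha> (R ` B) \<le> \<alpha> (R ` A \<union> R ` B)"
  proof (rule \<alpha>_superadditive)
    have "A \<inter> B = {}" by (auto simp: B_def)
    then show "R ` A \<inter> R ` B = {}" by (simp add: image_Int[OF inj_reflect, symmetric])
    show "R ` A \<union> R ` B \<subseteq> {v. b \<bullet> v < 0}" using AU B(2) inner_b_R by auto
  qed (rule reflect_image_sphere_borel[OF A] reflect_image_sphere_borel[OF B(1)])+
  also have "\<dots> \<le> \<H> (T ` K)"
    by (intro hausdorff_measure_mono image_mono) (use frontier_subset_K in \<open>auto simp: reverse_spherical_image_def\<close>)
  finally have 2: "\<alpha> (R ` A) + \<alpha> (R ` B) \<le> ennreal \<gamma> * \<alpha> (R ` A) + \<alpha> (R ` B)" using 1 by (rule order_trans)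
  have "\<alpha> (R ` A) = 0"
  proof -
    obtain a where a: "\<alpha> (R ` A) = ennreal a" "0 \<le> a"
      using \<alpha>_finite[of "R ` A"] by (cases "\<alpha> (R ` A)") auto
    obtain c where c: "\<alpha> (R ` B) = ennreal c" "0 \<le> c"
      using \<alpha>_finite[of "R ` B"] by (cases "\<alpha> (R ` B)") auto
    have "ennreal (a + c) \<le> ennreal (\<gamma> * a + c)"
      using 2 a c \<gamma> by (simp add: ennreal_mult)
    then have "a + c \<le> \<gamma> * a + c" using a c \<gamma> by (simp add: ennreal_le_iff)
    then have "(1 - \<gamma>) * a \<le> 0" by (simp add: algebra_simps)
    then have "a = 0" using \<gamma>(2) a(2) by (simp add: mult_le_0_iff)
    then show ?thesis using a by simp
  qed
  then have \<alpha>A: "\<alpha> A = 0" using compA by simp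
  have wb: "w \<bullet> b \<noteq> 0" using inner_b_w by (simp add: inner_commute)
  obtain c where c: "0 < c" "\<And>E. E \<in> sets borel \<Longrightarrow> E \<subseteq> {x. w \<bullet> x = 0} \<Longrightarrow> \<H> (T ` E) = c * \<H> E"
    using proj_hyperplane_factor[OF wb] by metis
  have "\<H> (P A) \<le> 0"
  proof (rule ennreal_le_epsilon)
    fix e :: real assume e: "0 < e"
    obtain C where C: "compact C" "C \<subseteq> A" "\<H> (P (A - C)) \<le> ennreal e"
      using inner_regular_S[OF A e] by metis
    have "c * \<H> (P C) \<le> ennreal ((1 / (1 - 1/2)) ^ (DIM('a) - 1)) * \<alpha> C"
      by (rule factor_estimate(2)[OF wb _ _ c(2) C(1)])
        (use C(2) r(2) inner_b_w in \<open>auto simp: A_def inner_commute\<close>)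
    also have "\<alpha> C = 0" using \<alpha>_mono[OF C(2)] \<alpha>A by simp
    finally have PC: "\<H> (P C) = 0" using c(1) by (simp add: zero_less_iff_neq_zero)
    have "\<H> (P A) = \<H> (P C \<union> P (A - C))"
      using C(2) by (simp add: reverse_spherical_image_Un[symmetric] Un_absorb1)
    also have "\<dots> \<le> \<H> (P C) + \<H> (P (A - C))" by (rule hausdorff_measure_Un_le)
    finally show "\<H> (P A) \<le> 0 + ennreal e" using PC C(3) by simp
  qed
  then have "A \<in> null_sets S" using A by (simp add: null_sets_def emeasure_S)
  moreover have "absolutely_continuous S \<mu>"
    unfolding \<mu>_eq_density by (rule absolutely_continuousI_density) measurable
  ultimately have "emeasure \<mu> A = 0" by (auto simp: absolutely_continuous_def)
  moreover have "emeasure \<mu> A = emeasure \<mu> {v \<in> unit_sphere. norm (v - w) < r}"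
  proof -
    have "{v. norm (v - w) < r} \<in> sets borel" by measurable
    then have "{v \<in> unit_sphere. norm (v - w) < r} \<in> sphere_borel" by (rule sphere_borel_Collect)
    moreover have "A \<inter> H = {v \<in> unit_sphere. norm (v - w) < r} \<inter> H" by (auto simp: A_def)
    ultimately show ?thesis using A by (simp add: emeasure_\<mu>)
  qed
  ultimately show False using cap_pos[OF w_H norm_w r(1)] by simp
qed

end

theorem (in Lp_solution) no_solution: False
proof (rule reflection_direction)
  fix w b
  assume "norm w = 1" "w \<in> H" "h (- w) = 0" "\<And>y. y \<in> H \<Longrightarrow> b \<bullet> y = w \<bullet> y"
    "\<And>v. h v = 0 \<Longrightarrow> b \<bullet> v \<le> 0"
  then interpret Lp_solution_direction K p H w b by unfold_locales
  show False by (rule reflection_contradiction)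
qed

theorem theorem1p3:
  fixes p :: real and k :: nat and H :: "(real ^ 'n) set"
  assumes "CARD('n) \<ge> 2" and "p < 1"
    and "subspace H" and "dim H = k" and "1 \<le> k" and "k \<le> CARD('n) - 1"
  shows "\<not> (\<exists>K :: (real ^ 'n) set. convex_body K \<and> 0 \<in> K \<and>
           Lp_surface_area_measure p K = subspace_sphere_measure k H)"
proof
  assume "\<exists>K :: (real ^ 'n) set. convex_body K \<and> 0 \<in> K \<and>
           Lp_surface_area_measure p K = subspace_sphere_measure k H"
  then obtain K :: "(real ^ 'n) set" where "convex_body K" "0 \<in> K"
    "Lp_surface_area_measure p K = subspace_sphere_measure k H" by blast
  then interpret Lp_solution K p H
    using assms by unfold_locales auto
  show False by (rule no_solution)
qed

end
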